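(* Let $\Omega\subseteq\mathbb{R}^N$ be a bounded open set with $C^1$ boundary and let $s\in(0,1)$. Let $m\in\mathbb{N}\cup\{0\}$ and $f\in H^m(\Omega)$. Assume that $u\in H^1(\mathbb{R}^N)$ is a weak solution of $$\mathcal{L}u=f\qquad\text{in }\Omega.$$ Then $u\in H^{m+2}_{\mathrm{loc}}(\Omega)$.
   Context: $\mathcal{L}:=-\Delta+(-\Delta)^s$, where $(-\Delta)^s u(x)=c_{N,s}\,\mathrm{P.V.}\int_{\mathbb{R}^N}\frac{u(x)-u(y)}{|x-y|^{N+2s}}\,dy$ and $c_{N,s}=\Big(\int_{\mathbb{R}^N}\frac{1-\cos(\zeta_1)}{|\zeta|^{N+2s}}\,d\zeta\Big)^{-1}$. For $f\in L^2(\Omega)$, a function $u\in H^1(\mathbb{R}^N)$ is a weak solution of $\mathcal{L}u=f$ in $\Omega$ if for every $\varphi\in C_0^\infty(\Omega,\mathbb{R})$ $$\int_\Omega\langle\nabla u,\nabla\varphi\rangle\,dx+\frac{c_{N,s}}{2}\int_{\mathbb{R}^N\times\mathbb{R}^N}\frac{(u(x)-u(y))(\varphi(x)-\varphi(y))}{|x-y|^{N+2s}}\,dx\,dy=\int_\Omega f\varphi\,dx.$$ *)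

theory Defs
  imports "HOL-Analysis.Analysis"
begin

definition partial :: "'n::finite \<Rightarrow> (real^'n \<Rightarrow> real) \<Rightarrow> real^'n \<Rightarrow> real" where
  "partial i f x = frechet_derivative f (at x) (axis i 1)"

text \<open>
  A list of coordinate directions plays the role of a multi-index: its length is the order of the
  derivative. On smooth functions the order of the directions is irrelevant.
\<close>

fun partials :: "'n::finite list \<Rightarrow> (real^'n \<Rightarrow> real) \<Rightarrow> real^'n \<Rightarrow> real" where
  "partials [] f = f"
| "partials (i # is) f = partial i (partials is f)"

definition grad :: "(real^'n::finite \<Rightarrow> real) \<Rightarrow> real^'n \<Rightarrow> real^'n" where
  "grad f x = (\<chi> i. partial i f x)"

definition smooth :: "(real^'n::finite \<Rightarrow> real) \<Rightarrow> bool" where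
  "smooth f \<longleftrightarrow> (\<forall>is x. partials is f differentiable (at x))"

definition test_functions :: "(real^'n::finite) set \<Rightarrow> (real^'n \<Rightarrow> real) set" where
  "test_functions U =
    {\<phi>. smooth \<phi> \<and> compact (closure {x. \<phi> x \<noteq> 0}) \<and> closure {x. \<phi> x \<noteq> 0} \<subseteq> U}"

text \<open>
  Elements of the function spaces below are represented by functions on the whole space, of which
  only the values on \<open>U\<close> matter.
\<close>

definition L2 :: "(real^'n::finite) set \<Rightarrow> (real^'n \<Rightarrow> real) set" where
  "L2 U = {u. u \<in> borel_measurable (lebesgue_on U) \<and> integrable (lebesgue_on U) (\<lambda>x. (u x)\<^sup>2)}"

definition weak_derivative ::
  "(real^'n::finite) set \<Rightarrow> 'n list \<Rightarrow> (real^'n \<Rightarrow> real) \<Rightarrow> (real^'n \<Rightarrow> real) \<Rightarrow> bool" where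
  "weak_derivative U is u g \<longleftrightarrow>
    (\<forall>\<phi>\<in>test_functions U.
      (LINT x|lebesgue_on U. u x * partials is \<phi> x) =
      (-1) ^ length is * (LINT x|lebesgue_on U. g x * \<phi> x))"

definition sobolev :: "nat \<Rightarrow> (real^'n::finite) set \<Rightarrow> (real^'n \<Rightarrow> real) set" where
  "sobolev m U = {u \<in> L2 U. \<forall>is. length is \<le> m \<longrightarrow> (\<exists>g\<in>L2 U. weak_derivative U is u g)}"

definition sobolev_loc :: "nat \<Rightarrow> (real^'n::finite) set \<Rightarrow> (real^'n \<Rightarrow> real) set" where
  "sobolev_loc m U =
    {u. \<forall>V. open V \<and> compact (closure V) \<and> closure V \<subseteq> U \<longrightarrow> u \<in> sobolev m V}"

definition weak_gradient ::
  "(real^'n::finite) set \<Rightarrow> (real^'n \<Rightarrow> real) \<Rightarrow> (real^'n \<Rightarrow> real^'n) \<Rightarrow> bool" where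
  "weak_gradient U u G \<longleftrightarrow>
    (\<forall>i. (\<lambda>x. G x $ i) \<in> L2 U \<and> weak_derivative U [i] u (\<lambda>x. G x $ i))"

definition C1_function :: "(real^'n::finite \<Rightarrow> real) \<Rightarrow> bool" where
  "C1_function \<gamma> \<longleftrightarrow> (\<exists>D. (\<forall>x. GDERIV \<gamma> x :> D x) \<and> continuous_on UNIV D)"

text \<open>
  Near each boundary point, after relabelling and reorienting the coordinate axes, the set is the
  region above the graph of a \<open>C\<^sup>1\<close> function of the remaining \<open>N - 1\<close> variables. Such a function is
  encoded as a function \<open>\<gamma>\<close> on the whole space that does not depend on the \<open>k\<close>-th coordinate;
  \<open>\<sigma>\<close> is the orientation of the \<open>k\<close>-th axis.
\<close>

definition C1_boundary :: "(real^'n::finite) set \<Rightarrow> bool" where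
  "C1_boundary U \<longleftrightarrow>
    (\<forall>p\<in>frontier U. \<exists>r>0. \<exists>k. \<exists>\<sigma>\<in>{-1, 1::real}. \<exists>\<gamma>.
      C1_function \<gamma> \<and> (\<forall>x t. \<gamma> (x + t *\<^sub>R axis k 1) = \<gamma> x) \<and>
      U \<inter> ball p r = {x \<in> ball p r. \<sigma> * x $ k > \<gamma> x})"

definition frac_integral :: "'n::finite \<Rightarrow> real \<Rightarrow> real" where
  "frac_integral k s =
    (LINT \<zeta>::real^'n|lebesgue. (1 - cos (\<zeta> $ k)) / norm \<zeta> powr (real CARD('n) + 2 * s))"

text \<open>
  The index type has no distinguished first element; by the next lemma every coordinate may serve
  as \<open>\<zeta>\<^sub>1\<close> in the normalising constant \<open>c\<^sub>N\<^sub>,\<^sub>s\<close>.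
\<close>

lemma frac_integral_index_irrelevant:
  fixes k l :: "'n::finite"
  shows "frac_integral k s = frac_integral l s"
proof -
  define \<pi> where "\<pi> = Transposition.transpose k l"
  define T :: "real^'n \<Rightarrow> real^'n" where "T = (\<lambda>x. \<chi> i. x $ \<pi> i)"
  have inv: "\<pi> (\<pi> i) = i" for i by (simp add: \<pi>_def)
  have bij: "bij \<pi>" by (simp add: \<pi>_def)
  have TT: "T (T x) = x" for x by (simp add: T_def inv vec_eq_iff)
  have [measurable]: "T \<in> borel_measurable borel"
    unfolding T_def by (intro borel_measurable_continuous_onI continuous_intros)
  have vol: "emeasure lborel (T -` box a b) = (\<Prod>c\<in>Basis. (b - a) \<bullet> c)"
    if le: "\<And>c. c \<in> Basis \<Longrightarrow> a \<bullet> c \<le> b \<bullet> c" for a b :: "real^'n"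
  proof -
    have le': "a $ i \<le> b $ i" for i
      using le[of "axis i 1"] by (simp add: inner_axis)
    have "T -` box a b = box (T a) (T b)"
      by (auto simp: T_def mem_box_cart) (metis inv)+
    moreover have "emeasure lborel (box (T a) (T b)) = (\<Prod>c\<in>Basis. (T b - T a) \<bullet> c)"
      by (rule emeasure_lborel_box) (auto simp: Basis_vec_def inner_axis T_def le')
    moreover have P: "(\<Prod>c\<in>Basis. (v::real^'n) \<bullet> c) = (\<Prod>i\<in>UNIV. v $ i)" for v
    proof -
      have B: "(Basis :: (real^'n) set) = (\<lambda>i. axis i 1) ` UNIV"
        by (auto simp: Basis_vec_def)
      show ?thesis unfolding B
        by (subst prod.reindex) (auto simp: inner_axis inj_on_def axis_eq_axis)
    qed
    moreover have "(\<Prod>i\<in>UNIV. (T b - T a) $ i) = (\<Prod>i\<in>UNIV. (b - a) $ i)"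
      using prod.reindex_bij_betw[of \<pi> UNIV UNIV "\<lambda>i. (b - a) $ i"] bij
      by (simp add: T_def)
    ultimately show ?thesis by (metis P)
  qed
  have D: "distr lborel borel T = lborel"
    by (rule lborel_eqI[symmetric]) (simp_all add: emeasure_distr vol)
  define h :: "'n \<Rightarrow> real^'n \<Rightarrow> real"
    where "h j \<zeta> = (1 - cos (\<zeta> $ j)) / norm \<zeta> powr (real CARD('n) + 2 * s)" for j \<zeta>
  have [measurable]: "h j \<in> borel_measurable borel" for j
    unfolding h_def by measurable
  have n: "norm (T x) = norm x" for x
    unfolding norm_vec_def L2_set_def T_def
    using sum.reindex_bij_betw[of \<pi> UNIV UNIV "\<lambda>i. (norm (x $ i))\<^sup>2"] bij by simp
  have hT: "h k (T x) = h l x" for x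
    by (simp add: h_def n) (simp add: T_def \<pi>_def)
  have leb: "frac_integral j s = (LINT x|lborel. h j x)" for j
    by (simp add: frac_integral_def h_def[symmetric] integral_completion)
  have "(LINT x|lborel. h k x) = (LINT x|distr lborel borel T. h k x)" by (simp add: D)
  also have "\<dots> = (LINT x|lborel. h k (T x))" by (rule integral_distr) auto
  also have "\<dots> = (LINT x|lborel. h l x)" by (simp add: hT)
  finally show ?thesis by (simp add: leb)
qed

definition frac_const :: "'n::finite itself \<Rightarrow> real \<Rightarrow> real" where
  "frac_const _ s = inverse (frac_integral (SOME k::'n. True) s)"

definition weak_solution ::
  "(real^'n::finite) set \<Rightarrow> real \<Rightarrow> (real^'n \<Rightarrow> real) \<Rightarrow> (real^'n \<Rightarrow> real) \<Rightarrow> bool" where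
  "weak_solution \<Omega> s f u \<longleftrightarrow> u \<in> sobolev 1 UNIV \<and>
    (\<exists>G. weak_gradient UNIV u G \<and>
      (\<forall>\<phi>\<in>test_functions \<Omega>.
        (LINT x|lebesgue_on \<Omega>. G x \<bullet> grad \<phi> x) +
        frac_const TYPE('n) s / 2 *
          (LINT (x, y)|lebesgue.
            (u x - u y) * (\<phi> x - \<phi> y) / norm (x - y) powr (real CARD('n) + 2 * s)) =
        (LINT x|lebesgue_on \<Omega>. f x * \<phi> x)))"

end

theory Submission
  imports Defs
begin

text \<open>
  After the substitution \<open>y = x + z\<close> the nonlocal form reads
  \<open>\<integral> K(z) (\<integral> (u(x + z) - u(x)) (\<phi>(x + z) - \<phi>(x)) dx) dz\<close>: an average of translation-invariant forms on
  \<open>L\<^sup>2\<close>. It therefore commutes with mollification and with derivatives, and it is nonnegative up to a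
  multiple of the \<open>L\<^sup>2\<close> norm when \<open>w\<close> is tested against \<open>\<eta>\<^sup>2 w\<close>.

  For \<open>m = 0\<close>, let \<open>w\<close> be a partial derivative of a mollification of \<open>u\<close>. Testing its equation with
  \<open>\<eta>\<^sup>2 w\<close> bounds \<open>\<nabla>(\<eta> w)\<close> in \<open>L\<^sup>2\<close> by \<open>w\<close> and the mollified datum. By linearity the same bound holds for the
  difference of two mollifications, so the second derivatives converge in \<open>L\<^sup>2\<close> near every compact
  subset of \<open>\<Omega>\<close>, and no weak compactness is needed.

  For the induction on \<open>m\<close>, take a cutoff \<open>\<zeta>\<close>. By the case \<open>m = 0\<close> each partial derivative of \<open>\<zeta> u\<close> belongs
  to \<open>H\<^sup>1\<close> of the whole space, and where \<open>\<zeta> = 1\<close> it solves the same equation, with datum the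
  derivative of \<open>f\<close> plus a multiple of the derivative of \<open>K * ((1 - \<zeta>) u)\<close>. The latter function is
  smooth there because \<open>K\<close> is only evaluated away from the origin.
\<close>

subsection \<open>Square-integrable functions on Euclidean space\<close>

text \<open>The operator sees all of the space, while second derivatives of \<open>u\<close> are
  controlled only inside \<Omega>. A partial derivative of \<open>u\<close> therefore need not lie
  in H^1 of the whole space, as the argument demands of a solution, and the equation cannot simply
  be differentiated repeatedly; the cutoff repairs this at the price of a far-field datum. In the
  base case \<open>f\<close> is only square-integrable and is never differentiated: it stays paired
  with \<open>partial i \<psi>\<close>, a datum in divergence form, and the gradient term that this
  creates is absorbed into the left-hand side. The resulting constant does not depend on the
  function that is tested, so the estimate applies to differences of mollifications. The analysis is
  carried out with Borel functions on the whole space and \<open>lborel\<close>; locality enters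
  only through the supports of test functions. Translations, Fubini and convolutions are thus
  available without restricted or completed measures, and almost-everywhere equal representatives
  are exchanged only at the end. Half of the normalising constant is carried along as an abstract
  \<open>c\<close> with \<open>0 \<le> c\<close>.\<close>

definition sqint :: "('a::euclidean_space \<Rightarrow> real) \<Rightarrow> bool" where
  "sqint u \<longleftrightarrow> u \<in> borel_measurable borel \<and> integrable lborel (\<lambda>x. (u x)\<^sup>2)"

text \<open>The square of the L^2 norm. Estimates are kept in squared form, which is why triangle
  inequalities below carry a factor 2.\<close>

definition sqnorm :: "('a::euclidean_space \<Rightarrow> real) \<Rightarrow> real" where
  "sqnorm u = (LINT x|lborel. (u x)\<^sup>2)"

lemma sqint_measurable [measurable_dest]: "sqint u \<Longrightarrow> u \<in> borel_measurable borel"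
  by (simp add: sqint_def)

lemma sqint_integrable: "sqint u \<Longrightarrow> integrable lborel (\<lambda>x. (u x)\<^sup>2)"
  by (simp add: sqint_def)

lemma sqnorm_nonneg [simp]: "0 \<le> sqnorm u"
  by (simp add: sqnorm_def)

lemma sqnorm_eq_nn_integral:
  "sqint u \<Longrightarrow> ennreal (sqnorm u) = (\<integral>\<^sup>+x. ennreal ((u x)\<^sup>2) \<partial>lborel)"
  unfolding sqnorm_def by (subst nn_integral_eq_integral) (auto simp: sqint_def)

lemma sqintI_nn_integral:
  fixes u :: "'a::euclidean_space \<Rightarrow> real"
  assumes [measurable]: "u \<in> borel_measurable borel"
    and le: "(\<integral>\<^sup>+x. ennreal ((u x)\<^sup>2) \<partial>lborel) \<le> ennreal B" and "0 \<le> B"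
  shows "sqint u" "sqnorm u \<le> B"
proof -
  have "integrable lborel (\<lambda>x. (u x)\<^sup>2)"
    using order.strict_trans1[OF le, of \<infinity>] by (intro integrableI_bounded) auto
  then show s: "sqint u" by (simp add: sqint_def)
  from sqnorm_eq_nn_integral[OF s] le \<open>0 \<le> B\<close> show "sqnorm u \<le> B"
    by (metis ennreal_le_iff)
qed

lemma sqint_mono:
  fixes u v :: "'a::euclidean_space \<Rightarrow> real"
  assumes [measurable]: "u \<in> borel_measurable borel" and v: "sqint v"
    and le: "\<And>x. \<bar>u x\<bar> \<le> \<bar>v x\<bar>"
  shows "sqint u" "sqnorm u \<le> sqnorm v"
proof -
  have le2: "(u x)\<^sup>2 \<le> (v x)\<^sup>2" for x using le[of x] by (simp add: abs_le_square_iff)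
  show s: "sqint u" unfolding sqint_def
    using le2 by (auto intro!: Bochner_Integration.integrable_bound[OF sqint_integrable[OF v]])
  show "sqnorm u \<le> sqnorm v" unfolding sqnorm_def
    by (intro integral_mono sqint_integrable s v le2)
qed

lemma sqint_cmult: "sqint u \<Longrightarrow> sqint (\<lambda>x. c * u x)"
  by (auto simp: sqint_def power_mult_distrib)

lemma sqnorm_cmult: "sqnorm (\<lambda>x. c * u x) = c\<^sup>2 * sqnorm u"
  by (simp add: sqnorm_def power_mult_distrib)

lemma sqint_minus: "sqint u \<Longrightarrow> sqint (\<lambda>x. - u x)"
  using sqint_cmult[of u "-1"] by simp

lemma sqnorm_minus: "sqnorm (\<lambda>x. - u x) = sqnorm u"
  by (simp add: sqnorm_def)

lemma sqnorm_minus_commute: "sqnorm (\<lambda>x. u x - v x) = sqnorm (\<lambda>x. v x - u x)"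
  by (simp add: sqnorm_def power2_commute)

lemma sq_add_le: "(a + b)\<^sup>2 \<le> 2 * a\<^sup>2 + 2 * (b::real)\<^sup>2"
  using sum_squares_ge_zero[of "a - b" 0] by (simp add: power2_eq_square algebra_simps)

lemma
  fixes u v :: "'a::euclidean_space \<Rightarrow> real"
  assumes u: "sqint u" and v: "sqint v"
  shows sqint_add: "sqint (\<lambda>x. u x + v x)"
    and sqnorm_add_le: "sqnorm (\<lambda>x. u x + v x) \<le> 2 * sqnorm u + 2 * sqnorm v"
proof -
  note [measurable] = sqint_measurable[OF u] sqint_measurable[OF v]
  have int: "integrable lborel (\<lambda>x. 2 * (u x)\<^sup>2 + 2 * (v x)\<^sup>2)"
    using u v by (auto simp: sqint_def)
  show s: "sqint (\<lambda>x. u x + v x)" unfolding sqint_def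
    using sq_add_le by (auto intro!: Bochner_Integration.integrable_bound[OF int])
  have "sqnorm (\<lambda>x. u x + v x) \<le> (LINT x|lborel. 2 * (u x)\<^sup>2 + 2 * (v x)\<^sup>2)"
    unfolding sqnorm_def by (intro integral_mono sqint_integrable[OF s] int sq_add_le)
  then show "sqnorm (\<lambda>x. u x + v x) \<le> 2 * sqnorm u + 2 * sqnorm v"
    using u v by (simp add: sqnorm_def sqint_def)
qed

lemma
  fixes u v :: "'a::euclidean_space \<Rightarrow> real"
  assumes u: "sqint u" and v: "sqint v"
  shows sqint_diff: "sqint (\<lambda>x. u x - v x)"
    and sqnorm_diff_le: "sqnorm (\<lambda>x. u x - v x) \<le> 2 * sqnorm u + 2 * sqnorm v"
proof -
  have eq: "(\<lambda>x. u x - v x) = (\<lambda>x. u x + - v x)" by simp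
  show "sqint (\<lambda>x. u x - v x)"
    unfolding eq by (rule sqint_add[OF u sqint_minus[OF v]])
  show "sqnorm (\<lambda>x. u x - v x) \<le> 2 * sqnorm u + 2 * sqnorm v"
    unfolding eq using sqnorm_add_le[OF u sqint_minus[OF v]] by (simp only: sqnorm_minus)
qed

lemma sqnorm_triangle_le:
  fixes u v w :: "'a::euclidean_space \<Rightarrow> real"
  assumes "sqint u" "sqint v" "sqint w"
  shows "sqnorm (\<lambda>x. u x - w x) \<le> 2 * sqnorm (\<lambda>x. u x - v x) + 2 * sqnorm (\<lambda>x. v x - w x)"
  using sqnorm_add_le[OF sqint_diff[OF assms(1,2)] sqint_diff[OF assms(2,3)]] by simp

lemma
  fixes u g :: "'a::euclidean_space \<Rightarrow> real"
  assumes [measurable]: "g \<in> borel_measurable borel" and u: "sqint u"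
    and g: "\<And>x. \<bar>g x\<bar> \<le> B"
  shows sqint_mult_bounded: "sqint (\<lambda>x. g x * u x)"
    and sqnorm_mult_bounded: "sqnorm (\<lambda>x. g x * u x) \<le> B\<^sup>2 * sqnorm u"
proof -
  note [measurable] = sqint_measurable[OF u]
  have le: "\<bar>g x * u x\<bar> \<le> \<bar>B * u x\<bar>" for x
    using g[of x] by (auto simp: abs_mult intro!: mult_right_mono)
  show "sqint (\<lambda>x. g x * u x)" by (rule sqint_mono(1)[OF _ sqint_cmult[OF u] le]) simp
  show "sqnorm (\<lambda>x. g x * u x) \<le> B\<^sup>2 * sqnorm u"
    using sqint_mono(2)[OF _ sqint_cmult[OF u] le] by (simp add: sqnorm_cmult)
qed

lemma integrable_mult_sqint:
  fixes u v :: "'a::euclidean_space \<Rightarrow> real"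
  assumes u: "sqint u" and v: "sqint v"
  shows "integrable lborel (\<lambda>x. u x * v x)"
proof -
  note [measurable] = sqint_measurable[OF u] sqint_measurable[OF v]
  have le: "\<bar>a * b\<bar> \<le> a\<^sup>2 + b\<^sup>2" for a b :: real
  proof -
    have "2 * (\<bar>a\<bar> * \<bar>b\<bar>) \<le> a\<^sup>2 + b\<^sup>2"
      using sum_squares_bound[of "\<bar>a\<bar>" "\<bar>b\<bar>"] by (simp add: mult.assoc)
    moreover have "0 \<le> \<bar>a\<bar> * \<bar>b\<bar>" by (intro mult_nonneg_nonneg) auto
    ultimately show ?thesis unfolding abs_mult by linarith
  qed
  show ?thesis
  proof (rule Bochner_Integration.integrable_bound)
    show "integrable lborel (\<lambda>x. (u x)\<^sup>2 + (v x)\<^sup>2)"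
      using u v by (simp add: sqint_def)
    show "AE x in lborel. norm (u x * v x) \<le> norm ((u x)\<^sup>2 + (v x)\<^sup>2)"
      using le by (intro AE_I2) (simp only: real_norm_def abs_ge_self order.trans[OF le abs_ge_self])
  qed measurable
qed

text \<open>The quadratic polynomial in \<open>t\<close> given by \<open>sqnorm\<close> of
  \<open>t * u + v\<close> is nonnegative. If its leading coefficient vanishes, it is affine and
  hence constant.\<close>

lemma Cauchy_Schwarz_sqnorm:
  fixes u v :: "'a::euclidean_space \<Rightarrow> real"
  assumes u: "sqint u" and v: "sqint v"
  shows "(LINT x|lborel. u x * v x)\<^sup>2 \<le> sqnorm u * sqnorm v"
proof -
  define b where "b = (LINT x|lborel. u x * v x)"
  have *: "0 \<le> t\<^sup>2 * sqnorm u + 2 * t * b + sqnorm v" for t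
  proof -
    have "0 \<le> sqnorm (\<lambda>x. t * u x + v x)" by simp
    also have "\<dots> = (LINT x|lborel. t\<^sup>2 * (u x)\<^sup>2 + 2 * t * (u x * v x) + (v x)\<^sup>2)"
      unfolding sqnorm_def by (intro Bochner_Integration.integral_cong) (auto simp: power2_eq_square algebra_simps)
    also have "\<dots> = t\<^sup>2 * sqnorm u + 2 * t * b + sqnorm v"
      using integrable_mult_sqint[OF u v] u v by (simp add: sqnorm_def b_def sqint_def)
    finally show ?thesis .
  qed
  show ?thesis
  proof (cases "sqnorm u = 0")
    case True
    have "b = 0"
    proof (rule ccontr)
      assume "b \<noteq> 0"
      \<comment> \<open>This \<open>t\<close> gives the polynomial the value -1.\<close>
      then have "2 * (- (sqnorm v + 1) / (2 * b)) * b = - (sqnorm v + 1)" by simp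
      moreover have "(- (sqnorm v + 1) / (2 * b))\<^sup>2 * sqnorm u = 0" using True by (simp only: mult_zero_right)
      ultimately show False using *[of "- (sqnorm v + 1) / (2 * b)"] by linarith
    qed
    then show ?thesis by (simp add: b_def[symmetric])
  next
    case False
    then have pos: "0 < sqnorm u" using sqnorm_nonneg[of u] by linarith
    have "(b / sqnorm u)\<^sup>2 * sqnorm u = b\<^sup>2 / sqnorm u"
      using pos by (simp add: power2_eq_square)
    \<comment> \<open>The minimiser of the polynomial.\<close>
    with *[of "- b / sqnorm u"] have "b\<^sup>2 / sqnorm u \<le> sqnorm v"
      by (simp add: power2_eq_square)
    then show ?thesis using pos by (simp add: b_def[symmetric] field_simps)
  qed
qed

lemma abs_integral_mult_le:
  fixes u v :: "'a::euclidean_space \<Rightarrow> real"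
  assumes u: "sqint u" and v: "sqint v"
  shows "\<bar>LINT x|lborel. u x * v x\<bar> \<le> (sqnorm u + sqnorm v) / 2"
proof -
  have "\<bar>LINT x|lborel. u x * v x\<bar> \<le> sqrt (sqnorm u * sqnorm v)"
    using Cauchy_Schwarz_sqnorm[OF u v] real_le_rsqrt by fastforce
  also have "\<dots> \<le> (sqnorm u + sqnorm v) / 2"
    by (intro arith_geo_mean_sqrt) auto
  finally show ?thesis .
qed

lemma tendsto_integral_mult_sqint:
  fixes U :: "nat \<Rightarrow> 'a::euclidean_space \<Rightarrow> real"
  assumes U: "\<And>n. sqint (U n)" and u: "sqint u" and v: "sqint v"
    and lim: "(\<lambda>n. sqnorm (\<lambda>x. U n x - u x)) \<longlonglongrightarrow> 0"
  shows "(\<lambda>n. LINT x|lborel. U n x * v x) \<longlonglongrightarrow> (LINT x|lborel. u x * v x)"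
proof -
  have "(LINT x|lborel. (U n x - u x) * v x) = (LINT x|lborel. U n x * v x) - (LINT x|lborel. u x * v x)" for n
    using integrable_mult_sqint[OF U v] integrable_mult_sqint[OF u v]
    by (simp add: left_diff_distrib)
  then have le: "((LINT x|lborel. U n x * v x) - (LINT x|lborel. u x * v x))\<^sup>2
      \<le> sqnorm (\<lambda>x. U n x - u x) * sqnorm v" for n
    using Cauchy_Schwarz_sqnorm[OF sqint_diff[OF U u] v] by metis
  have "(\<lambda>n. ((LINT x|lborel. U n x * v x) - (LINT x|lborel. u x * v x))\<^sup>2) \<longlonglongrightarrow> 0"
    by (rule tendsto_sandwich[OF _ _ tendsto_const tendsto_mult_left_zero[OF lim]])
       (auto intro!: always_eventually le)
  then have "(\<lambda>n. sqrt (((LINT x|lborel. U n x * v x) - (LINT x|lborel. u x * v x))\<^sup>2)) \<longlonglongrightarrow> sqrt 0"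
    by (intro tendsto_intros)
  then show ?thesis by (subst LIM_zero_iff[symmetric]) (simp add: tendsto_rabs_zero_iff)
qed

section \<open>Invariance of Lebesgue measure under translation and reflection\<close>

lemma plus_eq_translate: "(+) z = (\<lambda>x. x + (z::'a::ab_semigroup_add))"
  by (rule ext) (rule add.commute)

lemma
  fixes f :: "'a::euclidean_space \<Rightarrow> real"
  shows lborel_integrable_translate: "integrable lborel f \<Longrightarrow> integrable lborel (\<lambda>x. f (x + z))"
    and lborel_integral_translate: "f \<in> borel_measurable borel \<Longrightarrow> (LINT x|lborel. f (x + z)) = (LINT x|lborel. f x)"
    and lborel_integral_reflect: "f \<in> borel_measurable borel \<Longrightarrow> (LINT x|lborel. f (z - x)) = (LINT x|lborel. f x)"
    and lborel_integrable_reflect: "integrable lborel f \<Longrightarrow> integrable lborel (\<lambda>x. f (z - x))"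
proof -
  have D: "distr lborel borel (\<lambda>x. x + z) = (lborel :: 'a measure)"
    by (subst plus_eq_translate[symmetric]) (rule lborel_distr_plus)
  have R: "distr lborel borel (\<lambda>x. z - x) = (lborel :: 'a measure)"
    using lborel_affine[of "-1" z] by (simp add: density_1)
  show "integrable lborel (\<lambda>x. f (x + z))" if "integrable lborel f"
    using that integrable_distr[of "\<lambda>x. x + z" lborel borel f] D by simp
  show "(LINT x|lborel. f (x + z)) = (LINT x|lborel. f x)" if "f \<in> borel_measurable borel"
    using integral_distr[of "\<lambda>x. x + z" lborel borel f] that by (simp add: D)
  show "(LINT x|lborel. f (z - x)) = (LINT x|lborel. f x)" if "f \<in> borel_measurable borel"
    using integral_distr[of "\<lambda>x. z - x" lborel borel f] that by (simp add: R)
  show "integrable lborel (\<lambda>x. f (z - x))" if "integrable lborel f"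
    using that integrable_distr[of "\<lambda>x. z - x" lborel borel f] R by simp
qed

lemma nn_integral_lborel_translate:
  fixes f :: "'a::euclidean_space \<Rightarrow> ennreal"
  assumes [measurable]: "f \<in> borel_measurable borel"
  shows "(\<integral>\<^sup>+x. f (x + z) \<partial>lborel) = (\<integral>\<^sup>+x. f x \<partial>lborel)"
proof -
  have D: "distr lborel borel (\<lambda>x. x + z) = (lborel :: 'a measure)"
    by (subst plus_eq_translate[symmetric]) (rule lborel_distr_plus)
  show ?thesis
    using nn_integral_distr[of "\<lambda>x. x + z" lborel borel f] by (simp add: D)
qed

lemma
  fixes u :: "'a::euclidean_space \<Rightarrow> real"
  assumes u: "sqint u"
  shows sqint_translate: "sqint (\<lambda>x. u (x + z))"
    and sqnorm_translate: "sqnorm (\<lambda>x. u (x + z)) = sqnorm u"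
proof -
  note [measurable] = sqint_measurable[OF u]
  show "sqint (\<lambda>x. u (x + z))"
    using lborel_integrable_translate[OF sqint_integrable[OF u]] by (simp add: sqint_def)
  show "sqnorm (\<lambda>x. u (x + z)) = sqnorm u"
    unfolding sqnorm_def by (rule lborel_integral_translate[of "\<lambda>x. (u x)\<^sup>2"]) measurable
qed

text \<open>Jensen's inequality for the square: the variance of \<open>g\<close> under the
  probability density \<open>p\<close> is nonnegative.\<close>

lemma weighted_integral_square_le:
  fixes p g :: "'a \<Rightarrow> real"
  assumes p: "integrable M p" "(LINT x|M. p x) = 1" "\<And>x. 0 \<le> p x"
    and g: "integrable M (\<lambda>x. p x * g x)" "integrable M (\<lambda>x. p x * (g x)\<^sup>2)"
  shows "(LINT x|M. p x * g x)\<^sup>2 \<le> (LINT x|M. p x * (g x)\<^sup>2)"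
proof -
  define a where "a = (LINT x|M. p x * g x)"
  have "0 \<le> (LINT x|M. p x * (g x - a)\<^sup>2)"
    by (intro Bochner_Integration.integral_nonneg) (auto simp: p)
  also have "\<dots> = (LINT x|M. p x * (g x)\<^sup>2 - 2 * a * (p x * g x) + a\<^sup>2 * p x)"
    by (intro Bochner_Integration.integral_cong) (auto simp: power2_eq_square algebra_simps)
  also have "\<dots> = (LINT x|M. p x * (g x)\<^sup>2) - 2 * a * a + a\<^sup>2"
    using p g by (simp add: a_def)
  finally show ?thesis by (simp add: a_def[symmetric] power2_eq_square)
qed

text \<open>The Riesz-Fischer argument: a rapidly converging subsequence converges almost
  everywhere, and Fatou's lemma along it bounds the distance of every late member of the full
  sequence to the pointwise limit.\<close>

lemma sqint_complete:
  fixes U :: "nat \<Rightarrow> 'a::euclidean_space \<Rightarrow> real"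
  assumes U: "\<And>n. sqint (U n)"
    and Cauchy: "\<And>e. e > 0 \<Longrightarrow> \<exists>M. \<forall>m\<ge>M. \<forall>n\<ge>M. sqnorm (\<lambda>x. U m x - U n x) < e"
  obtains p where "sqint p" "(\<lambda>n. sqnorm (\<lambda>x. U n x - p x)) \<longlonglongrightarrow> 0"
proof -
  note [measurable] = sqint_measurable[OF U]
  have "\<exists>M. \<forall>m\<ge>M. \<forall>n\<ge>M. sqnorm (\<lambda>x. U m x - U n x) < (1/4)^k" for k :: nat
    by (rule Cauchy) simp
  then obtain M where M: "\<And>k m n. m \<ge> M k \<Longrightarrow> n \<ge> M k \<Longrightarrow> sqnorm (\<lambda>x. U m x - U n x) < (1/4)^k"
    by metis
  \<comment> \<open>A running maximum, so that \<open>r k\<close> and \<open>r (Suc k)\<close> both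
    lie beyond \<open>M k\<close>.\<close>
  define r where "r k = (MAX i\<in>{..k}. M i)" for k
  have rM: "M k \<le> r k'" if "k \<le> k'" for k k'
    unfolding r_def using that by (intro Max_ge) auto
  have d: "sqnorm (\<lambda>x. U (r (Suc k)) x - U (r k) x) < (1/4)^k" for k
    using rM by (intro M) auto
  \<comment> \<open>The squared differences are below \<open>(1/4)^k\<close>. The weight
    \<open>2^k\<close> leaves a convergent series and is strong enough to sum the differences
    themselves pointwise.\<close>
  have "(\<integral>\<^sup>+x. (\<Sum>k. ennreal (2^k * (U (r (Suc k)) x - U (r k) x)\<^sup>2)) \<partial>lborel)
      = (\<Sum>k. \<integral>\<^sup>+x. ennreal (2^k * (U (r (Suc k)) x - U (r k) x)\<^sup>2) \<partial>lborel)"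
    by (rule nn_integral_suminf) measurable
  also have "\<dots> = (\<Sum>k. ennreal (2^k * sqnorm (\<lambda>x. U (r (Suc k)) x - U (r k) x)))"
    using sqnorm_eq_nn_integral[OF sqint_diff[OF U U]]
    by (simp add: ennreal_mult nn_integral_cmult)
  also have "\<dots> \<le> (\<Sum>k. ennreal ((1/2)^k))"
  proof (intro suminf_le ennreal_leI)
    show "2^k * sqnorm (\<lambda>x. U (r (Suc k)) x - U (r k) x) \<le> (1/2)^k" for k
      using mult_left_mono[OF less_imp_le[OF d[of k]], of "2^k"]
      by (simp add: power_mult_distrib[symmetric])
  qed auto
  also have "\<dots> = ennreal (\<Sum>k. (1/2)^k)"
    by (intro suminf_ennreal2) auto
  also have "\<dots> < \<infinity>" by simp
  finally have "AE x in lborel. (\<Sum>k. ennreal (2^k * (U (r (Suc k)) x - U (r k) x)\<^sup>2)) \<noteq> \<infinity>"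
    by (intro nn_integral_PInf_AE) auto
  then have AE: "AE x in lborel. convergent (\<lambda>k. U (r k) x)"
  proof eventually_elim
    case (elim x)
    have sm: "summable (\<lambda>k. 2^k * (U (r (Suc k)) x - U (r k) x)\<^sup>2)"
      using elim by (intro summable_suminf_not_top) auto
    have le: "norm (U (r (Suc k)) x - U (r k) x) \<le> 2^k * (U (r (Suc k)) x - U (r k) x)\<^sup>2 + (1/2)^k" for k
    proof -
      define b where "b = \<bar>U (r (Suc k)) x - U (r k) x\<bar>"
      define t where "t = sqrt (2^k)"
      have t: "t > 0" "t\<^sup>2 = 2^k" "(1/t)\<^sup>2 = (1/2)^k" by (auto simp: t_def power_divide)
      \<comment> \<open>The arithmetic-geometric mean inequality, balanced so that the weight
        \<open>2^k\<close> falls on the square and the remainder \<open>(1/2)^k\<close> is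
        summable.\<close>
      have "2 * (t * b) * (1/t) \<le> (t * b)\<^sup>2 + (1/t)\<^sup>2" by (rule sum_squares_bound)
      then have "2 * b \<le> 2^k * b\<^sup>2 + (1/2)^k" using t by (simp add: power_mult_distrib)
      moreover have "0 \<le> b" by (simp add: b_def)
      moreover have "norm (U (r (Suc k)) x - U (r k) x) = b" "(U (r (Suc k)) x - U (r k) x)\<^sup>2 = b\<^sup>2"
        by (simp_all add: b_def)
      ultimately show ?thesis by simp
    qed
    have "summable (\<lambda>k. 2^k * (U (r (Suc k)) x - U (r k) x)\<^sup>2 + (1/2)^k)"
      by (intro summable_add sm) (simp add: summable_geometric)
    then have "summable (\<lambda>k. U (r (Suc k)) x - U (r k) x)"
      by (rule summable_comparison_test'[OF _ le])
    then have "convergent (\<lambda>n. \<Sum>k<n. U (r (Suc k)) x - U (r k) x)"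
      by (simp add: summable_iff_convergent)
    then have "convergent (\<lambda>n. (U (r n) x - U (r 0) x) + U (r 0) x)"
      unfolding sum_lessThan_telescope[where f="\<lambda>k. U (r k) x"] by (rule convergent_add[OF _ convergent_const])
    then show ?case by simp
  qed
  \<comment> \<open>Where the subsequence diverges \<open>lim\<close> is an unspecified value; by
    \<open>AE\<close> this concerns a null set only.\<close>
  define p where "p x = lim (\<lambda>k. U (r k) x)" for x
  have [measurable]: "p \<in> borel_measurable borel" unfolding p_def by measurable
  have est: "sqint (\<lambda>x. U n x - p x)" "sqnorm (\<lambda>x. U n x - p x) \<le> (1/4)^k" if n: "n \<ge> M k" for n k
  proof -
    have "(\<integral>\<^sup>+x. ennreal ((U n x - p x)\<^sup>2) \<partial>lborel)
        = (\<integral>\<^sup>+x. liminf (\<lambda>j. ennreal ((U n x - U (r j) x)\<^sup>2)) \<partial>lborel)"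
    proof (rule nn_integral_cong_AE, use AE in eventually_elim)
      case (elim x)
      then have "(\<lambda>j. U (r j) x) \<longlonglongrightarrow> p x" by (simp add: p_def convergent_LIMSEQ_iff)
      then have "(\<lambda>j. ennreal ((U n x - U (r j) x)\<^sup>2)) \<longlonglongrightarrow> ennreal ((U n x - p x)\<^sup>2)"
        by (intro tendsto_ennrealI tendsto_intros)
      then show ?case using lim_imp_Liminf[OF sequentially_bot] by metis
    qed
    also have "\<dots> \<le> liminf (\<lambda>j. \<integral>\<^sup>+x. ennreal ((U n x - U (r j) x)\<^sup>2) \<partial>lborel)"
      by (intro nn_integral_liminf) measurable
    also have "\<dots> = liminf (\<lambda>j. ennreal (sqnorm (\<lambda>x. U n x - U (r j) x)))"
      by (simp add: sqnorm_eq_nn_integral[OF sqint_diff[OF U U]])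
    also have "\<dots> \<le> ennreal ((1/4)^k)"
    proof (rule Liminf_le)
      show "\<forall>\<^sub>F j in sequentially. ennreal (sqnorm (\<lambda>x. U n x - U (r j) x)) \<le> ennreal ((1/4)^k)"
        using eventually_ge_at_top[of k]
        by eventually_elim (rule ennreal_leI[OF less_imp_le[OF M[OF n rM]]])
    qed simp
    finally show "sqint (\<lambda>x. U n x - p x)" "sqnorm (\<lambda>x. U n x - p x) \<le> (1/4)^k"
      by (auto intro!: sqintI_nn_integral)
  qed
  have "sqint (\<lambda>x. U (M 0) x - (U (M 0) x - p x))"
    by (intro sqint_diff[OF U] est(1)[of 0]) simp
  then have p: "sqint p" by simp
  have "(\<lambda>n. sqnorm (\<lambda>x. U n x - p x)) \<longlonglongrightarrow> 0"
  proof (rule LIMSEQ_I)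
    fix e :: real assume "e > 0"
    obtain k where k: "(1/4)^k < e" using real_arch_pow_inv[OF \<open>e > 0\<close>, of "1/4"] by auto
    show "\<exists>N. \<forall>n\<ge>N. norm (sqnorm (\<lambda>x. U n x - p x) - 0) < e"
      using est(2)[of k] k by (intro exI[of _ "M k"]) force
  qed
  with p show thesis by (rule that)
qed

subsection \<open>Continuity of translations\<close>

definition transcont :: "('a::euclidean_space \<Rightarrow> real) \<Rightarrow> bool" where
  "transcont u \<longleftrightarrow> (\<forall>e>0. \<exists>d>0. \<forall>z. norm z < d \<longrightarrow> sqnorm (\<lambda>x. u (x + z) - u x) < e)"

text \<open>A three-term splitting in which the increments of \<open>u - U n\<close> cost at most
  four times its squared norm, whatever the shift.\<close>

lemma transcont_limit:
  fixes u :: "'a::euclidean_space \<Rightarrow> real"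
  assumes U: "\<And>n. sqint (U n)" "\<And>n. transcont (U n)" and u: "sqint u"
    and lim: "(\<lambda>n. sqnorm (\<lambda>x. U n x - u x)) \<longlonglongrightarrow> 0"
  shows "transcont u"
  unfolding transcont_def
proof (intro allI impI)
  fix e :: real assume "e > 0"
  \<comment> \<open>The total will be 2 (e/8) + 2 (4 e/16) = 3e/4.\<close>
  then have "e / 16 > 0" by simp
  from LIMSEQ_D[OF lim this] obtain n where n: "sqnorm (\<lambda>x. U n x - u x) < e / 16" by auto
  obtain d where d: "d > 0" "\<And>z. norm z < d \<Longrightarrow> sqnorm (\<lambda>x. U n (x + z) - U n x) < e / 8"
    using U(2)[of n, unfolded transcont_def, rule_format, of "e / 8"] \<open>e > 0\<close> by auto
  have "sqnorm (\<lambda>x. u (x + z) - u x) < e" if z: "norm z < d" for z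
  proof -
    let ?w = "\<lambda>x. u x - U n x"
    have w: "sqint ?w" by (intro sqint_diff u U)
    have "sqnorm (\<lambda>x. (U n (x + z) - U n x) + (?w (x + z) - ?w x))
      \<le> 2 * sqnorm (\<lambda>x. U n (x + z) - U n x) + 2 * sqnorm (\<lambda>x. ?w (x + z) - ?w x)"
      by (intro sqnorm_add_le sqint_diff sqint_translate u U)
    also have "sqnorm (\<lambda>x. ?w (x + z) - ?w x) \<le> 2 * sqnorm ?w + 2 * sqnorm ?w"
      using sqnorm_diff_le[OF sqint_translate[OF w] w] sqnorm_translate[OF w] by simp
    also have "sqnorm ?w = sqnorm (\<lambda>x. U n x - u x)" by (rule sqnorm_minus_commute)
    finally show ?thesis using n d(2)[OF z] \<open>e > 0\<close> by simp
  qed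
  with d(1) show "\<exists>d>0. \<forall>z. norm z < d \<longrightarrow> sqnorm (\<lambda>x. u (x + z) - u x) < e" by blast
qed

lemma sqnorm_tendsto_dominated:
  fixes u :: "'a::euclidean_space \<Rightarrow> real"
  assumes [measurable]: "\<And>n. U n \<in> borel_measurable borel" and u: "sqint u"
    and le: "\<And>n x. \<bar>U n x\<bar> \<le> \<bar>u x\<bar>" and lim: "\<And>x. (\<lambda>n. U n x) \<longlonglongrightarrow> u x"
  shows "(\<lambda>n. sqnorm (\<lambda>x. U n x - u x)) \<longlonglongrightarrow> 0"
proof -
  note [measurable] = sqint_measurable[OF u]
  have "(\<lambda>n. LINT x|lborel. (U n x - u x)\<^sup>2) \<longlonglongrightarrow> (LINT x|(lborel::'a measure). 0)"
  proof (rule integral_dominated_convergence[where w="\<lambda>x. 4 * (u x)\<^sup>2"])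
    show "integrable lborel (\<lambda>x. 4 * (u x)\<^sup>2)" using u by (simp add: sqint_def)
    show "AE x in lborel. (\<lambda>n. (U n x - u x)\<^sup>2) \<longlonglongrightarrow> 0"
    proof (rule AE_I2)
      fix x have "(\<lambda>n. (U n x - u x)\<^sup>2) \<longlonglongrightarrow> (u x - u x)\<^sup>2" by (intro tendsto_intros lim)
      then show "(\<lambda>n. (U n x - u x)\<^sup>2) \<longlonglongrightarrow> 0" by simp
    qed
    show "AE x in lborel. norm ((U n x - u x)\<^sup>2) \<le> 4 * (u x)\<^sup>2" for n
    proof (rule AE_I2)
      fix x
      have "\<bar>U n x - u x\<bar> \<le> 2 * \<bar>u x\<bar>" using le[of n x] by linarith
      then have "\<bar>U n x - u x\<bar>\<^sup>2 \<le> (2 * \<bar>u x\<bar>)\<^sup>2" by (intro power_mono) auto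
      then show "norm ((U n x - u x)\<^sup>2) \<le> 4 * (u x)\<^sup>2" by (simp add: power_mult_distrib)
    qed
  qed measurable
  then show ?thesis by (simp add: sqnorm_def)
qed

text \<open>Regularity of the measure sandwiches \<open>A\<close> between a compact \<open>K\<close>
  and an open \<open>U\<close>. A shift shorter than the distance from \<open>K\<close> to the
  complement of \<open>U\<close> keeps \<open>K\<close> inside \<open>U\<close>, so if exactly one
  of \<open>x\<close>, \<open>x + z\<close> lies in \<open>A\<close>, then one of the two lies in
  the thin set between \<open>K\<close> and \<open>U\<close>.\<close>

lemma transcont_indicator_bounded:
  fixes A :: "'a::euclidean_space set"
  assumes A: "A \<in> sets borel" "bounded A"
  shows "transcont (indicator A)"
  unfolding transcont_def
proof (intro allI impI)
  fix e :: real assume e: "e > 0"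
  have AL: "A \<in> sets lebesgue" using A(1) by simp
  obtain U where U: "open U" "A \<subseteq> U" "U - A \<in> lmeasurable" "emeasure lebesgue (U - A) < ennreal (e/4)"
    using sets_lebesgue_outer_open[OF AL, of "e/4"] e by auto
  obtain K where K: "closed K" "K \<subseteq> A" "A - K \<in> lmeasurable" "emeasure lebesgue (A - K) < ennreal (e/4)"
    using sets_lebesgue_inner_closed[OF AL, of "e/4"] e by auto
  have [measurable]: "U \<in> sets borel" "K \<in> sets borel" "A \<in> sets borel" using U K A by auto
  have "compact K" using K A(2) bounded_subset compact_eq_bounded_closed by blast
  then obtain d where d: "d > 0" "(\<Union>x\<in>K. ball x d) \<subseteq> U"
    using U K compact_subset_open_imp_ball_epsilon_subset[of K U] by blast
  have fin: "integrable lborel (indicator (U - A) :: 'a \<Rightarrow> real)" "integrable lborel (indicator (A - K) :: 'a \<Rightarrow> real)"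
    using U(4) K(4) by (auto simp: integrable_indicator_iff intro: order.strict_trans)
  have m: "measure lborel (U - A) < e/4" "measure lborel (A - K) < e/4"
    using U(4) K(4) e by (auto simp: measure_def enn2real_less_iff order.strict_trans simp del: divide_le_eq_numeral1 less_divide_eq_numeral1)
  have "sqnorm (\<lambda>x. indicator A (x + z) - indicator A x) < e" if z: "norm z < d" for z
  proof -
    let ?b = "\<lambda>x. indicator (A - K) x + indicator (U - A) x :: real"
    have ib: "integrable lborel ?b" using fin by auto
    have nb: "x \<in> U \<and> x + z \<in> U" if "x \<in> K \<or> x + z \<in> K" for x
    proof (cases "x \<in> K")
      case True
      have "x + z \<in> ball x d" using z by (simp add: dist_norm)
      with True d U K show ?thesis by blast
    next
      case False
      have "x \<in> ball (x + z) d" using z by (simp add: dist_norm)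
      with False that d U K show ?thesis by blast
    qed
    have le: "(indicator A (x + z) - indicator A x)\<^sup>2 \<le> ?b x + ?b (x + z)" for x
    proof (cases "(x \<in> A) = (x + z \<in> A)")
      case True
      then show ?thesis by (simp add: indicator_def)
    next
      case False
      then have "1 \<le> ?b x + ?b (x + z)"
        using nb[of x] K(2) U(2) by (cases "x \<in> A"; cases "x \<in> K"; cases "x + z \<in> K") (auto simp: indicator_def)
      with False show ?thesis by (cases "x \<in> A") (simp_all add: indicator_def)
    qed
    have bm: "?b \<in> borel_measurable borel" by measurable
    have ib2: "integrable lborel (\<lambda>x. ?b x + ?b (x + z))"
      by (rule Bochner_Integration.integrable_add[OF ib lborel_integrable_translate[OF ib]])
    have "sqnorm (\<lambda>x. indicator A (x + z) - indicator A x) \<le> (LINT x|lborel. ?b x + ?b (x + z))"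
      unfolding sqnorm_def
      by (intro integral_mono' le ib2) (auto simp: zero_le_power2)
    also have "\<dots> = (LINT x|lborel. ?b x) + (LINT x|lborel. ?b (x + z))"
      by (rule Bochner_Integration.integral_add[OF ib lborel_integrable_translate[OF ib]])
    also have "(LINT x|lborel. ?b (x + z)) = (LINT x|lborel. ?b x)"
      by (rule lborel_integral_translate[OF bm])
    also have "(LINT x|lborel. ?b x) = measure lborel (A - K) + measure lborel (U - A)"
      using fin by simp
    finally show ?thesis using m by simp
  qed
  with d(1) show "\<exists>d>0. \<forall>z. norm z < d \<longrightarrow> sqnorm (\<lambda>x. indicator A (x + z) - indicator A x) < e"
    by blast
qed

lemma transcont_cmult:
  assumes "sqint u" "transcont u" shows "transcont (\<lambda>x. c * u x)"
  unfolding transcont_def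
proof (intro allI impI)
  fix e :: real assume e: "e > 0"
  have "e / (c\<^sup>2 + 1) > 0" using e by (simp add: add_nonneg_pos)
  then obtain d where d: "d > 0" "\<And>z. norm z < d \<Longrightarrow> sqnorm (\<lambda>x. u (x + z) - u x) < e / (c\<^sup>2 + 1)"
    using assms(2)[unfolded transcont_def, rule_format, of "e / (c\<^sup>2 + 1)"] by auto
  have "sqnorm (\<lambda>x. c * u (x + z) - c * u x) < e" if "norm z < d" for z
  proof -
    have "sqnorm (\<lambda>x. c * u (x + z) - c * u x) = c\<^sup>2 * sqnorm (\<lambda>x. u (x + z) - u x)"
      using sqnorm_cmult[of c "\<lambda>x. u (x + z) - u x"] by (simp add: right_diff_distrib)
    also have "\<dots> \<le> (c\<^sup>2 + 1) * sqnorm (\<lambda>x. u (x + z) - u x)" by (intro mult_right_mono) auto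
    also have "\<dots> < e"
    proof -
      have "0 < c\<^sup>2 + 1" by (intro add_nonneg_pos) auto
      with d(2)[OF that] show ?thesis by (subst (asm) pos_less_divide_eq) (auto simp only: mult.commute)
    qed
    finally show ?thesis .
  qed
  with d(1) show "\<exists>d>0. \<forall>z. norm z < d \<longrightarrow> sqnorm (\<lambda>x. c * u (x + z) - c * u x) < e" by blast
qed

lemma transcont_add:
  assumes u: "sqint u" "transcont u" and v: "sqint v" "transcont v"
  shows "transcont (\<lambda>x. u x + v x)"
  unfolding transcont_def
proof (intro allI impI)
  fix e :: real assume e: "e > 0"
  then have "e / 4 > 0" by simp
  then obtain d d' where d: "d > 0" "\<And>z. norm z < d \<Longrightarrow> sqnorm (\<lambda>x. u (x + z) - u x) < e / 4"
    and d': "d' > 0" "\<And>z. norm z < d' \<Longrightarrow> sqnorm (\<lambda>x. v (x + z) - v x) < e / 4"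
    using u(2)[unfolded transcont_def, rule_format, of "e / 4"] v(2)[unfolded transcont_def, rule_format, of "e / 4"]
    by blast
  have "sqnorm (\<lambda>x. u (x + z) + v (x + z) - (u x + v x)) < e" if "norm z < min d d'" for z
    using sqnorm_add_le[OF sqint_diff[OF sqint_translate[OF u(1)] u(1)] sqint_diff[OF sqint_translate[OF v(1)] v(1)], of z z]
      d(2)[of z] d'(2)[of z] that by (simp add: algebra_simps)
  with d(1) d'(1) show "\<exists>d>0. \<forall>z. norm z < d \<longrightarrow> sqnorm (\<lambda>x. u (x + z) + v (x + z) - (u x + v x)) < e"
    by (intro exI[of _ "min d d'"]) auto
qed

text \<open>Square integrability is a premise inside the conclusion so that the measurable-function
  induction passes through it: summands and monotone approximants inherit it by domination. An
  indicator is first cut off by balls, because the preceding regularity argument needs a bounded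
  set.\<close>

lemma transcont_nonneg:
  fixes u :: "'a::euclidean_space \<Rightarrow> real"
  assumes "u \<in> borel_measurable borel" "\<And>x. 0 \<le> u x"
  shows "sqint u \<longrightarrow> transcont u"
  using assms
proof (induction u rule: borel_measurable_induct_real)
  case (set A)
  show ?case
  proof
    assume A: "sqint (indicator A :: 'a \<Rightarrow> real)"
    note [measurable] = set
    let ?U = "\<lambda>n. indicator (A \<inter> ball 0 (real n)) :: 'a \<Rightarrow> real"
    have "(\<lambda>n. ?U n x) \<longlonglongrightarrow> indicator A x" for x
    proof (rule tendsto_eventually)
      obtain N :: nat where N: "norm x < real N" using reals_Archimedean2 by blast
      show "\<forall>\<^sub>F n in sequentially. ?U n x = indicator A x"
        using eventually_ge_at_top[of N] by eventually_elim (use N in \<open>auto split: split_indicator\<close>)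
    qed
    moreover have U: "?U n \<in> borel_measurable borel" for n
      using set by (intro borel_measurable_indicator) auto
    ultimately have lim: "(\<lambda>n. sqnorm (\<lambda>x. ?U n x - indicator A x)) \<longlonglongrightarrow> 0"
      by (intro sqnorm_tendsto_dominated A) (auto split: split_indicator)
    show "transcont (indicator A :: 'a \<Rightarrow> real)"
    proof (rule transcont_limit[OF _ _ A lim])
      show "sqint (?U n)" for n
        by (rule sqint_mono(1)[OF U A]) (auto split: split_indicator)
      show "transcont (?U n)" for n
        by (rule transcont_indicator_bounded) auto
    qed
  qed
next
  case (mult u c)
  show ?case
  proof
    assume s: "sqint (\<lambda>x. c * u x)"
    show "transcont (\<lambda>x. c * u x)"
    proof (cases "c = 0")
      case False
      with sqint_cmult[OF s, of "1/c"] have "sqint u" by simp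
      with mult show ?thesis by (simp add: transcont_cmult)
    qed (auto simp: transcont_def sqnorm_def intro: exI[of _ 1])
  qed
next
  case (add u v)
  show ?case
  proof
    assume s: "sqint (\<lambda>x. v x + u x)"
    have "sqint u" "sqint v"
      using add by (auto intro!: sqint_mono(1)[OF _ s])
    then show "transcont (\<lambda>x. v x + u x)"
      using add by (auto intro: transcont_add)
  qed
next
  case (seq U)
  show ?case
  proof
    assume s: "sqint u"
    have le: "\<bar>U i x\<bar> \<le> \<bar>u x\<bar>" for i x
    proof -
      have "U i x \<le> u x"
        using seq by (intro incseq_le) (auto simp: incseq_def le_fun_def)
      with seq(2)[of i x] show ?thesis by simp
    qed
    have sU: "sqint (U i)" for i
      using seq by (intro sqint_mono(1)[OF _ s le]) simp
    have "(\<lambda>n. sqnorm (\<lambda>x. U n x - u x)) \<longlonglongrightarrow> 0"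
      using seq by (intro sqnorm_tendsto_dominated s le) auto
    moreover have "transcont (U i)" for i using seq sU by blast
    ultimately show "transcont u" by (intro transcont_limit[OF sU _ s])
  qed
qed

lemma sqint_imp_transcont:
  fixes u :: "'a::euclidean_space \<Rightarrow> real"
  assumes u: "sqint u"
  shows "transcont u"
proof -
  note [measurable] = sqint_measurable[OF u]
  have p: "sqint (\<lambda>x. max 0 (u x))" by (rule sqint_mono(1)[OF _ u]) auto
  have n: "sqint (\<lambda>x. max 0 (- u x))" by (rule sqint_mono(1)[OF _ u]) auto
  have "transcont (\<lambda>x. max 0 (u x))" "transcont (\<lambda>x. max 0 (- u x))"
    using transcont_nonneg[of "\<lambda>x. max 0 (u x)"] transcont_nonneg[of "\<lambda>x. max 0 (- u x)"] p n by auto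
  then have "transcont (\<lambda>x. max 0 (u x) + (-1) * max 0 (- u x))"
    by (intro transcont_add transcont_cmult sqint_cmult p n)
  moreover have "(\<lambda>x. max 0 (u x) + (-1) * max 0 (- u x)) = u" by (auto simp: max_def)
  ultimately show ?thesis by simp
qed

subsection \<open>Smooth functions\<close>

lemma has_derivative_partial:
  fixes f :: "real^'n::finite \<Rightarrow> real"
  assumes "f differentiable (at x)"
  shows "(f has_derivative (\<lambda>h. \<Sum>i\<in>UNIV. h $ i * partial i f x)) (at x)"
proof -
  let ?D = "frechet_derivative f (at x)"
  have D: "(f has_derivative ?D) (at x)" using assms frechet_derivative_works by blast
  then have lin: "linear ?D" by (rule has_derivative_linear)
  have "?D = (\<lambda>h. \<Sum>i\<in>UNIV. h $ i * partial i f x)"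
  proof
    fix h
    have "?D h = ?D (\<Sum>i\<in>UNIV. h $ i *\<^sub>R axis i 1)"
      by (simp add: basis_expansion scalar_mult_eq_scaleR[symmetric])
    also have "\<dots> = (\<Sum>i\<in>UNIV. h $ i * partial i f x)"
      by (simp add: linear_sum[OF lin] linear_scale[OF lin] partial_def)
    finally show "?D h = (\<Sum>i\<in>UNIV. h $ i * partial i f x)" .
  qed
  with D show ?thesis by simp
qed

lemma partial_eqI: "(f has_derivative f') (at x) \<Longrightarrow> partial i f x = f' (axis i 1)"
  unfolding partial_def by (metis frechet_derivative_at)

lemma has_real_derivative_axis:
  fixes f :: "real^'n::finite \<Rightarrow> real"
  assumes "f differentiable (at (x + t *\<^sub>R axis i 1))"
  shows "((\<lambda>t. f (x + t *\<^sub>R axis i 1)) has_real_derivative partial i f (x + t *\<^sub>R axis i 1)) (at t)"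
proof -
  have "((\<lambda>t. x + t *\<^sub>R axis i 1) has_derivative (\<lambda>h. h *\<^sub>R axis i 1)) (at t)"
    by (auto intro!: derivative_eq_intros)
  from has_derivative_compose[OF this has_derivative_partial[OF assms]]
  have "((\<lambda>t. f (x + t *\<^sub>R axis i 1)) has_derivative
      (\<lambda>h. \<Sum>j\<in>UNIV. (h *\<^sub>R axis i 1 :: real^'n) $ j * partial j f (x + t *\<^sub>R axis i 1))) (at t)" .
  moreover have "(\<Sum>j\<in>UNIV. (h *\<^sub>R axis i 1 :: real^'n) $ j * g j) = g i * h" for h and g :: "'n \<Rightarrow> real"
  proof -
    have "(\<Sum>j\<in>UNIV. (h *\<^sub>R axis i 1 :: real^'n) $ j * g j) = (\<Sum>j\<in>UNIV. if j = i then h * g j else 0)"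
      by (intro sum.cong) (auto simp: axis_def)
    then show ?thesis by simp
  qed
  ultimately show ?thesis by (simp add: has_field_derivative_def)
qed

lemma has_real_derivative_line:
  fixes f :: "real^'n::finite \<Rightarrow> real"
  assumes "f differentiable (at (x + t *\<^sub>R z))"
  shows "((\<lambda>t. f (x + t *\<^sub>R z)) has_real_derivative (\<Sum>i\<in>UNIV. z $ i * partial i f (x + t *\<^sub>R z))) (at t)"
proof -
  have "((\<lambda>t. x + t *\<^sub>R z) has_derivative (\<lambda>h. h *\<^sub>R z)) (at t)"
    by (auto intro!: derivative_eq_intros)
  from has_derivative_compose[OF this has_derivative_partial[OF assms]]
  have "((\<lambda>t. f (x + t *\<^sub>R z)) has_derivative
      (\<lambda>h. \<Sum>j\<in>UNIV. (h *\<^sub>R z) $ j * partial j f (x + t *\<^sub>R z))) (at t)" .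
  moreover have "(\<Sum>j\<in>UNIV. (h *\<^sub>R z) $ j * g j) = (\<Sum>j\<in>UNIV. z $ j * g j) * h" for h and g :: "'n \<Rightarrow> real"
    by (simp add: sum_distrib_left sum_distrib_right mult_ac)
  ultimately show ?thesis by (simp add: has_field_derivative_def)
qed

text \<open>Smoothness is a greatest fixed point, so an invariant class of functions suffices and
  formulas for iterated derivatives never have to be written down.\<close>

lemma smooth_coinduct:
  assumes S: "f \<in> S" and diff: "\<And>g x. g \<in> S \<Longrightarrow> g differentiable (at x)"
    and closed: "\<And>g i. g \<in> S \<Longrightarrow> partial i g \<in> S"
  shows "smooth f"
proof -
  have "partials is f \<in> S" for "is" by (induction "is") (auto simp: S closed)
  then show ?thesis using diff by (auto simp: smooth_def)
qed

lemma smooth_differentiable: "smooth f \<Longrightarrow> f differentiable (at x)"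
  unfolding smooth_def by (metis partials.simps(1))

lemma partials_append: "partials (is @ js) f = partials is (partials js f)"
  by (induction "is") auto

lemma smooth_partials: "smooth f \<Longrightarrow> smooth (partials is f)"
  unfolding smooth_def by (metis partials_append)

lemma smooth_partial: "smooth f \<Longrightarrow> smooth (partial i f)"
  using smooth_partials[of f "[i]"] by simp

lemma smooth_continuous_on: "smooth f \<Longrightarrow> continuous_on A f"
  by (meson smooth_differentiable continuous_at_imp_continuous_on differentiable_imp_continuous_within)

lemma smooth_measurable [measurable_dest]: "smooth f \<Longrightarrow> f \<in> borel_measurable borel"
  by (intro borel_measurable_continuous_onI smooth_continuous_on)

lemma smooth_const: "smooth (\<lambda>x. c)"
proof (rule smooth_coinduct[where S="range (\<lambda>c x. c)"])
  show "partial i g \<in> range (\<lambda>c x. c)" if "g \<in> range (\<lambda>c x. c)" for g :: "real^'a \<Rightarrow> real" and i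
  proof -
    have "partial i g x = 0" for x
      using that by (intro partial_eqI[of _ "\<lambda>h. 0", simplified]) auto
    then show ?thesis by (auto simp: image_iff)
  qed
qed auto

lemma partial_add:
  "f differentiable (at x) \<Longrightarrow> g differentiable (at x) \<Longrightarrow>
    partial i (\<lambda>x. f x + g x) x = partial i f x + partial i g x"
  by (subst partial_eqI[OF has_derivative_add]) (auto simp: frechet_derivative_works partial_def)

lemma partial_mult:
  "f differentiable (at x) \<Longrightarrow> g differentiable (at x) \<Longrightarrow>
    partial i (\<lambda>x. f x * g x) x = f x * partial i g x + partial i f x * g x"
  by (subst partial_eqI[OF has_derivative_mult]) (auto simp: frechet_derivative_works partial_def)

text \<open>The algebra generated by \<open>B\<close>. Partial derivatives of products are sums of
  products, so this is the invariant class to feed into \<open>smooth_coinduct\<close>.\<close>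

inductive alg :: "((real^'n::finite \<Rightarrow> real) \<Rightarrow> bool) \<Rightarrow> (real^'n \<Rightarrow> real) \<Rightarrow> bool" for B where
  base: "B f \<Longrightarrow> alg B f"
| add: "alg B f \<Longrightarrow> alg B g \<Longrightarrow> alg B (\<lambda>x. f x + g x)"
| mult: "alg B f \<Longrightarrow> alg B g \<Longrightarrow> alg B (\<lambda>x. f x * g x)"

text \<open>Generators only have to differentiate into the algebra, not into \<open>B\<close>
  itself; the bump function below relies on this freedom.\<close>

lemma alg_smooth:
  assumes diff: "\<And>g x. B g \<Longrightarrow> g differentiable (at x)"
    and closed: "\<And>g i. B g \<Longrightarrow> alg B (partial i g)" and f: "alg B f"
  shows "smooth f"
proof (rule smooth_coinduct[where S="Collect (alg B)"])
  have *: "(\<forall>x. g differentiable (at x)) \<and> (\<forall>i. alg B (partial i g))" if "alg B g" for g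
    using that
  proof induction
    case (add f g)
    have "partial i (\<lambda>x. f x + g x) = (\<lambda>x. partial i f x + partial i g x)" for i
      using add by (auto simp: partial_add)
    with add show ?case by (auto intro: alg.add)
  next
    case (mult f g)
    have "partial i (\<lambda>x. f x * g x) = (\<lambda>x. f x * partial i g x + partial i f x * g x)" for i
      using mult by (auto simp: partial_mult)
    moreover have "alg B (\<lambda>x. f x * partial i g x + partial i f x * g x)" for i
      by (rule alg.add[OF alg.mult alg.mult]) (use mult in auto)
    ultimately show ?case using mult by auto
  qed (auto intro: diff closed)
  show "g differentiable (at x)" if "g \<in> Collect (alg B)" for g x using * that by blast
  show "partial i g \<in> Collect (alg B)" if "g \<in> Collect (alg B)" for g i using * that by blast
qed (use f in auto)

lemma smooth_add: "smooth f \<Longrightarrow> smooth g \<Longrightarrow> smooth (\<lambda>x. f x + g x)"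
  by (rule alg_smooth[where B=smooth]) (auto intro: alg.intros smooth_partial smooth_differentiable)

lemma smooth_mult: "smooth f \<Longrightarrow> smooth g \<Longrightarrow> smooth (\<lambda>x. f x * g x)"
  by (rule alg_smooth[where B=smooth]) (auto intro: alg.intros smooth_partial smooth_differentiable)

lemma smooth_cmult: "smooth f \<Longrightarrow> smooth (\<lambda>x. c * f x)"
  by (intro smooth_mult smooth_const)

lemma smooth_minus: "smooth f \<Longrightarrow> smooth (\<lambda>x. - f x)"
  using smooth_cmult[of f "-1"] by simp

lemma smooth_diff: "smooth f \<Longrightarrow> smooth g \<Longrightarrow> smooth (\<lambda>x. f x - g x)"
  using smooth_add[OF _ smooth_minus] by fastforce

lemma partial_const: "partial i (\<lambda>x. c) = (\<lambda>x. 0)"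
  by (rule ext, subst partial_eqI[of _ "\<lambda>h. 0"]) auto

lemma partial_cmult:
  assumes "f differentiable (at x)"
  shows "partial i (\<lambda>x. c * f x) x = c * partial i f x"
  by (subst partial_mult) (auto simp: assms partial_const)

lemma partial_diff:
  assumes "f differentiable (at x)" "g differentiable (at x)"
  shows "partial i (\<lambda>x. f x - g x) x = partial i f x - partial i g x"
  using has_derivative_diff[of f "frechet_derivative f (at x)" "at x" g "frechet_derivative g (at x)"] assms
  by (subst partial_eqI[of "\<lambda>x. f x - g x" "\<lambda>h. frechet_derivative f (at x) h - frechet_derivative g (at x) h"])
     (auto simp: frechet_derivative_works partial_def)

lemma partial_coord: "partial j (\<lambda>x::real^'n::finite. x $ i) = (\<lambda>x. if i = j then 1 else 0)"
proof
  fix x :: "real^'n"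
  have "((\<lambda>x::real^'n. x $ i) has_derivative (\<lambda>h. h $ i)) (at x)"
    by (intro bounded_linear_imp_has_derivative bounded_linear_vec_nth)
  from partial_eqI[OF this] show "partial j (\<lambda>x. x $ i) x = (if i = j then 1 else 0)"
    by (auto simp: axis_def)
qed

lemma smooth_coord: "smooth (\<lambda>x::real^'n::finite. x $ i)"
proof (rule smooth_coinduct[where S="insert (\<lambda>x. x $ i) (Collect smooth)"])
  fix g and x :: "real^'n" assume "g \<in> insert (\<lambda>x. x $ i) (Collect smooth)"
  then show "g differentiable (at x)"
    by (auto intro: smooth_differentiable bounded_linear_imp_differentiable bounded_linear_vec_nth)
next
  fix g :: "real^'n \<Rightarrow> real" and j assume "g \<in> insert (\<lambda>x. x $ i) (Collect smooth)"
  then show "partial j g \<in> insert (\<lambda>x. x $ i) (Collect smooth)"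
    using partial_coord[of j i] by (auto intro: smooth_partial smooth_const)
qed simp

lemma
  fixes f :: "real^'n::finite \<Rightarrow> real"
  assumes f: "smooth f"
  shows partial_affine: "partial i (\<lambda>x. f (a + c *\<^sub>R x)) = (\<lambda>x. c * partial i f (a + c *\<^sub>R x))"
    and smooth_affine: "smooth (\<lambda>x. f (a + c *\<^sub>R x))"
proof -
  have D: "((\<lambda>x. f (a + c *\<^sub>R x)) has_derivative (\<lambda>h. frechet_derivative f (at (a + c *\<^sub>R x)) (c *\<^sub>R h))) (at x)"
    if f: "smooth f" for f :: "real^'n \<Rightarrow> real" and x
  proof -
    have A: "((\<lambda>x. a + c *\<^sub>R x) has_derivative (\<lambda>h. c *\<^sub>R h)) (at x)"
      by (auto intro!: derivative_eq_intros)
    have B: "(f has_derivative frechet_derivative f (at (a + c *\<^sub>R x))) (at (a + c *\<^sub>R x))"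
      using smooth_differentiable[OF f] frechet_derivative_works by blast
    show ?thesis by (rule has_derivative_compose[OF A B])
  qed
  have P: "partial i (\<lambda>x. f (a + c *\<^sub>R x)) = (\<lambda>x. c * partial i f (a + c *\<^sub>R x))"
    if f: "smooth f" for f :: "real^'n \<Rightarrow> real" and i
  proof
    fix x
    have lin: "linear (frechet_derivative f (at (a + c *\<^sub>R x)))"
      using smooth_differentiable[OF f] linear_frechet_derivative by blast
    show "partial i (\<lambda>x. f (a + c *\<^sub>R x)) x = c * partial i f (a + c *\<^sub>R x)"
      unfolding partial_eqI[OF D[OF f]] by (simp add: linear_scale[OF lin] partial_def)
  qed
  show "partial i (\<lambda>x. f (a + c *\<^sub>R x)) = (\<lambda>x. c * partial i f (a + c *\<^sub>R x))" by (rule P[OF f])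
  let ?S = "{\<lambda>x. g (a + c *\<^sub>R x) |g. smooth g}"
  show "smooth (\<lambda>x. f (a + c *\<^sub>R x))"
  proof (rule smooth_coinduct[where S="?S"])
    show "(\<lambda>x. f (a + c *\<^sub>R x)) \<in> ?S" using f by blast
    show "g differentiable (at x)" if "g \<in> ?S" for g x using that D differentiable_def by blast
    show "partial i g \<in> ?S" if g: "g \<in> ?S" for g i
    proof -
      from g obtain h where h: "smooth h" "g = (\<lambda>x. h (a + c *\<^sub>R x))" by blast
      have "partial i g = (\<lambda>x. (\<lambda>y. c * partial i h y) (a + c *\<^sub>R x))" using P[OF h(1)] h(2) by simp
      moreover have "smooth (\<lambda>y. c * partial i h y)" by (intro smooth_cmult smooth_partial h)
      ultimately show ?thesis by (intro CollectI exI[of _ "\<lambda>y. c * partial i h y"]) auto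
    qed
  qed
qed

lemma
  assumes f: "smooth f"
  shows partial_translate: "partial i (\<lambda>x. f (x + z)) = (\<lambda>x. partial i f (x + z))"
    and smooth_translate: "smooth (\<lambda>x. f (x + z))"
    and partial_reflect: "partial i (\<lambda>x. f (z - x)) = (\<lambda>x. - partial i f (z - x))"
    and smooth_reflect: "smooth (\<lambda>x. f (z - x))"
  using partial_affine[OF f, of i z 1] smooth_affine[OF f, of z 1]
    partial_affine[OF f, of i z "-1"] smooth_affine[OF f, of z "-1"]
  by (simp_all add: add.commute)

text \<open>The mean value theorem is applied first in direction \<open>i\<close> to a difference in
  direction \<open>j\<close>, then in direction \<open>j\<close> to the derivative so
  obtained.\<close>

lemma second_difference_mvt:
  fixes f :: "real^'n::finite \<Rightarrow> real"
  assumes f: "smooth f" and h: "h > 0"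
  obtains s t where "0 < s" "s < h" "0 < t" "t < h"
    "f (x + h *\<^sub>R axis i 1 + h *\<^sub>R axis j 1) - f (x + h *\<^sub>R axis i 1) - f (x + h *\<^sub>R axis j 1) + f x
      = h\<^sup>2 * partial j (partial i f) (x + s *\<^sub>R axis i 1 + t *\<^sub>R axis j 1)"
proof -
  let ?i = "axis i 1 :: real^'n" and ?j = "axis j 1 :: real^'n"
  have sw: "x + s *\<^sub>R ?i + h *\<^sub>R ?j = x + h *\<^sub>R ?j + s *\<^sub>R ?i" for s
    by (simp only: add.assoc add.commute[of "s *\<^sub>R ?i"])
  have "\<exists>s>0. s < h \<and> (f ((x + h *\<^sub>R ?j) + h *\<^sub>R ?i) - f (x + h *\<^sub>R ?i)) - (f ((x + h *\<^sub>R ?j) + 0 *\<^sub>R ?i) - f (x + 0 *\<^sub>R ?i))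
      = (h - 0) * (partial i f ((x + h *\<^sub>R ?j) + s *\<^sub>R ?i) - partial i f (x + s *\<^sub>R ?i))"
    by (rule MVT2[OF h]) (intro DERIV_diff has_real_derivative_axis smooth_differentiable f)
  then obtain s where s: "0 < s" "s < h"
    "(f (x + h *\<^sub>R ?j + h *\<^sub>R ?i) - f (x + h *\<^sub>R ?i)) - (f (x + h *\<^sub>R ?j) - f x)
      = h * (partial i f ((x + h *\<^sub>R ?j) + s *\<^sub>R ?i) - partial i f (x + s *\<^sub>R ?i))" by auto
  have "\<exists>t>0. t < h \<and> partial i f ((x + s *\<^sub>R ?i) + h *\<^sub>R ?j) - partial i f ((x + s *\<^sub>R ?i) + 0 *\<^sub>R ?j)
      = (h - 0) * partial j (partial i f) ((x + s *\<^sub>R ?i) + t *\<^sub>R ?j)"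
    by (rule MVT2[OF h]) (intro has_real_derivative_axis smooth_differentiable smooth_partial f)
  then obtain t where t: "0 < t" "t < h"
    "partial i f (x + s *\<^sub>R ?i + h *\<^sub>R ?j) - partial i f (x + s *\<^sub>R ?i)
      = h * partial j (partial i f) (x + s *\<^sub>R ?i + t *\<^sub>R ?j)" by auto
  have "f (x + h *\<^sub>R ?i + h *\<^sub>R ?j) - f (x + h *\<^sub>R ?i) - f (x + h *\<^sub>R ?j) + f x
      = h\<^sup>2 * partial j (partial i f) (x + s *\<^sub>R ?i + t *\<^sub>R ?j)"
    using s(3) unfolding sw[symmetric] t(3) power2_eq_square mult.assoc by linarith
  with s t show thesis by (intro that)
qed

text \<open>The second difference is symmetric in the two directions, whereas
  \<open>second_difference_mvt\<close> expresses it by either mixed derivative at a nearby point;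
  continuity of both excludes a gap between them.\<close>

lemma partial_commute:
  fixes f :: "real^'n::finite \<Rightarrow> real"
  assumes f: "smooth f"
  shows "partial i (partial j f) = partial j (partial i f)"
proof
  fix x
  let ?p = "partial i (partial j f)" and ?q = "partial j (partial i f)"
  let ?i = "axis i 1 :: real^'n" and ?j = "axis j 1 :: real^'n"
  have "continuous_on UNIV ?p" "continuous_on UNIV ?q"
    by (intro smooth_continuous_on smooth_partial f)+
  then have c: "isCont ?p x" "isCont ?q x" by (auto simp: continuous_on_eq_continuous_at)
  show "?p x = ?q x"
  proof (rule ccontr)
    assume "?p x \<noteq> ?q x"
    then have e: "\<bar>?p x - ?q x\<bar> / 2 > 0" (is "?e > 0") by simp
    from c(1)[unfolded continuous_at_eps_delta, rule_format, OF e]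
    obtain d where d: "d > 0" "\<And>y. norm (y - x) < d \<Longrightarrow> norm (?p y - ?p x) < ?e"
      by (auto simp: dist_norm)
    from c(2)[unfolded continuous_at_eps_delta, rule_format, OF e]
    obtain d' where d': "d' > 0" "\<And>y. norm (y - x) < d' \<Longrightarrow> norm (?q y - ?q x) < ?e"
      by (auto simp: dist_norm)
    \<comment> \<open>The intermediate points lie within \<open>2 * h\<close> of \<open>x\<close>,
      which is the smaller of the two radii of continuity.\<close>
    define h where "h = min d d' / 2"
    have h: "h > 0" using d(1) d'(1) by (simp add: h_def)
    have near: "norm (x + s *\<^sub>R axis k 1 + t *\<^sub>R axis l 1 - x) < 2 * h"
      if "0 < s" "s < h" "0 < t" "t < h" for s t and k l :: 'n
    proof -
      have "norm (s *\<^sub>R axis k 1 + t *\<^sub>R axis l 1 :: real^'n) \<le> norm (s *\<^sub>R axis k 1 :: real^'n) + norm (t *\<^sub>R axis l 1 :: real^'n)"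
        by (rule norm_triangle_ineq)
      also have "\<dots> = s + t" using that by (simp add: norm_axis_1)
      finally show ?thesis using that by (simp add: add.assoc)
    qed
    obtain s t where st: "0 < s" "s < h" "0 < t" "t < h"
      "f (x + h *\<^sub>R ?i + h *\<^sub>R ?j) - f (x + h *\<^sub>R ?i) - f (x + h *\<^sub>R ?j) + f x
        = h\<^sup>2 * ?q (x + s *\<^sub>R ?i + t *\<^sub>R ?j)"
      using second_difference_mvt[OF f h] by metis
    obtain s' t' where st': "0 < s'" "s' < h" "0 < t'" "t' < h"
      "f (x + h *\<^sub>R ?j + h *\<^sub>R ?i) - f (x + h *\<^sub>R ?j) - f (x + h *\<^sub>R ?i) + f x
        = h\<^sup>2 * ?p (x + s' *\<^sub>R ?j + t' *\<^sub>R ?i)"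
      using second_difference_mvt[OF f h] by metis
    have sw: "x + h *\<^sub>R ?j + h *\<^sub>R ?i = x + h *\<^sub>R ?i + h *\<^sub>R ?j" by simp
    have "h\<^sup>2 * ?q (x + s *\<^sub>R ?i + t *\<^sub>R ?j) = h\<^sup>2 * ?p (x + s' *\<^sub>R ?j + t' *\<^sub>R ?i)"
      unfolding st(5)[symmetric] st'(5)[symmetric] sw by simp
    then have eq: "?q (x + s *\<^sub>R ?i + t *\<^sub>R ?j) = ?p (x + s' *\<^sub>R ?j + t' *\<^sub>R ?i)"
      using h by simp
    have "norm (?q (x + s *\<^sub>R ?i + t *\<^sub>R ?j) - ?q x) < ?e"
      by (rule d'(2)) (use near[OF st(1-4), of i j] in \<open>auto simp: h_def\<close>)
    moreover have "norm (?p (x + s' *\<^sub>R ?j + t' *\<^sub>R ?i) - ?p x) < ?e"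
      by (rule d(2)) (use near[OF st'(1-4), of j i] in \<open>auto simp: h_def\<close>)
    moreover define P where "P = ?p (x + s' *\<^sub>R ?j + t' *\<^sub>R ?i)"
    ultimately have "\<bar>P - ?q x\<bar> + \<bar>P - ?p x\<bar> < ?e + ?e"
      unfolding eq real_norm_def by (intro add_strict_mono) auto
    moreover have "\<bar>?p x - ?q x\<bar> \<le> \<bar>P - ?q x\<bar> + \<bar>P - ?p x\<bar>"
      using abs_triangle_ineq4[of "P - ?q x" "P - ?p x"] by simp
    ultimately show False unfolding field_sum_of_halves by simp
  qed
qed

subsection \<open>Test functions\<close>

lemma test_functionsI:
  assumes "smooth \<phi>" "compact K" "K \<subseteq> U" "\<And>x. x \<notin> K \<Longrightarrow> \<phi> x = 0"
  shows "\<phi> \<in> test_functions U"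
proof -
  have "closure {x. \<phi> x \<noteq> 0} \<subseteq> K"
    using assms by (intro closure_minimal compact_imp_closed) auto
  moreover from this have "compact (closure {x. \<phi> x \<noteq> 0})"
    using compact_imp_bounded[OF assms(2)] bounded_subset compact_eq_bounded_closed by blast
  ultimately show ?thesis using assms by (auto simp: test_functions_def)
qed

lemma test_functionsE:
  assumes "\<phi> \<in> test_functions U"
  obtains K where "smooth \<phi>" "compact K" "K \<subseteq> U" "\<And>x. x \<notin> K \<Longrightarrow> \<phi> x = 0"
proof (rule that[of "closure {x. \<phi> x \<noteq> 0}"])
  show "\<phi> x = 0" if "x \<notin> closure {x. \<phi> x \<noteq> 0}" for x
    using that closure_subset[of "{x. \<phi> x \<noteq> 0}"] by auto
qed (use assms in \<open>auto simp: test_functions_def\<close>)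

lemma test_smooth: "\<phi> \<in> test_functions U \<Longrightarrow> smooth \<phi>"
  by (simp add: test_functions_def)

lemma test_differentiable: "\<phi> \<in> test_functions U \<Longrightarrow> \<phi> differentiable (at x)"
  by (intro smooth_differentiable test_smooth)

lemma test_measurable [measurable_dest]: "\<phi> \<in> test_functions U \<Longrightarrow> \<phi> \<in> borel_measurable borel"
  by (intro smooth_measurable test_smooth)

lemma test_mono: "\<phi> \<in> test_functions U \<Longrightarrow> U \<subseteq> V \<Longrightarrow> \<phi> \<in> test_functions V"
  by (auto simp: test_functions_def)

lemma test_zero_outside: "\<phi> \<in> test_functions U \<Longrightarrow> x \<notin> U \<Longrightarrow> \<phi> x = 0"
  by (erule test_functionsE) blast

lemma partial_zero_off_closed:
  assumes "closed K" "\<And>x. x \<notin> K \<Longrightarrow> f x = 0" "x \<notin> K"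
  shows "partial i f x = 0"
proof -
  have "((\<lambda>x. 0) has_derivative (\<lambda>h. 0)) (at x)" by simp
  then have "(f has_derivative (\<lambda>h. 0)) (at x)"
    by (rule has_derivative_transform_within_open[of _ _ _ _ "- K"]) (use assms in auto)
  from partial_eqI[OF this] show ?thesis .
qed

lemma test_partial:
  assumes "\<phi> \<in> test_functions U" shows "partial i \<phi> \<in> test_functions U"
proof -
  from assms obtain K where K: "smooth \<phi>" "compact K" "K \<subseteq> U" "\<And>x. x \<notin> K \<Longrightarrow> \<phi> x = 0"
    by (rule test_functionsE) blast
  show ?thesis
    by (rule test_functionsI[OF smooth_partial[OF K(1)] K(2,3)])
       (rule partial_zero_off_closed[OF compact_imp_closed[OF K(2)] K(4)])
qed

lemma test_mult:
  assumes f: "smooth f" and \<phi>: "\<phi> \<in> test_functions U"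
  shows "(\<lambda>x. f x * \<phi> x) \<in> test_functions U"
proof -
  from \<phi> obtain K where K: "smooth \<phi>" "compact K" "K \<subseteq> U" "\<And>x. x \<notin> K \<Longrightarrow> \<phi> x = 0"
    by (rule test_functionsE) blast
  show ?thesis
    by (rule test_functionsI[OF smooth_mult[OF f K(1)] K(2,3)]) (simp add: K(4))
qed

lemma test_cmult: "\<phi> \<in> test_functions U \<Longrightarrow> (\<lambda>x. c * \<phi> x) \<in> test_functions U"
  by (rule test_mult[OF smooth_const])

lemma test_add:
  assumes "\<phi> \<in> test_functions U" "\<psi> \<in> test_functions U"
  shows "(\<lambda>x. \<phi> x + \<psi> x) \<in> test_functions U"
proof -
  from assms(1) obtain K where K: "smooth \<phi>" "compact K" "K \<subseteq> U" "\<And>x. x \<notin> K \<Longrightarrow> \<phi> x = 0"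
    by (rule test_functionsE) blast
  from assms(2) obtain L where L: "smooth \<psi>" "compact L" "L \<subseteq> U" "\<And>x. x \<notin> L \<Longrightarrow> \<psi> x = 0"
    by (rule test_functionsE) blast
  show ?thesis
    by (rule test_functionsI[OF smooth_add[OF K(1) L(1)] compact_Un[OF K(2) L(2)]]) (use K L in auto)
qed

lemma test_diff:
  assumes "\<phi> \<in> test_functions U" "\<psi> \<in> test_functions U"
  shows "(\<lambda>x. \<phi> x - \<psi> x) \<in> test_functions U"
  using test_add[OF assms(1) test_cmult[OF assms(2), of "-1"]] by simp

lemma
  assumes "\<phi> \<in> test_functions U"
  shows test_translate: "(\<lambda>x. \<phi> (x + z)) \<in> test_functions UNIV"
    and test_reflect: "(\<lambda>x. \<phi> (z - x)) \<in> test_functions UNIV"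
proof -
  from assms obtain K where K: "smooth \<phi>" "compact K" "K \<subseteq> U" "\<And>x. x \<notin> K \<Longrightarrow> \<phi> x = 0"
    by (rule test_functionsE) blast
  show "(\<lambda>x. \<phi> (x + z)) \<in> test_functions UNIV"
  proof (rule test_functionsI[OF smooth_translate[OF K(1)], where K="(\<lambda>x. x - z) ` K"])
    show "\<phi> (x + z) = 0" if "x \<notin> (\<lambda>x. x - z) ` K" for x
      using that by (intro K(4)) (auto simp: image_iff)
    show "compact ((\<lambda>x. x - z) ` K)"
      by (intro compact_continuous_image K(2) continuous_intros)
  qed auto
  show "(\<lambda>x. \<phi> (z - x)) \<in> test_functions UNIV"
  proof (rule test_functionsI[OF smooth_reflect[OF K(1)], where K="(\<lambda>x. z - x) ` K"])
    show "\<phi> (z - x) = 0" if "x \<notin> (\<lambda>x. z - x) ` K" for x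
      using that by (intro K(4)) (auto simp: image_iff)
    show "compact ((\<lambda>x. z - x) ` K)"
      by (intro compact_continuous_image K(2) continuous_intros)
  qed auto
qed

lemma test_radius:
  assumes "\<phi> \<in> test_functions U"
  obtains R where "R > 0" "\<And>x. R < norm x \<Longrightarrow> \<phi> x = 0"
proof -
  from assms obtain K where K: "smooth \<phi>" "compact K" "K \<subseteq> U" "\<And>x. x \<notin> K \<Longrightarrow> \<phi> x = 0"
    by (rule test_functionsE) blast
  obtain R where R: "R > 0" "\<And>x. x \<in> K \<Longrightarrow> norm x \<le> R"
    using compact_imp_bounded[OF K(2)] by (auto simp: bounded_pos)
  have "\<phi> x = 0" if "R < norm x" for x
    by (rule K(4)) (use R(2)[of x] that in auto)
  with R(1) show thesis by (rule that)
qed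

lemma
  fixes f :: "'a::euclidean_space \<Rightarrow> real"
  assumes f: "continuous_on UNIV f" and R: "\<And>x. R < norm x \<Longrightarrow> f x = 0"
  shows integrable_compact_support: "integrable lborel f"
    and bounded_compact_support: "\<exists>B>0. \<forall>x. \<bar>f x\<bar> \<le> B"
proof -
  have c: "continuous_on (cball 0 R) f" using f by (rule continuous_on_subset) simp
  have "(\<lambda>x. indicator (cball 0 R) x *\<^sub>R f x) = f"
    using R by (auto simp: indicator_def fun_eq_iff)
  with borel_integrable_compact[OF compact_cball c] show "integrable lborel f" by simp
  have "bounded (f ` cball 0 R)" by (intro compact_imp_bounded compact_continuous_image c compact_cball)
  then obtain B where B: "B > 0" "\<And>x. norm x \<le> R \<Longrightarrow> \<bar>f x\<bar> \<le> B" by (auto simp: bounded_pos)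
  have "\<bar>f x\<bar> \<le> B" for x
    using B(2)[of x] R[of x] B(1) by (cases "norm x \<le> R") auto
  with B(1) show "\<exists>B>0. \<forall>x. \<bar>f x\<bar> \<le> B" by blast
qed

lemma integrable_indicator_cball:
  "integrable lborel (indicator (cball c r) :: 'a::euclidean_space \<Rightarrow> real)"
  by (intro integrable_real_indicator emeasure_bounded_finite) auto

lemma test_integrable:
  assumes "\<phi> \<in> test_functions U" shows "integrable lborel \<phi>"
proof -
  obtain R where "\<And>x. R < norm x \<Longrightarrow> \<phi> x = 0" using test_radius[OF assms] by blast
  then show ?thesis by (rule integrable_compact_support[OF smooth_continuous_on[OF test_smooth[OF assms]]])
qed

lemma test_bounded:
  assumes "\<phi> \<in> test_functions U" obtains B where "B > 0" "\<And>x. \<bar>\<phi> x\<bar> \<le> B"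
proof -
  obtain R where "\<And>x. R < norm x \<Longrightarrow> \<phi> x = 0" using test_radius[OF assms] by blast
  from bounded_compact_support[OF smooth_continuous_on[OF test_smooth[OF assms]] this] that
  show thesis by blast
qed

lemma test_sqint:
  assumes "\<phi> \<in> test_functions U" shows "sqint \<phi>"
  using test_integrable[OF test_mult[OF test_smooth[OF assms] assms]] test_measurable[OF assms]
  by (simp add: sqint_def power2_eq_square)

lemma test_lipschitz:
  assumes "\<phi> \<in> test_functions (U :: (real^'n::finite) set)"
  obtains L where "L > 0" "\<And>x z. \<bar>\<phi> (x + z) - \<phi> x\<bar> \<le> L * norm z"
proof -
  have "\<exists>B>0. \<forall>x. \<bar>partial i \<phi> x\<bar> \<le> B" for i
    using test_bounded[OF test_partial[OF assms]] by metis
  then obtain B where B: "\<And>i. B i > 0" "\<And>i x. \<bar>partial i \<phi> x\<bar> \<le> B i" by metis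
  have "\<bar>\<phi> (x + z) - \<phi> x\<bar> \<le> (\<Sum>i\<in>UNIV. B i) * norm z" for x z
  proof -
    have "\<exists>t>0. t < 1 \<and> \<phi> (x + 1 *\<^sub>R z) - \<phi> (x + 0 *\<^sub>R z) = (1 - 0) * (\<Sum>i\<in>UNIV. z $ i * partial i \<phi> (x + t *\<^sub>R z))"
      by (rule MVT2) (auto intro: has_real_derivative_line test_differentiable[OF assms])
    then obtain t where t: "\<phi> (x + z) - \<phi> x = (\<Sum>i\<in>UNIV. z $ i * partial i \<phi> (x + t *\<^sub>R z))" by auto
    have "\<bar>\<Sum>i\<in>UNIV. z $ i * partial i \<phi> (x + t *\<^sub>R z)\<bar> \<le> (\<Sum>i\<in>UNIV. \<bar>z $ i * partial i \<phi> (x + t *\<^sub>R z)\<bar>)"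
      by (rule sum_abs)
    also have "\<dots> \<le> (\<Sum>i\<in>UNIV. norm z * B i)"
      unfolding abs_mult by (intro sum_mono mult_mono B component_le_norm_cart) auto
    also have "\<dots> = (\<Sum>i\<in>UNIV. B i) * norm z" by (simp add: sum_distrib_left[symmetric])
    finally show ?thesis using t by simp
  qed
  moreover have "(\<Sum>i\<in>UNIV. B i) > 0" using B by (intro sum_pos) auto
  ultimately show thesis by (rule that[rotated])
qed

text \<open>Difference quotients have integral zero by translation invariance and converge
  dominatedly. Only a continuous \<open>partial i f\<close> is assumed, not smoothness, because the
  result is also applied to the product of a test function with a kernel that is singular at one
  point.\<close>

lemma integral_partial_eq_0:
  fixes f :: "real^'n::finite \<Rightarrow> real"
  assumes diff: "\<And>x. f differentiable (at x)" and cont: "continuous_on UNIV (partial i f)"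
    and R: "\<And>x. R < norm x \<Longrightarrow> f x = 0"
  shows "(LINT x|lborel. partial i f x) = 0"
proof -
  let ?e = "axis i 1 :: real^'n"
  have R': "partial i f x = 0" if "R < norm x" for x
    by (rule partial_zero_off_closed[of "cball 0 R"]) (use R that in auto)
  obtain B where B: "B > 0" "\<And>x. \<bar>partial i f x\<bar> \<le> B"
    using bounded_compact_support[OF cont R'] by blast
  have cf: "continuous_on UNIV f"
    by (meson diff continuous_at_imp_continuous_on differentiable_imp_continuous_within)
  have int: "integrable lborel f" by (rule integrable_compact_support[OF cf R])
  have [measurable]: "f \<in> borel_measurable borel" "partial i f \<in> borel_measurable borel"
    using cf cont by (auto intro: borel_measurable_continuous_onI)
  define h where "h n = 1 / real (Suc n)" for n
  have h: "h n > 0" "h n \<le> 1" for n by (auto simp: h_def)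
  have h0: "h \<longlonglongrightarrow> 0" unfolding h_def using LIMSEQ_inverse_real_of_nat by (simp add: inverse_eq_divide)
  define D where "D n x = (f (x + h n *\<^sub>R ?e) - f x) / h n" for n x
  have "(\<lambda>n. LINT x|lborel. D n x) \<longlonglongrightarrow> (LINT x|lborel. partial i f x)"
  proof (rule integral_dominated_convergence[where w="\<lambda>x. B * indicator (cball 0 (R + 1)) x"])
    show "integrable lborel (\<lambda>x. B * indicator (cball 0 (R + 1)) x)"
      by (intro integrable_mult_right integrable_indicator_cball)
    show "partial i f \<in> borel_measurable lborel" "\<And>n. D n \<in> borel_measurable lborel"
      unfolding D_def by measurable
    show "AE x in lborel. (\<lambda>n. D n x) \<longlonglongrightarrow> partial i f x"
    proof (rule AE_I2)
      fix x
      have "((\<lambda>t. f (x + t *\<^sub>R ?e)) has_real_derivative partial i f (x + 0 *\<^sub>R ?e)) (at 0)"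
        by (rule has_real_derivative_axis[OF diff])
      then have "((\<lambda>t. (f (x + t *\<^sub>R ?e) - f x) / t) \<longlongrightarrow> partial i f x) (at 0)"
        by (simp add: has_field_derivative_iff)
      moreover have "filterlim h (at 0) sequentially"
        unfolding filterlim_at using h0 h(1) by (auto intro!: always_eventually simp: less_imp_neq[symmetric])
      ultimately show "(\<lambda>n. D n x) \<longlonglongrightarrow> partial i f x"
        unfolding D_def by (rule filterlim_compose)
    qed
    show "AE x in lborel. norm (D n x) \<le> B * indicator (cball 0 (R + 1)) x" for n
    proof (rule AE_I2)
      fix x
      show "norm (D n x) \<le> B * indicator (cball 0 (R + 1)) x"
      proof (cases "norm x \<le> R + 1")
        case True
        have "\<exists>t>0. t < h n \<and> f (x + h n *\<^sub>R ?e) - f (x + 0 *\<^sub>R ?e) = (h n - 0) * partial i f (x + t *\<^sub>R ?e)"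
          by (rule MVT2[OF h(1)]) (rule has_real_derivative_axis[OF diff])
        then obtain t where "f (x + h n *\<^sub>R ?e) - f x = h n * partial i f (x + t *\<^sub>R ?e)" by auto
        then have "D n x = partial i f (x + t *\<^sub>R ?e)" using h(1)[of n] by (simp add: D_def)
        then show ?thesis using B(2) True by simp
      next
        case False
        \<comment> \<open>Steps are at most 1, so outside the ball of radius \<open>R + 1\<close>
          both points of the quotient lie where \<open>f\<close> vanishes.\<close>
        have "norm x \<le> norm (x + h n *\<^sub>R ?e) + norm (h n *\<^sub>R ?e)"
          using norm_triangle_ineq4[of "x + h n *\<^sub>R ?e" "h n *\<^sub>R ?e"] by simp
        moreover have "norm (h n *\<^sub>R ?e) \<le> 1" using h[of n] by (simp add: norm_axis_1)
        ultimately have "f (x + h n *\<^sub>R ?e) = 0" "f x = 0"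
          using False by (auto intro!: R)
        then show ?thesis using B by (simp add: D_def)
      qed
    qed
  qed
  moreover have "(LINT x|lborel. D n x) = 0" for n
    unfolding D_def using lborel_integrable_translate[OF int] int
    by (simp add: lborel_integral_translate)
  ultimately show ?thesis by (simp add: LIMSEQ_const_iff)
qed

lemma integral_by_parts_test:
  assumes f: "smooth f" and \<phi>: "\<phi> \<in> test_functions U"
  shows "(LINT x|lborel. f x * partial i \<phi> x) = - (LINT x|lborel. partial i f x * \<phi> x)"
proof -
  let ?g = "\<lambda>x. f x * \<phi> x"
  have g: "?g \<in> test_functions U" by (rule test_mult[OF f \<phi>])
  obtain R where R: "\<And>x. R < norm x \<Longrightarrow> ?g x = 0" using test_radius[OF g] by blast
  have "(LINT x|lborel. partial i ?g x) = 0"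
    by (rule integral_partial_eq_0[OF test_differentiable[OF g] smooth_continuous_on[OF smooth_partial[OF test_smooth[OF g]]] R])
  moreover have "partial i ?g x = f x * partial i \<phi> x + partial i f x * \<phi> x" for x
    by (rule partial_mult[OF smooth_differentiable[OF f] test_differentiable[OF \<phi>]])
  moreover have "integrable lborel (\<lambda>x. f x * partial i \<phi> x)" "integrable lborel (\<lambda>x. partial i f x * \<phi> x)"
    by (rule test_integrable[OF test_mult] f smooth_partial[OF f] \<phi> test_partial[OF \<phi>])+
  ultimately show ?thesis by simp
qed

subsection \<open>A smooth bump\<close>

text \<open>The function exp(-1/t), extended by zero, together with its multiples by powers of 1/t:
  the smallest natural family in which it can be differentiated indefinitely.\<close>

definition theta :: "nat \<Rightarrow> real \<Rightarrow> real" where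
  "theta k t = (if t > 0 then exp (- inverse t) * inverse t ^ k else 0)"

lemma power_le_exp:
  fixes x :: real
  assumes "0 \<le> x"
  shows "x ^ n / fact n \<le> exp x"
proof -
  have "sum (\<lambda>k. x ^ k /\<^sub>R fact k) {n} \<le> (\<Sum>k. x ^ k /\<^sub>R fact k)"
    using assms by (intro sum_le_suminf summable_exp_generic) auto
  then show ?thesis by (simp add: exp_def field_simps)
qed

lemma theta_nonneg: "0 \<le> theta k t"
  by (simp add: theta_def)

text \<open>The exponential of 1/t dominates its Taylor term of order \<open>k + 1\<close>; one
  power more than in \<open>theta k\<close> leaves a factor \<open>t\<close>, which gives continuity
  at 0.\<close>

lemma theta_le:
  assumes "t > 0"
  shows "theta k t \<le> fact (Suc k) * t"
proof -
  have "inverse t ^ Suc k / fact (Suc k) \<le> exp (inverse t)"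
    using assms by (intro power_le_exp) simp
  then have "inverse t ^ Suc k \<le> exp (inverse t) * fact (Suc k)"
    by (simp only: pos_divide_le_eq fact_gt_zero)
  then have "exp (- inverse t) * (inverse t ^ Suc k) \<le> exp (- inverse t) * (exp (inverse t) * fact (Suc k))"
    by (rule mult_left_mono) simp
  also have "\<dots> = fact (Suc k)" by (simp add: exp_minus)
  finally have "exp (- inverse t) * (inverse t ^ Suc k) \<le> fact (Suc k)" .
  then have "theta k t * inverse t \<le> fact (Suc k)"
    using assms by (simp add: theta_def mult_ac)
  then show ?thesis using assms by (simp only: divide_inverse[symmetric] pos_divide_le_eq)
qed

lemma has_real_derivative_theta:
  "(theta k has_real_derivative (theta (k + 2) t - real k * theta (k + 1) t)) (at t)"
proof -
  consider "t > 0" | "t < 0" | "t = 0" by linarith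
  then show ?thesis
  proof cases
    case 1
    have "((\<lambda>t. exp (- inverse t) * inverse t ^ k) has_real_derivative
        exp (- inverse t) * (inverse t)\<^sup>2 * inverse t ^ k
          - exp (- inverse t) * (real k * inverse t ^ (k - 1) * (inverse t)\<^sup>2)) (at t)"
      using 1 by (auto intro!: derivative_eq_intros simp: power2_eq_square)
    moreover have "exp (- inverse t) * (inverse t)\<^sup>2 * inverse t ^ k
          - exp (- inverse t) * (real k * inverse t ^ (k - 1) * (inverse t)\<^sup>2)
        = theta (k + 2) t - real k * theta (k + 1) t"
      using 1 by (cases k) (simp_all add: theta_def power2_eq_square mult_ac)
    ultimately have "((\<lambda>t. exp (- inverse t) * inverse t ^ k) has_real_derivative
        (theta (k + 2) t - real k * theta (k + 1) t)) (at t)" by (simp only:)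
    then show ?thesis
      by (rule has_field_derivative_transform_within_open[where S="{0<..}"]) (use 1 in \<open>auto simp: theta_def\<close>)
  next
    case 2
    have "((\<lambda>t. 0) has_real_derivative 0) (at t)" by simp
    then have "(theta k has_real_derivative 0) (at t)"
      by (rule has_field_derivative_transform_within_open[where S="{..<0}"]) (use 2 in \<open>auto simp: theta_def\<close>)
    then show ?thesis using 2 by (simp add: theta_def)
  next
    case 3
    \<comment> \<open>For positive \<open>h\<close> the difference quotient at 0 is
      \<open>theta (k + 1) h\<close>, to which \<open>theta_le\<close> applies.\<close>
    have le: "norm (theta k h / h) \<le> fact (k + 2) * \<bar>h\<bar>" for h
    proof (cases "h > 0")
      case True
      then have "theta k h / h = theta (Suc k) h" by (simp add: theta_def field_simps)
      then show ?thesis using theta_le[OF True, of "Suc k"] theta_nonneg[of "Suc k" h] True by simp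
    next
      case False
      have "0 \<le> fact (k + 2) * \<bar>h\<bar>" by (intro mult_nonneg_nonneg) auto
      moreover have "theta k h / h = 0" using False by (simp add: theta_def)
      ultimately show ?thesis by (simp only: norm_zero)
    qed
    have "((\<lambda>h::real. fact (k + 2) * \<bar>h\<bar>) \<longlongrightarrow> fact (k + 2) * \<bar>0\<bar>) (at 0)"
      by (intro tendsto_intros)
    then have lim0: "((\<lambda>h::real. fact (k + 2) * \<bar>h\<bar>) \<longlongrightarrow> 0) (at 0)" by simp
    have "((\<lambda>h. theta k h / h) \<longlongrightarrow> 0) (at 0)"
      by (rule Lim_null_comparison[OF _ lim0]) (intro always_eventually allI le)
    then show ?thesis using 3 by (simp add: has_field_derivative_iff theta_def)
  qed
qed

lemma smooth_theta_norm:
  "smooth (\<lambda>x::real^'n::finite. theta k (c - x \<bullet> x))"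
proof -
  define B where "B f \<longleftrightarrow> smooth f \<or> (\<exists>k. f = (\<lambda>x::real^'n. theta k (c - x \<bullet> x)))" for f
  have D: "((\<lambda>x::real^'n. theta k (c - x \<bullet> x)) has_derivative
      (\<lambda>h. - 2 * (x \<bullet> h) * (theta (k + 2) (c - x \<bullet> x) - real k * theta (k + 1) (c - x \<bullet> x)))) (at x)" for k x
  proof -
    have "((\<lambda>x::real^'n. c - x \<bullet> x) has_derivative (\<lambda>h. - 2 * (x \<bullet> h))) (at x)"
      by (auto intro!: derivative_eq_intros simp: inner_commute)
    from DERIV_compose_FDERIV[OF has_real_derivative_theta this] show ?thesis .
  qed
  have base: "alg B (\<lambda>x. theta k (c - x \<bullet> x))" for k by (rule alg.base) (auto simp: B_def)
  have sm: "alg B f" if "smooth f" for f using that by (intro alg.base) (simp add: B_def)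
  show ?thesis
  proof (rule alg_smooth[of B])
    show "g differentiable (at x)" if "B g" for g x
      using that D smooth_differentiable unfolding B_def differentiable_def by blast
    show "alg B (partial i g)" if "B g" for g i
    proof (cases "smooth g")
      case False
      with that have "\<exists>k. g = (\<lambda>x. theta k (c - x \<bullet> x))" unfolding B_def by simp
      then obtain k where g: "g = (\<lambda>x. theta k (c - x \<bullet> x))" by blast
      have "partial i g = (\<lambda>x. ((-2) * x $ i) * (theta (k + 2) (c - x \<bullet> x) + (- real k) * theta (k + 1) (c - x \<bullet> x)))"
        unfolding g by (rule ext, subst partial_eqI[OF D]) (simp add: inner_axis)
      moreover have "alg B (\<lambda>x. ((-2) * x $ i) * (theta (k + 2) (c - x \<bullet> x) + (- real k) * theta (k + 1) (c - x \<bullet> x)))"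
        by (rule alg.mult[OF sm alg.add[OF base alg.mult[OF sm base]]]) (intro smooth_cmult smooth_coord smooth_const)+
      ultimately show ?thesis by simp
    qed (intro sm smooth_partial)
  qed (rule base)
qed

text \<open>Evenness is included because it makes convolution with \<rho> self-adjoint, see
  \<open>conv_adjoint\<close>.\<close>

lemma mollifier_exists:
  fixes r :: real
  assumes r: "r > 0"
  obtains \<rho> :: "real^'n::finite \<Rightarrow> real" where "\<rho> \<in> test_functions UNIV" "\<And>x. 0 \<le> \<rho> x"
    "\<And>x. r \<le> norm x \<Longrightarrow> \<rho> x = 0" "(LINT x|lborel. \<rho> x) = 1" "\<And>x. \<rho> (- x) = \<rho> x"
proof -
  define b where "b x = theta 0 (r\<^sup>2 - x \<bullet> x)" for x :: "real^'n"
  have b0: "b x = 0" if "r \<le> norm x" for x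
  proof -
    have "r\<^sup>2 \<le> x \<bullet> x" using that r power_mono[of r "norm x" 2] by (simp add: power2_norm_eq_inner)
    then show ?thesis by (simp add: b_def theta_def)
  qed
  have test: "b \<in> test_functions UNIV"
    by (rule test_functionsI[of _ "cball 0 r"]) (use b0 in \<open>auto simp: b_def[abs_def] smooth_theta_norm\<close>)
  \<comment> \<open>On the ball of radius r/2 the argument of \<open>theta 0\<close> is at least r^2
    - (r/2)^2 = (3/4) r^2; the value \<open>m\<close> there bounds the integral away from zero, so
    that it can be normalised.\<close>
  define m where "m = exp (- inverse (3 / 4 * r\<^sup>2))"
  have low: "m * indicator (cball 0 (r / 2)) x \<le> b x" for x
  proof (cases "norm x \<le> r / 2")
    case True
    have "x \<bullet> x \<le> (r / 2)\<^sup>2"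
      using True power_mono[of "norm x" "r / 2" 2] by (simp add: power2_norm_eq_inner)
    then have t: "3 / 4 * r\<^sup>2 \<le> r\<^sup>2 - x \<bullet> x" by (simp add: power_divide)
    moreover have p: "0 < 3 / 4 * r\<^sup>2" using r by simp
    ultimately have "inverse (r\<^sup>2 - x \<bullet> x) \<le> inverse (3 / 4 * r\<^sup>2)" by (intro le_imp_inverse_le)
    moreover have "0 < r\<^sup>2 - x \<bullet> x" using t p by linarith
    ultimately show ?thesis using True by (simp add: b_def theta_def m_def)
  qed (simp add: b_def theta_nonneg)
  have I: "0 < (LINT x|lborel. b x)"
  proof -
    have "0 < m * measure lborel (cball (0::real^'n) (r / 2))"
      using r by (simp add: m_def content_cball_pos)
    also have "\<dots> = (LINT x|lborel. m * indicator (cball (0::real^'n) (r / 2)) x)" by simp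
    also have "\<dots> \<le> (LINT x|lborel. b x)"
      by (intro integral_mono low test_integrable[OF test] integrable_mult_right integrable_indicator_cball)
    finally show ?thesis .
  qed
  show thesis
  proof (rule that[of "\<lambda>x. inverse (LINT x|lborel. b x) * b x"])
    show "(\<lambda>x. inverse (LINT x|lborel. b x) * b x) \<in> test_functions UNIV" by (rule test_cmult[OF test])
    show "0 \<le> inverse (LINT x|lborel. b x) * b x" for x using I by (simp add: b_def theta_nonneg)
    show "inverse (LINT x|lborel. b x) * b x = 0" if "r \<le> norm x" for x using b0[OF that] by simp
    show "(LINT x|lborel. inverse (LINT x|lborel. b x) * b x) = 1" using I by simp
    show "inverse (LINT x|lborel. b x) * b (- x) = inverse (LINT x|lborel. b x) * b x" for x by (simp add: b_def)
  qed
qed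

subsection \<open>Convolution\<close>

lemma integrable_kernel_left:
  fixes a k :: "'a::euclidean_space \<Rightarrow> real"
  assumes a: "integrable lborel a" and k: "integrable lborel k"
  shows "integrable (lborel \<Otimes>\<^sub>M lborel) (\<lambda>(x, y). a x * k (x - y))"
proof -
  have [measurable]: "a \<in> borel_measurable borel" "k \<in> borel_measurable borel" using a k by auto
  have kr: "integrable lborel (\<lambda>y. k (x - y))" for x by (rule lborel_integrable_reflect[OF k])
  show ?thesis
  proof (rule lborel_pair.Fubini_integrable)
    have "(LINT y|lborel. norm (case (x, y) of (x, y) \<Rightarrow> a x * k (x - y))) = \<bar>a x\<bar> * (LINT y|lborel. \<bar>k y\<bar>)" for x
    proof -
      have "(LINT y|lborel. \<bar>k (x - y)\<bar>) = (LINT y|lborel. \<bar>k y\<bar>)"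
        by (rule lborel_integral_reflect[of "\<lambda>y. \<bar>k y\<bar>"]) measurable
      then show ?thesis by (simp add: abs_mult)
    qed
    then show "integrable lborel (\<lambda>x. LINT y|lborel. norm (case (x, y) of (x, y) \<Rightarrow> a x * k (x - y)))"
      using a by (simp add: integrable_abs)
    show "AE x in lborel. integrable lborel (\<lambda>y. case (x, y) of (x, y) \<Rightarrow> a x * k (x - y))"
      using kr by (intro AE_I2) simp
  qed measurable
qed

lemma integrable_kernel_right:
  fixes a k :: "'a::euclidean_space \<Rightarrow> real"
  assumes a: "integrable lborel a" and k: "integrable lborel k"
  shows "integrable (lborel \<Otimes>\<^sub>M lborel) (\<lambda>(x, y). a y * k (x - y))"
proof -
  have "integrable lborel (\<lambda>z. k (0 - z))" by (rule lborel_integrable_reflect[OF k])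
  from lborel_pair.integrable_product_swap[OF integrable_kernel_left[OF a this]]
  show ?thesis by (simp add: case_prod_beta')
qed

text \<open>The product of \<open>f x\<close> and \<open>g y\<close> is dominated by the sum of the
  squares, and each square against the kernel integrates by translation invariance.\<close>

lemma integrable_kernel:
  fixes f g k :: "'a::euclidean_space \<Rightarrow> real"
  assumes f: "sqint f" and g: "sqint g" and k: "integrable lborel k"
  shows "integrable (lborel \<Otimes>\<^sub>M lborel) (\<lambda>(x, y). f x * g y * k (x - y))"
proof -
  have [measurable]: "f \<in> borel_measurable borel" "g \<in> borel_measurable borel" "k \<in> borel_measurable borel"
    using f g k by (auto simp: sqint_def)
  have ka: "integrable lborel (\<lambda>z. \<bar>k z\<bar>)" using k by (rule integrable_abs)
  have int: "integrable (lborel \<Otimes>\<^sub>M lborel) (\<lambda>z. (case z of (x, y) \<Rightarrow> (f x)\<^sup>2 * \<bar>k (x - y)\<bar>) + (case z of (x, y) \<Rightarrow> (g y)\<^sup>2 * \<bar>k (x - y)\<bar>))"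
    by (intro Bochner_Integration.integrable_add integrable_kernel_left integrable_kernel_right ka sqint_integrable f g)
  have le: "\<bar>a * b * c\<bar> \<le> a\<^sup>2 * \<bar>c\<bar> + b\<^sup>2 * \<bar>c\<bar>" for a b c :: real
  proof -
    have "2 * (\<bar>a\<bar> * \<bar>b\<bar>) \<le> a\<^sup>2 + b\<^sup>2"
      using sum_squares_bound[of "\<bar>a\<bar>" "\<bar>b\<bar>"] by (simp add: mult.assoc)
    moreover have "0 \<le> \<bar>a\<bar> * \<bar>b\<bar>" by (intro mult_nonneg_nonneg) auto
    ultimately have "\<bar>a\<bar> * \<bar>b\<bar> \<le> a\<^sup>2 + b\<^sup>2" by linarith
    from mult_right_mono[OF this, of "\<bar>c\<bar>"] show ?thesis by (simp add: abs_mult distrib_right)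
  qed
  show ?thesis
  proof (rule Bochner_Integration.integrable_bound[OF int])
    show "AE z in lborel \<Otimes>\<^sub>M lborel. norm (case z of (x, y) \<Rightarrow> f x * g y * k (x - y))
      \<le> norm ((case z of (x, y) \<Rightarrow> (f x)\<^sup>2 * \<bar>k (x - y)\<bar>) + (case z of (x, y) \<Rightarrow> (g y)\<^sup>2 * \<bar>k (x - y)\<bar>))"
    proof (rule AE_I2)
      fix z :: "'a \<times> 'a"
      show "norm (case z of (x, y) \<Rightarrow> f x * g y * k (x - y))
        \<le> norm ((case z of (x, y) \<Rightarrow> (f x)\<^sup>2 * \<bar>k (x - y)\<bar>) + (case z of (x, y) \<Rightarrow> (g y)\<^sup>2 * \<bar>k (x - y)\<bar>))"
        using order.trans[OF le abs_ge_self] by (cases z) (simp only: case_prod_conv real_norm_def)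
    qed
  qed measurable
qed

definition conv :: "('a::euclidean_space \<Rightarrow> real) \<Rightarrow> ('a \<Rightarrow> real) \<Rightarrow> 'a \<Rightarrow> real" where
  "conv u \<rho> x = (LINT y|lborel. u y * \<rho> (x - y))"

lemma conv_integrable:
  fixes u :: "real^'n::finite \<Rightarrow> real"
  assumes "sqint u" "\<rho> \<in> test_functions U"
  shows "integrable lborel (\<lambda>y. u y * \<rho> (x - y))"
  by (rule integrable_mult_sqint[OF assms(1) test_sqint[OF test_reflect[OF assms(2)]]])

lemma conv_eq_reflect:
  assumes [measurable]: "u \<in> borel_measurable borel" "\<rho> \<in> borel_measurable borel"
  shows "conv u \<rho> x = (LINT y|lborel. \<rho> y * u (x - y))"
  unfolding conv_def using lborel_integral_reflect[of "\<lambda>y. \<rho> y * u (x - y)" x] by (simp add: mult.commute)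

lemma test_taylor:
  assumes "\<rho> \<in> test_functions (U :: (real^'n::finite) set)"
  obtains C where "C > 0"
    "\<And>x z. \<bar>\<rho> (x + z) - \<rho> x - (\<Sum>i\<in>UNIV. z $ i * partial i \<rho> x)\<bar> \<le> C * (norm z)\<^sup>2"
proof -
  have "\<exists>L>0. \<forall>x z. \<bar>partial i \<rho> (x + z) - partial i \<rho> x\<bar> \<le> L * norm z" for i
    using test_lipschitz[OF test_partial[OF assms]] by metis
  then obtain L where L: "\<And>i. L i > 0" "\<And>i x z. \<bar>partial i \<rho> (x + z) - partial i \<rho> x\<bar> \<le> L i * norm z"
    by metis
  have "\<bar>\<rho> (x + z) - \<rho> x - (\<Sum>i\<in>UNIV. z $ i * partial i \<rho> x)\<bar> \<le> (\<Sum>i\<in>UNIV. L i) * (norm z)\<^sup>2" for x z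
  proof -
    have "\<exists>t>0. t < 1 \<and> \<rho> (x + 1 *\<^sub>R z) - \<rho> (x + 0 *\<^sub>R z) = (1 - 0) * (\<Sum>i\<in>UNIV. z $ i * partial i \<rho> (x + t *\<^sub>R z))"
      by (rule MVT2) (auto intro: has_real_derivative_line test_differentiable[OF assms])
    then obtain t where t: "0 < t" "t < 1" "\<rho> (x + z) - \<rho> x = (\<Sum>i\<in>UNIV. z $ i * partial i \<rho> (x + t *\<^sub>R z))" by auto
    have "\<rho> (x + z) - \<rho> x - (\<Sum>i\<in>UNIV. z $ i * partial i \<rho> x)
        = (\<Sum>i\<in>UNIV. z $ i * (partial i \<rho> (x + t *\<^sub>R z) - partial i \<rho> x))"
      unfolding t(3) by (simp add: sum_subtractf right_diff_distrib)
    also have "\<bar>\<dots>\<bar> \<le> (\<Sum>i\<in>UNIV. \<bar>z $ i * (partial i \<rho> (x + t *\<^sub>R z) - partial i \<rho> x)\<bar>)"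
      by (rule sum_abs)
    also have "\<dots> \<le> (\<Sum>i\<in>UNIV. norm z * (L i * norm z))"
      unfolding abs_mult
    proof (intro sum_mono mult_mono component_le_norm_cart)
      fix i
      have "\<bar>partial i \<rho> (x + t *\<^sub>R z) - partial i \<rho> x\<bar> \<le> L i * norm (t *\<^sub>R z)" by (rule L)
      also have "\<dots> \<le> L i * norm z"
        using t L(1)[of i] by (intro mult_left_mono) (auto simp: mult_left_le_one_le)
      finally show "\<bar>partial i \<rho> (x + t *\<^sub>R z) - partial i \<rho> x\<bar> \<le> L i * norm z" .
    qed auto
    also have "\<dots> = (\<Sum>i\<in>UNIV. L i) * (norm z)\<^sup>2"
      by (simp add: sum_distrib_right sum_distrib_left power2_eq_square mult_ac)
    finally show ?thesis .
  qed
  moreover have "(\<Sum>i\<in>UNIV. L i) > 0" using L by (intro sum_pos) auto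
  ultimately show thesis by (rule that[rotated])
qed

text \<open>The second-order Taylor remainder of \<rho> is bounded by a multiple of the square of
  \<open>norm h\<close>, uniformly in the base point. For \<open>norm h < 1\<close> it is supported
  in a fixed ball, on which \<open>u\<close> is integrable.\<close>

lemma conv_has_derivative:
  fixes u :: "real^'n::finite \<Rightarrow> real"
  assumes u: "sqint u" and \<rho>: "\<rho> \<in> test_functions U"
  shows "(conv u \<rho> has_derivative (\<lambda>h. \<Sum>i\<in>UNIV. h $ i * conv u (partial i \<rho>) x)) (at x)"
proof -
  note [measurable] = sqint_measurable[OF u]
  obtain C where C: "C > 0" "\<And>x z. \<bar>\<rho> (x + z) - \<rho> x - (\<Sum>i\<in>UNIV. z $ i * partial i \<rho> x)\<bar> \<le> C * (norm z)\<^sup>2"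
    using test_taylor[OF \<rho>] by metis
  obtain R where R: "R > 0" "\<And>x. R < norm x \<Longrightarrow> \<rho> x = 0" using test_radius[OF \<rho>] by metis
  have R': "partial i \<rho> x = 0" if "R < norm x" for i x
    by (rule partial_zero_off_closed[of "cball 0 R"]) (use R that in auto)
  define M where "M = (LINT y|lborel. \<bar>u y\<bar> * indicator (cball x (R + 1)) y)"
  have s1: "sqint (indicator (cball x (R + 1)) :: real^'n \<Rightarrow> real)"
  proof -
    have "(\<lambda>y. (indicator (cball x (R + 1)) y :: real)\<^sup>2) = indicator (cball x (R + 1))"
      by (auto simp: indicator_def)
    then show ?thesis using integrable_indicator_cball[of x "R + 1"] by (auto simp: sqint_def)
  qed
  have sa: "sqint (\<lambda>y. \<bar>u y\<bar>)" by (rule sqint_mono(1)[OF _ u]) auto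
  have im: "integrable lborel (\<lambda>y. \<bar>u y\<bar> * indicator (cball x (R + 1)) y)"
    by (rule integrable_mult_sqint[OF sa s1])
  have est: "\<bar>conv u \<rho> (x + h) - conv u \<rho> x - (\<Sum>i\<in>UNIV. h $ i * conv u (partial i \<rho>) x)\<bar> \<le> C * M * (norm h)\<^sup>2"
    if h: "norm h < 1" for h
  proof -
    let ?E = "\<lambda>y. \<rho> (x - y + h) - \<rho> (x - y) - (\<Sum>i\<in>UNIV. h $ i * partial i \<rho> (x - y))"
    have sw: "x + h - y = x - y + h" for y by simp
    have i1: "integrable lborel (\<lambda>y. u y * \<rho> (x - y + h))" using conv_integrable[OF u \<rho>, of "x + h"] by (simp only: sw)
    have i2: "integrable lborel (\<lambda>y. u y * \<rho> (x - y))" by (rule conv_integrable[OF u \<rho>])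
    have i3: "integrable lborel (\<lambda>y. h $ i * (u y * partial i \<rho> (x - y)))" for i
      by (intro integrable_mult_right conv_integrable[OF u test_partial[OF \<rho>]])
    have eqE: "u y * ?E y = u y * \<rho> (x - y + h) - u y * \<rho> (x - y) - (\<Sum>i\<in>UNIV. h $ i * (u y * partial i \<rho> (x - y)))" for y
      by (simp add: right_diff_distrib sum_distrib_left mult_ac)
    have eq: "(LINT y|lborel. u y * ?E y) = conv u \<rho> (x + h) - conv u \<rho> x - (\<Sum>i\<in>UNIV. h $ i * conv u (partial i \<rho>) x)"
      unfolding eqE conv_def sw using i1 i2 i3 by (simp add: Bochner_Integration.integral_sum)
    have iE: "integrable lborel (\<lambda>y. u y * ?E y)"
      unfolding eqE by (intro Bochner_Integration.integrable_diff Bochner_Integration.integrable_sum i1 i2 i3)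
    have bE: "\<bar>u y * ?E y\<bar> \<le> C * (norm h)\<^sup>2 * (\<bar>u y\<bar> * indicator (cball x (R + 1)) y)" for y
    proof (cases "norm (x - y) \<le> R + 1")
      case True
      have "\<bar>u y * ?E y\<bar> \<le> \<bar>u y\<bar> * (C * (norm h)\<^sup>2)"
        unfolding abs_mult by (intro mult_left_mono C) auto
      then show ?thesis using True by (simp add: dist_norm mult_ac)
    next
      case False
      then have "R < norm (x - y)" by simp
      moreover have "R < norm (x - y + h)"
        using False h norm_triangle_ineq4[of "x - y + h" h] by simp
      ultimately have "?E y = 0" using R(2) R' by simp
      then show ?thesis using C(1) by simp
    qed
    have "\<bar>LINT y|lborel. u y * ?E y\<bar> \<le> (LINT y|lborel. \<bar>u y * ?E y\<bar>)"
      by (rule integral_abs_bound)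
    also have "\<dots> \<le> (LINT y|lborel. C * (norm h)\<^sup>2 * (\<bar>u y\<bar> * indicator (cball x (R + 1)) y))"
      by (intro integral_mono bE integrable_abs iE integrable_mult_right im)
    also have "\<dots> = C * M * (norm h)\<^sup>2" by (simp add: M_def)
    finally show ?thesis unfolding eq .
  qed
  show ?thesis
    unfolding has_derivative_at
  proof
    show "bounded_linear (\<lambda>h. \<Sum>i\<in>UNIV. h $ i * conv u (partial i \<rho>) x)"
      by (intro bounded_linear_sum bounded_linear_mult_const bounded_linear_vec_nth)
    have "((\<lambda>h::real^'n. C * M * norm h) \<longlongrightarrow> C * M * norm (0::real^'n)) (at 0)"
      by (intro tendsto_mult tendsto_const tendsto_norm tendsto_ident_at)
    then have lim: "((\<lambda>h::real^'n. C * M * norm h) \<longlongrightarrow> 0) (at 0)" by simp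
    have ev: "\<forall>\<^sub>F h in at (0::real^'n). norm h < 1 \<and> h \<noteq> 0"
      unfolding eventually_at by (intro exI[of _ 1]) auto
    show "((\<lambda>h. norm (conv u \<rho> (x + h) - conv u \<rho> x - (\<Sum>i\<in>UNIV. h $ i * conv u (partial i \<rho>) x)) / norm h) \<longlongrightarrow> 0) (at 0)"
    proof (rule Lim_null_comparison[OF _ lim])
      show "\<forall>\<^sub>F h in at 0. norm (norm (conv u \<rho> (x + h) - conv u \<rho> x - (\<Sum>i\<in>UNIV. h $ i * conv u (partial i \<rho>) x)) / norm h) \<le> C * M * norm h"
        using ev
      proof eventually_elim
        case (elim h)
        then have "norm h > 0" by simp
        with est[of h] elim show ?case
          by (simp add: divide_le_eq power2_eq_square mult.assoc)
      qed
    qed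
  qed
qed

lemma
  fixes u :: "real^'n::finite \<Rightarrow> real"
  assumes u: "sqint u" and \<rho>: "\<rho> \<in> test_functions U"
  shows partial_conv: "partial i (conv u \<rho>) = conv u (partial i \<rho>)"
    and smooth_conv: "smooth (conv u \<rho>)"
proof -
  have P: "partial i (conv u \<rho>) = conv u (partial i \<rho>)" if "\<rho> \<in> test_functions U" for \<rho> i
  proof
    fix x
    have "(\<Sum>j\<in>UNIV. (axis i 1 :: real^'n) $ j * conv u (partial j \<rho>) x) = (\<Sum>j\<in>UNIV. if j = i then conv u (partial j \<rho>) x else 0)"
      by (intro sum.cong) (auto simp: axis_def)
    then show "partial i (conv u \<rho>) x = conv u (partial i \<rho>) x"
      unfolding partial_eqI[OF conv_has_derivative[OF u that]] by simp
  qed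
  show "partial i (conv u \<rho>) = conv u (partial i \<rho>)" by (rule P[OF \<rho>])
  show "smooth (conv u \<rho>)"
  proof (rule smooth_coinduct[where S="conv u ` test_functions U"])
    show "g differentiable (at x)" if "g \<in> conv u ` test_functions U" for g x
      using that conv_has_derivative[OF u] unfolding differentiable_def by blast
    show "partial i g \<in> conv u ` test_functions U" if "g \<in> conv u ` test_functions U" for g i
      using that P test_partial by blast
  qed (use \<rho> in auto)
qed

text \<open>The reflected kernel is itself a test function; the sign from its reflection cancels the
  sign in the definition of the weak derivative.\<close>

lemma conv_weak_partial:
  fixes u :: "real^'n::finite \<Rightarrow> real"
  assumes weak: "\<And>\<phi>. \<phi> \<in> test_functions UNIV \<Longrightarrow>
      (LINT x|lborel. u x * partial i \<phi> x) = - (LINT x|lborel. g x * \<phi> x)"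
    and \<rho>: "\<rho> \<in> test_functions U"
  shows "conv u (partial i \<rho>) = conv g \<rho>"
proof
  fix x
  have "(LINT y|lborel. u y * (- partial i \<rho> (x - y))) = - (LINT y|lborel. g y * \<rho> (x - y))"
    using weak[OF test_reflect[OF \<rho>, of x]] by (simp only: partial_reflect[OF test_smooth[OF \<rho>]])
  then show "conv u (partial i \<rho>) x = conv g \<rho> x" by (simp add: conv_def)
qed

lemma conv_adjoint:
  fixes u \<phi> :: "real^'n::finite \<Rightarrow> real"
  assumes u: "sqint u" and \<phi>: "sqint \<phi>" and \<rho>: "\<rho> \<in> test_functions U"
    and even: "\<And>x. \<rho> (- x) = \<rho> x"
  shows "(LINT x|lborel. conv u \<rho> x * \<phi> x) = (LINT x|lborel. u x * conv \<phi> \<rho> x)"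
proof -
  have int: "integrable (lborel \<Otimes>\<^sub>M lborel) (\<lambda>(x, y). \<phi> x * u y * \<rho> (x - y))"
    by (rule integrable_kernel[OF \<phi> u test_integrable[OF \<rho>]])
  have "(LINT x|lborel. conv u \<rho> x * \<phi> x) = (LINT x|lborel. LINT y|lborel. \<phi> x * u y * \<rho> (x - y))"
    unfolding mult.assoc integral_mult_right_zero conv_def by (simp only: mult.commute)
  also have "\<dots> = (LINT y|lborel. LINT x|lborel. \<phi> x * u y * \<rho> (x - y))"
    using lborel_pair.Fubini_integral[OF int] by simp
  also have "\<dots> = (LINT y|lborel. u y * conv \<phi> \<rho> y)"
  proof (rule Bochner_Integration.integral_cong)
    fix y
    have "(LINT x|lborel. \<phi> x * u y * \<rho> (x - y)) = (LINT x|lborel. u y * (\<phi> x * \<rho> (y - x)))"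
      using even[of "y - _"] by (simp add: mult_ac)
    then show "(LINT x|lborel. \<phi> x * u y * \<rho> (x - y)) = u y * conv \<phi> \<rho> y"
      by (simp add: conv_def)
  qed simp
  finally show ?thesis .
qed

text \<open>Minkowski's integral inequality in squared form, for averages over a probability
  density: Jensen in the parameter, then Tonelli. The parameter space may differ from the space of
  \<open>x\<close>, so that averages over segments are covered too, and the bound is asked for only
  where the density is nonzero, so that small supports can be exploited.\<close>

lemma weighted_average_bound:
  fixes \<rho> :: "'b::euclidean_space \<Rightarrow> real" and F :: "'a::euclidean_space \<Rightarrow> 'b \<Rightarrow> real"
  assumes F [measurable]: "case_prod F \<in> borel_measurable (borel \<Otimes>\<^sub>M borel)"
    and \<rho>: "integrable lborel \<rho>" "(LINT y|lborel. \<rho> y) = 1" "\<And>y. 0 \<le> \<rho> y"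
    and int: "\<And>x. integrable lborel (\<lambda>y. \<rho> y * F x y)" "\<And>x. integrable lborel (\<lambda>y. \<rho> y * (F x y)\<^sup>2)"
    and bound: "\<And>y. \<rho> y \<noteq> 0 \<Longrightarrow> (\<integral>\<^sup>+x. ennreal ((F x y)\<^sup>2) \<partial>lborel) \<le> ennreal B" and "0 \<le> B"
  shows "sqint (\<lambda>x. LINT y|lborel. \<rho> y * F x y)" "sqnorm (\<lambda>x. LINT y|lborel. \<rho> y * F x y) \<le> B"
proof -
  have [measurable]: "\<rho> \<in> borel_measurable borel" using \<rho>(1) by auto
  have m: "(\<lambda>x. LINT y|lborel. \<rho> y * F x y) \<in> borel_measurable borel"
    by measurable
  have "(\<integral>\<^sup>+x. ennreal ((LINT y|lborel. \<rho> y * F x y)\<^sup>2) \<partial>lborel)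
      \<le> (\<integral>\<^sup>+x. ennreal (LINT y|lborel. \<rho> y * (F x y)\<^sup>2) \<partial>lborel)"
    by (intro nn_integral_mono ennreal_leI weighted_integral_square_le \<rho> int)
  also have "\<dots> = (\<integral>\<^sup>+x. \<integral>\<^sup>+y. ennreal (\<rho> y * (F x y)\<^sup>2) \<partial>lborel \<partial>lborel)"
    using int(2) \<rho>(3) by (intro nn_integral_cong) (simp add: nn_integral_eq_integral)
  also have "\<dots> = (\<integral>\<^sup>+y. \<integral>\<^sup>+x. ennreal (\<rho> y * (F x y)\<^sup>2) \<partial>lborel \<partial>lborel)"
    by (rule lborel_pair.Fubini'[symmetric]) measurable
  also have "\<dots> \<le> (\<integral>\<^sup>+y. ennreal B * ennreal (\<rho> y) \<partial>lborel)"
  proof (rule nn_integral_mono)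
    fix y
    have "(\<integral>\<^sup>+x. ennreal (\<rho> y * (F x y)\<^sup>2) \<partial>lborel) = ennreal (\<rho> y) * (\<integral>\<^sup>+x. ennreal ((F x y)\<^sup>2) \<partial>lborel)"
      using \<rho>(3) by (simp add: ennreal_mult nn_integral_cmult)
    also have "\<dots> \<le> ennreal (\<rho> y) * ennreal B"
      by (cases "\<rho> y = 0") (auto intro: mult_left_mono bound)
    finally show "(\<integral>\<^sup>+x. ennreal (\<rho> y * (F x y)\<^sup>2) \<partial>lborel) \<le> ennreal B * ennreal (\<rho> y)"
      by (simp add: mult.commute)
  qed
  also have "\<dots> = ennreal B * ennreal 1"
    using \<rho> by (simp add: nn_integral_cmult nn_integral_eq_integral)
  finally have le: "(\<integral>\<^sup>+x. ennreal ((LINT y|lborel. \<rho> y * F x y)\<^sup>2) \<partial>lborel) \<le> ennreal B" by simp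
  show "sqint (\<lambda>x. LINT y|lborel. \<rho> y * F x y)" "sqnorm (\<lambda>x. LINT y|lborel. \<rho> y * F x y) \<le> B"
    using sqintI_nn_integral[OF m le \<open>0 \<le> B\<close>] by auto
qed

lemma sqint_reflect: "sqint u \<Longrightarrow> sqint (\<lambda>y. u (x - y))"
  unfolding sqint_def by (auto intro: lborel_integrable_reflect[of "\<lambda>y. (u y)\<^sup>2"])

lemma integrable_test_mult:
  fixes \<rho> :: "real^'n::finite \<Rightarrow> real"
  assumes \<rho>: "\<rho> \<in> test_functions U" and g: "integrable lborel g"
  shows "integrable lborel (\<lambda>y. \<rho> y * g y)"
proof -
  obtain B where B: "B > 0" "\<And>x. \<bar>\<rho> x\<bar> \<le> B" using test_bounded[OF \<rho>] by metis
  note [measurable] = test_measurable[OF \<rho>] borel_measurable_integrable[OF g]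
  show ?thesis
  proof (rule Bochner_Integration.integrable_bound)
    show "integrable lborel (\<lambda>y. B * g y)" using g by simp
    show "AE y in lborel. norm (\<rho> y * g y) \<le> norm (B * g y)"
      using B by (intro AE_I2) (auto simp: abs_mult intro!: mult_right_mono)
  qed measurable
qed

lemma
  fixes u :: "real^'n::finite \<Rightarrow> real"
  assumes u: "sqint u" and \<rho>: "\<rho> \<in> test_functions U" "\<And>x. 0 \<le> \<rho> x" "(LINT x|lborel. \<rho> x) = 1"
  shows sqint_conv: "sqint (conv u \<rho>)" and sqnorm_conv_le: "sqnorm (conv u \<rho>) \<le> sqnorm u"
proof -
  note [measurable] = sqint_measurable[OF u] test_measurable[OF \<rho>(1)]
  have eq: "conv u \<rho> = (\<lambda>x. LINT y|lborel. \<rho> y * u (x - y))" by (rule ext, rule conv_eq_reflect) measurable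
  have b: "(\<integral>\<^sup>+x. ennreal ((u (x - y))\<^sup>2) \<partial>lborel) \<le> ennreal (sqnorm u)" for y
    using nn_integral_lborel_translate[of "\<lambda>x. ennreal ((u x)\<^sup>2)" "- y"] sqnorm_eq_nn_integral[OF u] by simp
  show "sqint (conv u \<rho>)" unfolding eq
    by (rule weighted_average_bound(1)[where B="sqnorm u", OF _ test_integrable[OF \<rho>(1)] \<rho>(3,2)
     integrable_mult_sqint[OF test_sqint[OF \<rho>(1)] sqint_reflect[OF u]] integrable_test_mult[OF \<rho>(1) sqint_integrable[OF sqint_reflect[OF u]]] b sqnorm_nonneg])
      measurable
  show "sqnorm (conv u \<rho>) \<le> sqnorm u" unfolding eq
    by (rule weighted_average_bound(2)[where B="sqnorm u", OF _ test_integrable[OF \<rho>(1)] \<rho>(3,2)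
     integrable_mult_sqint[OF test_sqint[OF \<rho>(1)] sqint_reflect[OF u]] integrable_test_mult[OF \<rho>(1) sqint_integrable[OF sqint_reflect[OF u]]] b sqnorm_nonneg])
      measurable
qed

text \<open>Since \<rho> has mass one, the error is the \<rho>-average of increments of
  \<open>u\<close> over shifts shorter than \<open>r\<close>.\<close>

lemma sqnorm_conv_diff_le:
  fixes u :: "real^'n::finite \<Rightarrow> real"
  assumes u: "sqint u" and \<rho>: "\<rho> \<in> test_functions U" "\<And>x. 0 \<le> \<rho> x" "(LINT x|lborel. \<rho> x) = 1"
    and small: "\<And>x. r \<le> norm x \<Longrightarrow> \<rho> x = 0"
    and close: "\<And>z. norm z < r \<Longrightarrow> sqnorm (\<lambda>x. u (x + z) - u x) \<le> B" and "0 \<le> B"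
  shows "sqnorm (\<lambda>x. conv u \<rho> x - u x) \<le> B"
proof -
  note [measurable] = sqint_measurable[OF u] test_measurable[OF \<rho>(1)]
  have i1: "integrable lborel (\<lambda>y. \<rho> y * u (x - y))" for x
    by (rule integrable_mult_sqint[OF test_sqint[OF \<rho>(1)] sqint_reflect[OF u]])
  have i2: "integrable lborel (\<lambda>y. \<rho> y * c)" for c
    using test_integrable[OF \<rho>(1)] by simp
  have i3: "integrable lborel (\<lambda>y. \<rho> y * (u (x - y) - u x))" for x
    unfolding right_diff_distrib by (intro Bochner_Integration.integrable_diff i1 i2)
  have i4: "integrable lborel (\<lambda>y. \<rho> y * (u (x - y) - u x)\<^sup>2)" for x
  proof -
    have "integrable lborel (\<lambda>y. \<rho> y * (u (x - y))\<^sup>2 - (2 * u x) * (\<rho> y * u (x - y)) + \<rho> y * (u x)\<^sup>2)"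
      by (intro Bochner_Integration.integrable_add Bochner_Integration.integrable_diff i2 integrable_mult_right i1
          integrable_test_mult[OF \<rho>(1) sqint_integrable[OF sqint_reflect[OF u]]])
    moreover have "\<rho> y * (u (x - y))\<^sup>2 - (2 * u x) * (\<rho> y * u (x - y)) + \<rho> y * (u x)\<^sup>2 = \<rho> y * (u (x - y) - u x)\<^sup>2" for y
      by (simp add: power2_diff algebra_simps)
    ultimately show ?thesis by simp
  qed
  have eq: "(\<lambda>x. conv u \<rho> x - u x) = (\<lambda>x. LINT y|lborel. \<rho> y * (u (x - y) - u x))"
  proof
    fix x
    have "conv u \<rho> x = (LINT y|lborel. \<rho> y * u (x - y))" by (rule conv_eq_reflect) measurable
    moreover have "(LINT y|lborel. \<rho> y * u x) = u x" using \<rho>(3) by simp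
    ultimately show "conv u \<rho> x - u x = (LINT y|lborel. \<rho> y * (u (x - y) - u x))"
      unfolding right_diff_distrib using i1 i2 by simp
  qed
  have b: "(\<integral>\<^sup>+x. ennreal ((u (x - y) - u x)\<^sup>2) \<partial>lborel) \<le> ennreal B" if "\<rho> y \<noteq> 0" for y
  proof -
    have "norm (- y) < r" using small[of y] that by force
    then have "ennreal (sqnorm (\<lambda>x. u (x + - y) - u x)) \<le> ennreal B" by (intro ennreal_leI close)
    then show ?thesis
      unfolding sqnorm_eq_nn_integral[OF sqint_diff[OF sqint_translate[OF u, of "- y"] u]] by simp
  qed
  show ?thesis unfolding eq
    by (rule weighted_average_bound(2)[OF _ test_integrable[OF \<rho>(1)] \<rho>(3,2) i3 i4 b \<open>0 \<le> B\<close>]) measurable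
qed

lemma mollifier_sequence:
  fixes r0 :: real
  assumes "r0 > 0"
  obtains \<rho> :: "nat \<Rightarrow> real^'n::finite \<Rightarrow> real" where "\<And>n. \<rho> n \<in> test_functions UNIV" "\<And>n x. 0 \<le> \<rho> n x"
    "\<And>n. (LINT x|lborel. \<rho> n x) = 1" "\<And>n x. \<rho> n (- x) = \<rho> n x"
    "\<And>n x. r0 \<le> norm x \<Longrightarrow> \<rho> n x = 0"
    "\<And>u. sqint u \<Longrightarrow> (\<lambda>n. sqnorm (\<lambda>x. conv u (\<rho> n) x - u x)) \<longlonglongrightarrow> 0"
proof -
  have "\<exists>\<rho> :: real^'n \<Rightarrow> real. \<rho> \<in> test_functions UNIV \<and> (\<forall>x. 0 \<le> \<rho> x) \<and> (\<forall>x. r0 / real (Suc n) \<le> norm x \<longrightarrow> \<rho> x = 0)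
      \<and> (LINT x|lborel. \<rho> x) = 1 \<and> (\<forall>x. \<rho> (- x) = \<rho> x)" for n
    by (rule mollifier_exists[of "r0 / real (Suc n)"]) (use assms in auto)
  then obtain \<rho> :: "nat \<Rightarrow> real^'n \<Rightarrow> real" where \<rho>: "\<And>n. \<rho> n \<in> test_functions UNIV" "\<And>n x. 0 \<le> \<rho> n x"
    "\<And>n x. r0 / real (Suc n) \<le> norm x \<Longrightarrow> \<rho> n x = 0" "\<And>n. (LINT x|lborel. \<rho> n x) = 1" "\<And>n x. \<rho> n (- x) = \<rho> n x"
    by metis
  show thesis
  proof (rule that[of \<rho>, OF \<rho>(1,2,4,5)])
    show "\<rho> n x = 0" if "r0 \<le> norm x" for n x
    proof (rule \<rho>(3))
      have "r0 / real (Suc n) \<le> r0" using assms by (simp add: divide_le_eq mult_le_cancel_left1)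
      with that show "r0 / real (Suc n) \<le> norm x" by linarith
    qed
    show "(\<lambda>n. sqnorm (\<lambda>x. conv u (\<rho> n) x - u x)) \<longlonglongrightarrow> 0" if u: "sqint u" for u
    proof (rule LIMSEQ_I)
      fix e :: real assume e: "e > 0"
      then have "e / 2 > 0" by simp
      from sqint_imp_transcont[OF u, unfolded transcont_def, rule_format, OF this]
      obtain d where d: "d > 0" "\<And>z. norm z < d \<Longrightarrow> sqnorm (\<lambda>x. u (x + z) - u x) < e / 2" by auto
      obtain N :: nat where N: "r0 / d < real N" using reals_Archimedean2 by blast
      have le: "sqnorm (\<lambda>x. conv u (\<rho> n) x - u x) \<le> e / 2" if "n \<ge> N" for n
      proof (rule sqnorm_conv_diff_le[OF u \<rho>(1,2,4)])
        show "\<rho> n x = 0" if "d \<le> norm x" for x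
        proof (rule \<rho>(3))
          have "r0 < real (Suc n) * d" using N \<open>n \<ge> N\<close> d(1)
            by (simp add: divide_less_eq) (smt (verit, best) mult_right_mono of_nat_le_iff)
          then have "r0 / real (Suc n) \<le> d" by (simp add: divide_le_eq mult.commute)
          with that show "r0 / real (Suc n) \<le> norm x" by linarith
        qed
        show "sqnorm (\<lambda>x. u (x + z) - u x) \<le> e / 2" if "norm z < d" for z using d(2)[OF that] by simp
        show "0 \<le> e / 2" using e by simp
      qed
      have "sqnorm (\<lambda>x. conv u (\<rho> n) x - u x) < e" if "n \<ge> N" for n
        using le[OF that] e by linarith
      then show "\<exists>N. \<forall>n\<ge>N. norm (sqnorm (\<lambda>x. conv u (\<rho> n) x - u x) - 0) < e"
        by (intro exI[of _ N]) simp
    qed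
  qed
qed

lemma conv_support:
  assumes "\<And>x. x \<notin> K \<Longrightarrow> u x = 0" "\<And>x. r \<le> norm x \<Longrightarrow> \<rho> x = 0"
    and x: "\<And>y. y \<in> K \<Longrightarrow> r \<le> dist x y"
  shows "conv u \<rho> x = 0"
proof -
  have eq: "u y * \<rho> (x - y) = 0" for y
    using assms by (cases "y \<in> K") (auto simp: dist_norm)
  show ?thesis unfolding conv_def eq by simp
qed

lemma test_conv:
  fixes u :: "real^'n::finite \<Rightarrow> real"
  assumes u: "sqint u" and \<rho>: "\<rho> \<in> test_functions UNIV" "\<And>x. r \<le> norm x \<Longrightarrow> \<rho> x = 0"
    and K: "compact K" "\<And>x. x \<notin> K \<Longrightarrow> u x = 0" and U: "\<And>x y. x \<in> K \<Longrightarrow> dist x y \<le> r \<Longrightarrow> y \<in> U"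
  shows "conv u \<rho> \<in> test_functions U"
proof (rule test_functionsI[OF smooth_conv[OF u \<rho>(1)]])
  let ?L = "{x + y |x y. x \<in> K \<and> y \<in> cball 0 r}"
  show "compact ?L" by (intro compact_sums K compact_cball)
  show "?L \<subseteq> U" using U by (force simp: dist_norm)
  show "conv u \<rho> x = 0" if x: "x \<notin> ?L" for x
  proof (rule conv_support[OF K(2) \<rho>(2)])
    show "r \<le> dist x y" if y: "y \<in> K" for y
    proof (rule ccontr)
      assume "\<not> r \<le> dist x y"
      then have "x - y \<in> cball 0 r" "x = y + (x - y)"
        using norm_minus_commute[of x y] by (simp_all add: dist_norm)
      with x y show False by blast
    qed
  qed
qed

text \<open>The indicator of the \<open>2 * r\<close>-neighbourhood of \<open>K\<close> is mollified
  at radius \<open>r\<close>: the result is 1 on the \<open>r\<close>-neighbourhood and is supported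
  in the \<open>3 * r\<close>-neighbourhood, which lies within the distance \<open>d = 4 * r\<close>
  available in \<open>U\<close>.\<close>

lemma cutoff_exists:
  fixes K :: "(real^'n::finite) set"
  assumes K: "compact K" and U: "open U" "K \<subseteq> U"
  obtains \<eta> W where "\<eta> \<in> test_functions U" "open W" "K \<subseteq> W" "W \<subseteq> U" "\<And>x. x \<in> W \<Longrightarrow> \<eta> x = 1"
proof -
  obtain d where d: "d > 0" "(\<Union>x\<in>K. ball x d) \<subseteq> U"
    using compact_subset_open_imp_ball_epsilon_subset[OF K U] by blast
  define r where "r = d / 4"
  have r: "r > 0" using d(1) by (simp add: r_def)
  define A where "A = {x + y |x y. x \<in> K \<and> y \<in> cball 0 (2 * r)}"
  have A: "compact A" unfolding A_def by (intro compact_sums K compact_cball)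
  have inA: "y \<in> A" if "x \<in> K" "dist x y \<le> 2 * r" for x y
  proof -
    have "y = x + (y - x)" "y - x \<in> cball 0 (2 * r)" using that by (auto simp: dist_norm norm_minus_commute)
    with that(1) show ?thesis unfolding A_def by blast
  qed
  define u :: "real^'n \<Rightarrow> real" where "u = indicator A"
  have u: "sqint u"
  proof -
    have "A \<in> sets borel" using A by (simp add: compact_imp_closed borel_closed)
    moreover have "emeasure lborel A < \<infinity>" using A by (intro emeasure_bounded_finite compact_imp_bounded)
    ultimately have "integrable lborel u" unfolding u_def by (intro integrable_real_indicator) auto
    moreover have "(\<lambda>x. (u x)\<^sup>2) = u" by (auto simp: u_def indicator_def)
    ultimately show ?thesis unfolding sqint_def by auto
  qed
  obtain \<rho> :: "real^'n \<Rightarrow> real" where \<rho>: "\<rho> \<in> test_functions UNIV" "\<And>x. 0 \<le> \<rho> x"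
    "\<And>x. r \<le> norm x \<Longrightarrow> \<rho> x = 0" "(LINT x|lborel. \<rho> x) = 1" "\<And>x. \<rho> (- x) = \<rho> x"
    using mollifier_exists[OF r] by metis
  define W where "W = (\<Union>x\<in>K. ball x r)"
  show thesis
  proof (rule that[of "conv u \<rho>" W])
    show "conv u \<rho> \<in> test_functions U"
    proof (rule test_conv[OF u \<rho>(1,3) A])
      show "u x = 0" if "x \<notin> A" for x using that by (simp add: u_def)
      show "y \<in> U" if xA: "x \<in> A" and "dist x y \<le> r" for x y
      proof -
        obtain k z where k: "x = k + z" "k \<in> K" "norm z \<le> 2 * r" using xA
          unfolding A_def mem_Collect_eq mem_cball_0 by blast
        have "dist k x \<le> 2 * r" using k by (simp add: dist_norm)
        then have "dist k y \<le> 3 * r" using that dist_triangle[of k y x] by linarith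
        then have "y \<in> ball k d" using r by (simp add: r_def)
        with k(2) d(2) show ?thesis by blast
      qed
    qed
    show "open W" unfolding W_def by blast
    show "K \<subseteq> W" unfolding W_def using r by force
    have "ball x r \<subseteq> ball x d" for x :: "real^'n" using d(1) by (intro subset_ball) (simp add: r_def)
    then show "W \<subseteq> U" unfolding W_def using d(2) by blast
    show "conv u \<rho> x = 1" if xW: "x \<in> W" for x
    proof -
      obtain k where k: "k \<in> K" "dist k x < r" using xW by (auto simp: W_def)
      have eq: "u y * \<rho> (x - y) = \<rho> (x - y)" for y
      proof (cases "norm (x - y) < r")
        case True
        have "dist k y \<le> 2 * r" using k(2) True dist_triangle[of k y x] by (simp add: dist_norm)
        then show ?thesis using inA[OF k(1)] by (simp add: u_def)
      qed (use \<rho>(3) in auto)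
      have "conv u \<rho> x = (LINT y|lborel. \<rho> (x - y))" unfolding conv_def eq ..
      also have "\<dots> = 1" using lborel_integral_reflect[OF test_measurable[OF \<rho>(1)], of x] \<rho>(4) by simp
      finally show ?thesis .
    qed
  qed
qed

subsection \<open>The singular kernel\<close>

text \<open>The kernel of the fractional Laplacian without its normalising constant. At the origin
  the conventions for \<open>powr\<close> and division give the value 0.\<close>

definition riesz :: "real \<Rightarrow> real^'n::finite \<Rightarrow> real" where
  "riesz s z = 1 / norm z powr (real CARD('n) + 2 * s)"

lemma riesz_nonneg: "0 \<le> riesz s z"
  by (simp add: riesz_def)

lemma riesz_measurable [measurable]: "riesz s \<in> borel_measurable borel"
  unfolding riesz_def[abs_def] by measurable

lemma riesz_minus: "riesz s (- z) = riesz s z"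
  by (simp add: riesz_def)

lemma dyadic_bracket:
  fixes t :: real
  assumes "1 \<le> t"
  obtains k :: nat where "2 ^ k \<le> t" "t < 2 ^ Suc k"
proof -
  obtain n where n: "t < 2 ^ n" using real_arch_pow[of 2 t] by auto
  define m where "m = (LEAST n. t < 2 ^ n)"
  have m: "t < 2 ^ m" unfolding m_def by (rule LeastI[of _ n]) (rule n)
  have "m \<noteq> 0" using m assms by (intro notI) simp
  then obtain k where k: "m = Suc k" by (cases m) auto
  have "\<not> t < 2 ^ k" using not_less_Least[of k "\<lambda>n. t < 2 ^ n"] k by (simp add: m_def[symmetric])
  with m k show thesis by (intro that[of k]) auto
qed

text \<open>A substitute for polar coordinates: radial functions are majorised by weighted
  indicators of dyadic balls, and the integral becomes a geometric series.\<close>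

lemma nn_integral_geometric_cballs:
  fixes c r :: "nat \<Rightarrow> real" and q C :: real
  assumes c: "\<And>k. 0 \<le> c k" and r: "\<And>k. 0 \<le> r k" and q: "0 \<le> q" "q < 1"
    and le: "\<And>k. c k * r k ^ CARD('n) \<le> C * q ^ k"
  shows "(\<integral>\<^sup>+z. (\<Sum>k. ennreal (c k * indicator (cball 0 (r k)) z)) \<partial>(lborel :: (real^'n::finite) measure)) < \<infinity>"
proof -
  define V where "V = unit_ball_vol (real CARD('n))"
  have [measurable]: "(cball 0 (r k) :: (real^'n) set) \<in> sets borel" for k by simp
  have V: "0 \<le> V" by (simp add: V_def unit_ball_vol_nonneg)
  have C: "0 \<le> C"
  proof -
    have "0 \<le> c 0 * r 0 ^ CARD('n)" by (intro mult_nonneg_nonneg zero_le_power c r)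
    with le[of 0] show ?thesis by simp
  qed
  have I: "(\<integral>\<^sup>+z. ennreal (c k * indicator (cball 0 (r k)) z) \<partial>(lborel :: (real^'n) measure)) = ennreal (V * (c k * r k ^ CARD('n)))" for k
  proof -
    have "(\<integral>\<^sup>+z. ennreal (c k * indicator (cball 0 (r k)) z) \<partial>(lborel :: (real^'n) measure))
        = ennreal (LINT z|(lborel :: (real^'n) measure). c k * indicator (cball 0 (r k)) z)"
      using c by (intro nn_integral_eq_integral integrable_mult_right integrable_indicator_cball) auto
    also have "(LINT z|(lborel :: (real^'n) measure). c k * indicator (cball 0 (r k)) z) = c k * (V * r k ^ CARD('n))"
      using content_cball[of "r k" "0::real^'n"] r[of k] by (simp add: V_def)
    finally show ?thesis by (simp add: mult_ac)
  qed
  have "(\<integral>\<^sup>+z. (\<Sum>k. ennreal (c k * indicator (cball 0 (r k)) z)) \<partial>(lborel :: (real^'n) measure))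
      = (\<Sum>k. ennreal (V * (c k * r k ^ CARD('n))))"
    unfolding I[symmetric] by (rule nn_integral_suminf) measurable
  also have "\<dots> \<le> (\<Sum>k. ennreal (V * C * q ^ k))"
  proof (intro suminf_le ennreal_leI)
    show "V * (c k * r k ^ CARD('n)) \<le> V * C * q ^ k" for k
      using mult_left_mono[OF le V] by (simp add: mult.assoc)
  qed auto
  also have "\<dots> = ennreal (\<Sum>k. V * C * q ^ k)"
    using V C q by (intro suminf_ennreal2 summable_mult summable_geometric) auto
  also have "\<dots> < \<infinity>" by simp
  finally show ?thesis .
qed

text \<open>Dyadic shells outside the unit ball contribute a geometric series of ratio 2^(-2s),
  shells inside it one of ratio 2^(2s-2). Convergence of the first is \<open>0 < s\<close>, that of
  the second is \<open>s < 1\<close>.\<close>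

lemma integrable_min_riesz:
  assumes s: "0 < s" "s < 1"
  shows "integrable lborel (\<lambda>z::real^'n::finite. min 1 ((norm z)\<^sup>2) * riesz s z)"
proof (rule integrableI_bounded)
  let ?N = "CARD('n)"
  define p where "p = real ?N + 2 * s"
  have p: "p > 0" using s by (simp add: p_def add_nonneg_pos)
  \<comment> \<open>\<open>a k\<close> bounds the integrand on the shell from 2^k to 2^(k+1),
    \<open>b k\<close> on the shell from 2^(-k-1) to 2^(-k), where the factor
    \<open>(norm z)\<^sup>2\<close> is estimated at the outer and the kernel at the inner
    radius.\<close>
  define a where "a k = (2 ^ k) powr - p" for k :: nat
  define b where "b k = ((1/2) ^ k)\<^sup>2 * (2 ^ Suc k) powr p" for k :: nat
  have pow: "(2 ^ k) powr x = (2 powr x) ^ k" for k :: nat and x :: real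
    by (simp add: powr_powr powr_realpow[symmetric] mult.commute)
  have a: "a k * (2 ^ Suc k) ^ ?N \<le> 2 ^ ?N * (2 powr (- 2 * s)) ^ k" for k
  proof -
    have "a k * (2 ^ Suc k) ^ ?N = 2 ^ ?N * ((2 powr - p) ^ k * (2 ^ ?N) ^ k)"
      by (simp add: a_def pow power_mult_distrib power_mult[symmetric] mult.commute)
    also have "(2 powr - p) ^ k * (2 ^ ?N) ^ k = (2 powr (- 2 * s)) ^ k"
    proof -
      have "2 powr - p * 2 ^ ?N = 2 powr - p * 2 powr real ?N" by (simp add: powr_realpow)
      also have "\<dots> = 2 powr (- p + real ?N)" by (rule powr_add[symmetric])
      also have "- p + real ?N = - 2 * s" by (simp add: p_def)
      finally show ?thesis by (simp only: power_mult_distrib[symmetric])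
    qed
    finally show ?thesis by simp
  qed
  have b: "b k * ((1/2) ^ k) ^ ?N \<le> 2 powr p * (2 powr (2 * s - 2)) ^ k" for k
  proof -
    have h: "(1/2) ^ j = 2 powr (- real j)" for j :: nat
      by (simp add: powr_minus powr_realpow power_one_over inverse_eq_divide)
    have e: "(2 ^ Suc k) powr p = 2 powr (p * real (Suc k))"
      using powr_powr[of 2 "real (Suc k)" p] by (simp only: powr_realpow zero_less_numeral mult.commute)
    have "b k * ((1/2) ^ k) ^ ?N = 2 powr (- 2 * real k) * (2 powr (p * real (Suc k)) * 2 powr (- real k * real ?N))"
      unfolding b_def power_mult[symmetric] unfolding h e by (simp add: mult.commute)
    also have "\<dots> = 2 powr (p + (2 * s - 2) * real k)"
      by (simp add: powr_add[symmetric] p_def algebra_simps)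
    also have "\<dots> = 2 powr p * (2 powr (2 * s - 2)) ^ k"
      by (simp add: powr_add powr_powr powr_realpow[symmetric])
    finally show ?thesis by simp
  qed
  let ?f = "\<lambda>z::real^'n. \<Sum>k. ennreal (a k * indicator (cball 0 (2 ^ Suc k)) z)"
  let ?g = "\<lambda>z::real^'n. \<Sum>k. ennreal (b k * indicator (cball 0 ((1/2) ^ k)) z)"
  have [measurable]: "(cball 0 t :: (real^'n) set) \<in> sets borel" for t by simp
  have fin: "(\<integral>\<^sup>+z. ?f z \<partial>lborel) < \<infinity>" "(\<integral>\<^sup>+z. ?g z \<partial>lborel) < \<infinity>"
  proof -
    show "(\<integral>\<^sup>+z. ?f z \<partial>lborel) < \<infinity>"
      using s by (intro nn_integral_geometric_cballs[OF _ _ _ _ a]) (auto simp: a_def powr_less_one)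
    show "(\<integral>\<^sup>+z. ?g z \<partial>lborel) < \<infinity>"
      using s by (intro nn_integral_geometric_cballs[OF _ _ _ _ b]) (auto simp: b_def powr_less_one)
  qed
  have le: "ennreal (norm (min 1 ((norm z)\<^sup>2) * riesz s z)) \<le> ?f z + ?g z" for z :: "real^'n"
  proof (cases "z = 0")
    case False
    then have t: "norm z > 0" by simp
    have single: "ennreal (c k) \<le> (\<Sum>k. ennreal (c k))" for c :: "nat \<Rightarrow> real" and k
      using sum_le_suminf[of "\<lambda>k. ennreal (c k)" "{k}"] by simp
    have n: "norm (min 1 ((norm z)\<^sup>2) * riesz s z) = min 1 ((norm z)\<^sup>2) * norm z powr - p"
    proof -
      have "riesz s z = norm z powr - p" by (simp only: riesz_def p_def powr_minus inverse_eq_divide)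
      then show ?thesis by (simp add: abs_mult)
    qed
    show ?thesis
    proof (cases "1 \<le> norm z")
      case True
      then obtain k where k: "2 ^ k \<le> norm z" "norm z < 2 ^ Suc k" by (rule dyadic_bracket)
      have "min 1 ((norm z)\<^sup>2) * norm z powr - p \<le> 1 * a k"
        unfolding a_def using k p by (intro mult_mono powr_mono2') auto
      also have "\<dots> = a k * indicator (cball 0 (2 ^ Suc k)) z" using k by simp
      finally have "ennreal (min 1 ((norm z)\<^sup>2) * norm z powr - p) \<le> ?f z"
        by (intro order.trans[OF ennreal_leI single[of "\<lambda>k. a k * indicator (cball 0 (2 ^ Suc k)) z" k]])
      then show ?thesis unfolding n by (rule order.trans) simp
    next
      case False
      then have "1 \<le> 1 / norm z" using t by simp
      then obtain k where k: "2 ^ k \<le> 1 / norm z" "1 / norm z < 2 ^ Suc k" by (rule dyadic_bracket)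
      have k1: "norm z \<le> (1/2) ^ k" using k(1) t by (simp add: field_simps power_divide)
      have "norm z powr - p = (1 / norm z) powr p"
        using t by (simp add: powr_minus_divide powr_divide)
      also have "\<dots> \<le> (2 ^ Suc k) powr p" using k(2) p t by (intro powr_mono2) auto
      finally have "min 1 ((norm z)\<^sup>2) * norm z powr - p \<le> b k"
        unfolding b_def using k1 by (intro mult_mono) (auto intro: power_mono min.coboundedI2)
      also have "\<dots> = b k * indicator (cball 0 ((1/2) ^ k)) z" using k1 by simp
      finally have "ennreal (min 1 ((norm z)\<^sup>2) * norm z powr - p) \<le> ?g z"
        by (intro order.trans[OF ennreal_leI single[of "\<lambda>k. b k * indicator (cball 0 ((1/2) ^ k)) z" k]])
      then show ?thesis unfolding n by (rule order.trans) simp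
    qed
  qed simp
  have "(\<integral>\<^sup>+z. ennreal (norm (min 1 ((norm z)\<^sup>2) * riesz s (z::real^'n))) \<partial>lborel) \<le> (\<integral>\<^sup>+z. ?f z + ?g z \<partial>lborel)"
    by (intro nn_integral_mono le)
  also have "\<dots> = (\<integral>\<^sup>+z. ?f z \<partial>lborel) + (\<integral>\<^sup>+z. ?g z \<partial>lborel)"
    by (rule nn_integral_add) measurable
  also have "\<dots> < \<infinity>" using fin by simp
  finally show "(\<integral>\<^sup>+z. ennreal (norm (min 1 ((norm z)\<^sup>2) * riesz s (z::real^'n))) \<partial>lborel) < \<infinity>" .
qed measurable

subsection \<open>Increments and the nonlocal form\<close>

definition incr :: "('a::euclidean_space \<Rightarrow> real) \<Rightarrow> ('a \<Rightarrow> real) \<Rightarrow> 'a \<Rightarrow> real" where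
  "incr u v z = (LINT x|lborel. (u (x + z) - u x) * (v (x + z) - v x))"

text \<open>Minus the centred second difference: what remains on \<open>v\<close> once both
  increments in \<open>incr\<close> have been moved there, see \<open>incr_eq_sdiff\<close>.\<close>

definition sdiff :: "'a::euclidean_space \<Rightarrow> ('a \<Rightarrow> real) \<Rightarrow> 'a \<Rightarrow> real" where
  "sdiff z v x = 2 * v x - v (x + z) - v (x - z)"

definition nonlocal :: "real \<Rightarrow> (real^'n::finite \<Rightarrow> real) \<Rightarrow> (real^'n \<Rightarrow> real) \<Rightarrow> real" where
  "nonlocal s u v = (LINT z|lborel. incr u v z * riesz s z)"

text \<open>
  Membership in \<open>H\<^sup>1\<close> of the whole space, expressed through difference quotients: this is all that the
  convergence of the nonlocal form requires.
\<close>

definition tame :: "('a::euclidean_space \<Rightarrow> real) \<Rightarrow> bool" where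
  "tame u \<longleftrightarrow> sqint u \<and> (\<exists>C\<ge>0. \<forall>z. sqnorm (\<lambda>x. u (x + z) - u x) \<le> C * (norm z)\<^sup>2)"

lemma tame_sqint: "tame u \<Longrightarrow> sqint u"
  by (simp add: tame_def)

text \<open>The quadratic bound serves short shifts, the trivial bound \<open>4 * sqnorm u\<close>
  long ones; together they match the weight that makes the kernel integrable.\<close>

lemma tame_bound:
  fixes u :: "'a::euclidean_space \<Rightarrow> real"
  assumes "tame u"
  obtains C where "C \<ge> 0" "\<And>z. sqnorm (\<lambda>x. u (x + z) - u x) \<le> C * min 1 ((norm z)\<^sup>2)"
proof -
  obtain C where C: "C \<ge> 0" "\<And>z. sqnorm (\<lambda>x. u (x + z) - u x) \<le> C * (norm z)\<^sup>2" and u: "sqint u"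
    using assms by (auto simp: tame_def)
  have 4: "sqnorm (\<lambda>x. u (x + z) - u x) \<le> 4 * sqnorm u" for z
    using sqnorm_diff_le[OF sqint_translate[OF u, of z] u] by (simp add: sqnorm_translate[OF u])
  have "sqnorm (\<lambda>x. u (x + z) - u x) \<le> (C + 4 * sqnorm u) * min 1 ((norm z)\<^sup>2)" for z
  proof (cases "(norm z)\<^sup>2 \<le> 1")
    case True
    have "0 \<le> 4 * sqnorm u * (norm z)\<^sup>2" by (intro mult_nonneg_nonneg) auto
    with C(2)[of z] have "sqnorm (\<lambda>x. u (x + z) - u x) \<le> C * (norm z)\<^sup>2 + 4 * sqnorm u * (norm z)\<^sup>2"
      by linarith
    then show ?thesis using True by (simp add: min_absorb2 distrib_right)
  next
    case False
    with 4[of z] C(1) show ?thesis by simp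
  qed
  moreover have "0 \<le> C + 4 * sqnorm u" using C(1) by simp
  ultimately show thesis by (intro that)
qed

lemma tame_cmult:
  assumes "tame u" shows "tame (\<lambda>x. c * u x)"
proof -
  obtain C where C: "C \<ge> 0" "\<And>z. sqnorm (\<lambda>x. u (x + z) - u x) \<le> C * (norm z)\<^sup>2" and u: "sqint u"
    using assms by (auto simp: tame_def)
  have "sqnorm (\<lambda>x. c * u (x + z) - c * u x) \<le> (c\<^sup>2 * C) * (norm z)\<^sup>2" for z
  proof -
    have "sqnorm (\<lambda>x. c * u (x + z) - c * u x) = c\<^sup>2 * sqnorm (\<lambda>x. u (x + z) - u x)"
      using sqnorm_cmult[of c "\<lambda>x. u (x + z) - u x"] by (simp add: right_diff_distrib)
    also have "\<dots> \<le> c\<^sup>2 * (C * (norm z)\<^sup>2)" by (intro mult_left_mono C) auto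
    finally show ?thesis by (simp add: mult.assoc)
  qed
  moreover have "0 \<le> c\<^sup>2 * C" using C(1) by simp
  ultimately show ?thesis unfolding tame_def using sqint_cmult[OF u] by blast
qed

lemma tame_add:
  assumes "tame u" "tame v" shows "tame (\<lambda>x. u x + v x)"
proof -
  obtain C where C: "C \<ge> 0" "\<And>z. sqnorm (\<lambda>x. u (x + z) - u x) \<le> C * (norm z)\<^sup>2" and u: "sqint u"
    using assms(1) by (auto simp: tame_def)
  obtain D where D: "D \<ge> 0" "\<And>z. sqnorm (\<lambda>x. v (x + z) - v x) \<le> D * (norm z)\<^sup>2" and v: "sqint v"
    using assms(2) by (auto simp: tame_def)
  have "sqnorm (\<lambda>x. u (x + z) + v (x + z) - (u x + v x)) \<le> (2 * C + 2 * D) * (norm z)\<^sup>2" for z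
  proof -
    have "(\<lambda>x. u (x + z) + v (x + z) - (u x + v x)) = (\<lambda>x. (u (x + z) - u x) + (v (x + z) - v x))" by auto
    then have "sqnorm (\<lambda>x. u (x + z) + v (x + z) - (u x + v x))
        \<le> 2 * sqnorm (\<lambda>x. u (x + z) - u x) + 2 * sqnorm (\<lambda>x. v (x + z) - v x)"
      using sqnorm_add_le[OF sqint_diff[OF sqint_translate[OF u, of z] u] sqint_diff[OF sqint_translate[OF v, of z] v]] by simp
    also have "\<dots> \<le> 2 * (C * (norm z)\<^sup>2) + 2 * (D * (norm z)\<^sup>2)"
      by (intro add_mono mult_left_mono C D) auto
    finally show ?thesis by (simp add: algebra_simps)
  qed
  moreover have "0 \<le> 2 * C + 2 * D" using C(1) D(1) by simp
  ultimately show ?thesis unfolding tame_def using sqint_add[OF u v] by blast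
qed

lemma tame_diff:
  assumes "tame u" "tame v" shows "tame (\<lambda>x. u x - v x)"
  using tame_add[OF assms(1) tame_cmult[OF assms(2), of "-1"]] by simp

text \<open>The increment is the average over \<open>t\<close> in [0,1] of \<open>z\<close> paired
  with the gradient at \<open>x + t *\<^sub>R z\<close>, so \<open>weighted_average_bound\<close>
  applies with the uniform density on the segment.\<close>

lemma sqnorm_increment_smooth:
  fixes v :: "real^'n::finite \<Rightarrow> real"
  assumes v: "smooth v" and dv: "\<And>i. sqint (partial i v)"
  shows "sqnorm (\<lambda>x. v (x + z) - v x) \<le> (norm z)\<^sup>2 * (\<Sum>i\<in>UNIV. sqnorm (partial i v))"
proof -
  note [measurable] = smooth_measurable[OF v] smooth_measurable[OF smooth_partial[OF v]]
  let ?\<rho> = "\<lambda>t::real. indicator {0..1} t :: real"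
  let ?F = "\<lambda>x t. \<Sum>i\<in>UNIV. z $ i * partial i v (x + t *\<^sub>R z)"
  let ?B = "(norm z)\<^sup>2 * (\<Sum>i\<in>UNIV. sqnorm (partial i v))"
  have cont: "continuous_on UNIV (\<lambda>t. ?F x t)" for x
    by (intro continuous_intros continuous_on_compose2[OF smooth_continuous_on[OF smooth_partial[OF v], of UNIV]]) auto
  have i: "integrable lborel (\<lambda>t. ?\<rho> t * g t)" if "continuous_on UNIV g" for g :: "real \<Rightarrow> real"
    using borel_integrable_compact[OF compact_Icc continuous_on_subset[OF that], of 0 1] by simp
  have eq: "v (x + z) - v x = (LINT t|lborel. ?\<rho> t * ?F x t)" for x
  proof -
    have "(LINT t|lborel. ?F x t * indicator {0..1} t) = v (x + 1 *\<^sub>R z) - v (x + 0 *\<^sub>R z)"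
    proof (rule integral_FTC_Icc_real)
      show "((\<lambda>t. v (x + t *\<^sub>R z)) has_real_derivative ?F x t) (at t)" for t
        by (rule has_real_derivative_line[OF smooth_differentiable[OF v]])
      show "isCont (?F x) t" for t using cont by (simp add: continuous_on_eq_continuous_at)
    qed simp
    then show ?thesis by (simp add: mult.commute)
  qed
  have b: "(\<integral>\<^sup>+x. ennreal ((?F x t)\<^sup>2) \<partial>lborel) \<le> ennreal ?B" for t
  proof -
    have le: "(?F x t)\<^sup>2 \<le> (norm z)\<^sup>2 * (\<Sum>i\<in>UNIV. (partial i v (x + t *\<^sub>R z))\<^sup>2)" for x
    proof -
      have "(?F x t)\<^sup>2 \<le> (\<Sum>i\<in>UNIV. (z $ i)\<^sup>2) * (\<Sum>i\<in>UNIV. (partial i v (x + t *\<^sub>R z))\<^sup>2)"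
        by (rule Cauchy_Schwarz_ineq_sum)
      also have "(\<Sum>i\<in>UNIV. (z $ i)\<^sup>2) = (norm z)\<^sup>2"
        by (simp add: norm_vec_def L2_set_def sum_nonneg)
      finally show ?thesis .
    qed
    have si: "sqint (\<lambda>x. partial i v (x + t *\<^sub>R z))" for i by (rule sqint_translate[OF dv])
    have "(\<integral>\<^sup>+x. ennreal ((?F x t)\<^sup>2) \<partial>lborel) \<le> (\<integral>\<^sup>+x. ennreal ((norm z)\<^sup>2 * (\<Sum>i\<in>UNIV. (partial i v (x + t *\<^sub>R z))\<^sup>2)) \<partial>lborel)"
      by (intro nn_integral_mono ennreal_leI le)
    also have "\<dots> = ennreal (LINT x|lborel. (norm z)\<^sup>2 * (\<Sum>i\<in>UNIV. (partial i v (x + t *\<^sub>R z))\<^sup>2))"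
      by (intro nn_integral_eq_integral integrable_mult_right Bochner_Integration.integrable_sum sqint_integrable si)
         (auto intro!: mult_nonneg_nonneg sum_nonneg)
    also have "(LINT x|lborel. (norm z)\<^sup>2 * (\<Sum>i\<in>UNIV. (partial i v (x + t *\<^sub>R z))\<^sup>2))
        = (norm z)\<^sup>2 * (\<Sum>i\<in>UNIV. sqnorm (\<lambda>x. partial i v (x + t *\<^sub>R z)))"
      using sqint_integrable[OF si] by (simp add: Bochner_Integration.integral_sum sqnorm_def)
    also have "\<dots> = ?B" by (simp only: sqnorm_translate[OF dv])
    finally show ?thesis .
  qed
  show ?thesis unfolding eq
  proof (rule weighted_average_bound(2)[where B="?B"])
    show "integrable lborel ?\<rho>" using i[of "\<lambda>_. 1"] by simp
    show "integrable lborel (\<lambda>t. ?\<rho> t * ?F x t)" for x by (rule i[OF cont])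
    show "integrable lborel (\<lambda>t. ?\<rho> t * (?F x t)\<^sup>2)" for x by (intro i continuous_on_power cont)
    show "(\<integral>\<^sup>+x. ennreal ((?F x t)\<^sup>2) \<partial>lborel) \<le> ennreal ?B" for t by (rule b)
    show "0 \<le> ?B" by (intro mult_nonneg_nonneg sum_nonneg) auto
    show "(\<lambda>(x, t). ?F x t) \<in> borel_measurable (borel \<Otimes>\<^sub>M borel)" by measurable
  qed auto
qed

lemma tame_smooth:
  fixes v :: "real^'n::finite \<Rightarrow> real"
  assumes "smooth v" "sqint v" "\<And>i. sqint (partial i v)"
  shows "tame v"
  unfolding tame_def using sqnorm_increment_smooth[OF assms(1,3)] assms(2)
  by (intro conjI exI[of _ "\<Sum>i\<in>UNIV. sqnorm (partial i v)"]) (auto simp: mult.commute sum_nonneg)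

lemma tame_test: "\<phi> \<in> test_functions U \<Longrightarrow> tame \<phi>"
  by (intro tame_smooth test_smooth test_sqint test_partial)

text \<open>Integration runs over the whole space; since test functions vanish off \<open>U\<close>,
  the relation still concerns only the values of \<open>u\<close> and \<open>g\<close> on
  \<open>U\<close>.\<close>

definition wpartial :: "(real^'n::finite) set \<Rightarrow> 'n \<Rightarrow> (real^'n \<Rightarrow> real) \<Rightarrow> (real^'n \<Rightarrow> real) \<Rightarrow> bool" where
  "wpartial U i u g \<longleftrightarrow> (\<forall>\<phi>\<in>test_functions U.
      (LINT x|lborel. u x * partial i \<phi> x) = - (LINT x|lborel. g x * \<phi> x))"

lemma wpartialD:
  "wpartial U i u g \<Longrightarrow> \<phi> \<in> test_functions U \<Longrightarrow>
    (LINT x|lborel. u x * partial i \<phi> x) = - (LINT x|lborel. g x * \<phi> x)"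
  by (simp add: wpartial_def)

text \<open>Mollifications satisfy the increment bound with the weak derivatives in place of the
  gradient, uniformly in \<open>n\<close>, and the bound survives the limit. The squared triangle
  inequality costs a factor 2, harmless because only some constant is asked for.\<close>

lemma tame_weak:
  fixes u :: "real^'n::finite \<Rightarrow> real"
  assumes u: "sqint u" and g: "\<And>i. sqint (g i)" and w: "\<And>i. wpartial UNIV i u (g i)"
  shows "tame u"
proof -
  obtain \<rho> :: "nat \<Rightarrow> real^'n \<Rightarrow> real" where \<rho>: "\<And>n. \<rho> n \<in> test_functions UNIV" "\<And>n x. 0 \<le> \<rho> n x"
    "\<And>n. (LINT x|lborel. \<rho> n x) = 1"
    and lim: "\<And>u. sqint u \<Longrightarrow> (\<lambda>n. sqnorm (\<lambda>x. conv u (\<rho> n) x - u x)) \<longlonglongrightarrow> 0"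
    by (rule mollifier_sequence[of 1], simp) (rule that)
  define S where "S = (\<Sum>i\<in>UNIV. sqnorm (g i))"
  have S: "0 \<le> S" by (simp add: S_def sum_nonneg)
  have "sqnorm (\<lambda>x. u (x + z) - u x) \<le> (2 * S) * (norm z)\<^sup>2" for z
  proof -
    let ?v = "\<lambda>n. conv u (\<rho> n)"
    have v: "sqint (?v n)" for n by (rule sqint_conv[OF u \<rho>])
    have pv: "partial i (?v n) = conv (g i) (\<rho> n)" for i n
      unfolding partial_conv[OF u \<rho>(1)] by (rule conv_weak_partial[OF wpartialD[OF w] \<rho>(1)])
    have vz: "sqnorm (\<lambda>x. ?v n (x + z) - ?v n x) \<le> (norm z)\<^sup>2 * S" for n
    proof -
      have "sqnorm (\<lambda>x. ?v n (x + z) - ?v n x) \<le> (norm z)\<^sup>2 * (\<Sum>i\<in>UNIV. sqnorm (partial i (?v n)))"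
        by (rule sqnorm_increment_smooth[OF smooth_conv[OF u \<rho>(1)]]) (simp add: pv sqint_conv[OF g \<rho>])
      also have "\<dots> \<le> (norm z)\<^sup>2 * S" unfolding S_def
        by (intro mult_left_mono sum_mono) (auto simp: pv sqnorm_conv_le[OF g \<rho>])
      finally show ?thesis .
    qed
    have le: "sqnorm (\<lambda>x. u (x + z) - u x) \<le> 2 * S * (norm z)\<^sup>2 + 8 * sqnorm (\<lambda>x. ?v n x - u x)" for n
    proof -
      let ?w = "\<lambda>x. u x - ?v n x"
      have w: "sqint ?w" by (rule sqint_diff[OF u v])
      have "sqnorm (\<lambda>x. (?v n (x + z) - ?v n x) + (?w (x + z) - ?w x))
        \<le> 2 * sqnorm (\<lambda>x. ?v n (x + z) - ?v n x) + 2 * sqnorm (\<lambda>x. ?w (x + z) - ?w x)"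
        by (rule sqnorm_add_le[OF sqint_diff[OF sqint_translate[OF v] v] sqint_diff[OF sqint_translate[OF w] w]])
      moreover have "sqnorm (\<lambda>x. ?w (x + z) - ?w x) \<le> 2 * sqnorm ?w + 2 * sqnorm ?w"
        using sqnorm_diff_le[OF sqint_translate[OF w, of z] w] by (simp only: sqnorm_translate[OF w])
      moreover have "sqnorm ?w = sqnorm (\<lambda>x. ?v n x - u x)" by (rule sqnorm_minus_commute)
      moreover have "(\<lambda>x. (?v n (x + z) - ?v n x) + (?w (x + z) - ?w x)) = (\<lambda>x. u (x + z) - u x)" by auto
      ultimately show ?thesis using vz[of n] by (simp add: mult.commute mult.left_commute)
    qed
    have "(\<lambda>n. 2 * S * (norm z)\<^sup>2 + 8 * sqnorm (\<lambda>x. ?v n x - u x)) \<longlonglongrightarrow> 2 * S * (norm z)\<^sup>2 + 8 * 0"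
      by (intro tendsto_intros lim[OF u])
    then have "sqnorm (\<lambda>x. u (x + z) - u x) \<le> 2 * S * (norm z)\<^sup>2 + 8 * 0"
      by (rule LIMSEQ_le_const) (use le in auto)
    then show ?thesis by simp
  qed
  with u S show ?thesis unfolding tame_def by (intro conjI exI[of _ "2 * S"]) auto
qed

section \<open>Convergence and transport of the nonlocal form\<close>

lemma incr_measurable [measurable]:
  fixes u v :: "'a::euclidean_space \<Rightarrow> real"
  assumes [measurable]: "u \<in> borel_measurable borel" "v \<in> borel_measurable borel"
  shows "incr u v \<in> borel_measurable borel"
  unfolding incr_def by measurable

lemma incr_integrable:
  "sqint u \<Longrightarrow> sqint v \<Longrightarrow> integrable lborel (\<lambda>x. (u (x + z) - u x) * (v (x + z) - v x))"
  by (intro integrable_mult_sqint sqint_diff sqint_translate)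

lemma incr_diff_left:
  assumes "sqint u" "sqint u'" "sqint v"
  shows "incr (\<lambda>x. u x - u' x) v z = incr u v z - incr u' v z"
proof -
  have "((u (x + z) - u' (x + z)) - (u x - u' x)) * (v (x + z) - v x)
      = (u (x + z) - u x) * (v (x + z) - v x) - (u' (x + z) - u' x) * (v (x + z) - v x)" for x
    by (simp add: algebra_simps)
  then show ?thesis
    unfolding incr_def using incr_integrable[OF assms(1,3), of z] incr_integrable[OF assms(2,3), of z] by simp
qed

text \<open>The second estimate keeps the absolute value inside the integral: it supplies the
  integrability on the product space that Fubini needs in
  \<open>double_integral_eq_nonlocal\<close>.\<close>

lemma abs_incr_le:
  fixes u v :: "'a::euclidean_space \<Rightarrow> real"
  assumes "tame u" "tame v"
  obtains C where "C \<ge> 0" "\<And>z. \<bar>incr u v z\<bar> \<le> C * min 1 ((norm z)\<^sup>2)"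
    "\<And>z. (LINT x|lborel. \<bar>(u (x + z) - u x) * (v (x + z) - v x)\<bar>) \<le> C * min 1 ((norm z)\<^sup>2)"
proof -
  obtain C where C: "C \<ge> 0" "\<And>z. sqnorm (\<lambda>x. u (x + z) - u x) \<le> C * min 1 ((norm z)\<^sup>2)"
    using tame_bound[OF assms(1)] by blast
  obtain D where D: "D \<ge> 0" "\<And>z. sqnorm (\<lambda>x. v (x + z) - v x) \<le> D * min 1 ((norm z)\<^sup>2)"
    using tame_bound[OF assms(2)] by blast
  have b: "(LINT x|lborel. \<bar>(u (x + z) - u x) * (v (x + z) - v x)\<bar>) \<le> (C + D) * min 1 ((norm z)\<^sup>2)" for z
  proof -
    have u: "sqint (\<lambda>x. \<bar>u (x + z) - u x\<bar>)" and v: "sqint (\<lambda>x. \<bar>v (x + z) - v x\<bar>)"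
      using sqint_diff[OF sqint_translate[OF tame_sqint[OF assms(1)], of z] tame_sqint[OF assms(1)]]
        sqint_diff[OF sqint_translate[OF tame_sqint[OF assms(2)], of z] tame_sqint[OF assms(2)]]
      by (auto simp: sqint_def)
    have "(LINT x|lborel. \<bar>(u (x + z) - u x) * (v (x + z) - v x)\<bar>)
        \<le> \<bar>LINT x|lborel. \<bar>u (x + z) - u x\<bar> * \<bar>v (x + z) - v x\<bar>\<bar>"
      by (simp add: abs_mult)
    also have "\<dots> \<le> (sqnorm (\<lambda>x. \<bar>u (x + z) - u x\<bar>) + sqnorm (\<lambda>x. \<bar>v (x + z) - v x\<bar>)) / 2"
      by (rule abs_integral_mult_le[OF u v])
    also have "\<dots> \<le> sqnorm (\<lambda>x. u (x + z) - u x) + sqnorm (\<lambda>x. v (x + z) - v x)"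
      by (simp add: sqnorm_def)
    also have "\<dots> \<le> C * min 1 ((norm z)\<^sup>2) + D * min 1 ((norm z)\<^sup>2)" by (intro add_mono C D)
    finally show ?thesis by (simp add: distrib_right)
  qed
  moreover have "\<bar>incr u v z\<bar> \<le> (C + D) * min 1 ((norm z)\<^sup>2)" for z
    unfolding incr_def by (rule order.trans[OF integral_abs_bound b])
  moreover have "0 \<le> C + D" using C D by simp
  ultimately show thesis by (intro that)
qed

lemma nonlocal_integrable:
  fixes u v :: "real^'n::finite \<Rightarrow> real"
  assumes s: "0 < s" "s < 1" and u: "tame u" and v: "tame v"
  shows "integrable lborel (\<lambda>z. incr u v z * riesz s z)"
proof -
  note [measurable] = sqint_measurable[OF tame_sqint[OF u]] sqint_measurable[OF tame_sqint[OF v]]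
  obtain C where C: "C \<ge> 0" "\<And>z. \<bar>incr u v z\<bar> \<le> C * min 1 ((norm z)\<^sup>2)"
    "\<And>z. (LINT x|lborel. \<bar>(u (x + z) - u x) * (v (x + z) - v x)\<bar>) \<le> C * min 1 ((norm z)\<^sup>2)"
    by (rule abs_incr_le[OF u v]) (rule that)
  show ?thesis
  proof (rule Bochner_Integration.integrable_bound)
    show "integrable lborel (\<lambda>z::real^'n. C * (min 1 ((norm z)\<^sup>2) * riesz s z))"
      by (intro integrable_mult_right integrable_min_riesz s)
    show "AE z in lborel. norm (incr u v z * riesz s z) \<le> norm (C * (min 1 ((norm z)\<^sup>2) * riesz s z))"
    proof (rule AE_I2)
      fix z :: "real^'n"
      have "\<bar>incr u v z\<bar> * riesz s z \<le> C * min 1 ((norm z)\<^sup>2) * riesz s z"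
        by (intro mult_right_mono C riesz_nonneg)
      also have "\<dots> \<le> \<bar>C * (min 1 ((norm z)\<^sup>2) * riesz s z)\<bar>" by (simp only: mult.assoc abs_ge_self)
      finally show "norm (incr u v z * riesz s z) \<le> norm (C * (min 1 ((norm z)\<^sup>2) * riesz s z))"
        by (simp only: real_norm_def abs_mult abs_of_nonneg[OF riesz_nonneg])
    qed
  qed measurable
qed

lemma nonlocal_diff_left:
  fixes u v :: "real^'n::finite \<Rightarrow> real"
  assumes s: "0 < s" "s < 1" and u: "tame u" "tame u'" and v: "tame v"
  shows "nonlocal s (\<lambda>x. u x - u' x) v = nonlocal s u v - nonlocal s u' v"
  using nonlocal_integrable[OF s u(1) v] nonlocal_integrable[OF s u(2) v]
  by (simp add: nonlocal_def incr_diff_left tame_sqint u v left_diff_distrib)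

text \<open>A discrete integration by parts, from translation invariance. It leaves \<open>u\<close>
  free of differences, so that weak derivatives and mollifiers can be moved between the two
  arguments for each fixed \<open>z\<close>.\<close>

lemma incr_eq_sdiff:
  fixes u v :: "'a::euclidean_space \<Rightarrow> real"
  assumes u: "sqint u" and v: "sqint v"
  shows "incr u v z = (LINT x|lborel. u x * sdiff z v x)"
proof -
  note [measurable] = sqint_measurable[OF u] sqint_measurable[OF v]
  have uz: "sqint (\<lambda>x. u (x + z))" and vz: "sqint (\<lambda>x. v (x + z))" and vm: "sqint (\<lambda>x. v (x - z))"
    using sqint_translate[OF u, of z] sqint_translate[OF v, of z] sqint_translate[OF v, of "-z"] by auto
  note i = integrable_mult_sqint
  have 1: "(LINT x|lborel. u (x + z) * v (x + z)) = (LINT x|lborel. u x * v x)"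
    by (rule lborel_integral_translate[of "\<lambda>x. u x * v x"]) measurable
  have 2: "(LINT x|lborel. u (x + z) * v x) = (LINT x|lborel. u x * v (x - z))"
    using lborel_integral_translate[of "\<lambda>x. u x * v (x - z)" z] by simp
  have "incr u v z = (LINT x|lborel. u (x + z) * v (x + z) - u (x + z) * v x - u x * v (x + z) + u x * v x)"
    unfolding incr_def by (intro Bochner_Integration.integral_cong) (auto simp: algebra_simps)
  also have "\<dots> = (LINT x|lborel. u (x + z) * v (x + z)) - (LINT x|lborel. u (x + z) * v x)
      - (LINT x|lborel. u x * v (x + z)) + (LINT x|lborel. u x * v x)"
    using i[OF uz vz] i[OF uz v] i[OF u vz] i[OF u v] by simp
  also have "\<dots> = (LINT x|lborel. 2 * (u x * v x) - u x * v (x + z) - u x * v (x - z))"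
    unfolding 1 2 using i[OF u v] i[OF u vz] i[OF u vm] by simp
  also have "\<dots> = (LINT x|lborel. u x * sdiff z v x)"
    by (intro Bochner_Integration.integral_cong) (auto simp: sdiff_def algebra_simps)
  finally show ?thesis .
qed

lemma
  fixes \<phi> :: "real^'n::finite \<Rightarrow> real"
  assumes \<phi>: "\<phi> \<in> test_functions U"
  shows test_sdiff: "sdiff z \<phi> \<in> test_functions UNIV"
    and partial_sdiff: "partial i (sdiff z \<phi>) = sdiff z (partial i \<phi>)"
proof -
  have t: "(\<lambda>x. 2 * \<phi> x) \<in> test_functions UNIV" "(\<lambda>x. \<phi> (x + z)) \<in> test_functions UNIV"
    "(\<lambda>x. \<phi> (x - z)) \<in> test_functions UNIV"
    using test_cmult[OF test_mono[OF \<phi>, of UNIV], of 2] test_translate[OF \<phi>, of z] test_translate[OF \<phi>, of "-z"] by auto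
  have eq: "sdiff z \<phi> = (\<lambda>x. (2 * \<phi> x - \<phi> (x + z)) - \<phi> (x - z))" by (auto simp: sdiff_def)
  show "sdiff z \<phi> \<in> test_functions UNIV" unfolding eq by (intro test_diff t)
  have p: "partial i (\<lambda>x. \<phi> (x + z)) = (\<lambda>x. partial i \<phi> (x + z))" for z
    by (rule partial_translate[OF test_smooth[OF \<phi>]])
  have p': "partial i (\<lambda>x. \<phi> (x - z)) = (\<lambda>x. partial i \<phi> (x - z))" using p[of "-z"] by simp
  show "partial i (sdiff z \<phi>) = sdiff z (partial i \<phi>)"
  proof
    fix x
    have "partial i (sdiff z \<phi>) x = partial i (\<lambda>x. 2 * \<phi> x - \<phi> (x + z)) x - partial i (\<lambda>x. \<phi> (x - z)) x"
      unfolding eq by (intro partial_diff test_differentiable[OF test_diff[OF t(1,2)]] test_differentiable[OF t(3)])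
    also have "partial i (\<lambda>x. 2 * \<phi> x - \<phi> (x + z)) x = partial i (\<lambda>x. 2 * \<phi> x) x - partial i (\<lambda>x. \<phi> (x + z)) x"
      by (intro partial_diff test_differentiable[OF t(1)] test_differentiable[OF t(2)])
    also have "partial i (\<lambda>x. 2 * \<phi> x) x = 2 * partial i \<phi> x"
      by (rule partial_cmult[OF test_differentiable[OF \<phi>]])
    finally show "partial i (sdiff z \<phi>) x = sdiff z (partial i \<phi>) x" by (simp add: p p' sdiff_def[abs_def])
  qed
qed

text \<open>Second differences of a test function leave its original support, so the weak derivative
  must be one on the whole space even when \<phi> is supported in \<open>U\<close>.\<close>

lemma nonlocal_wpartial:
  fixes u g \<phi> :: "real^'n::finite \<Rightarrow> real"
  assumes u: "sqint u" and g: "sqint g" and w: "wpartial UNIV i u g" and \<phi>: "\<phi> \<in> test_functions U"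
  shows "nonlocal s u (partial i \<phi>) = - nonlocal s g \<phi>"
proof -
  have "incr u (partial i \<phi>) z = - incr g \<phi> z" for z
    unfolding incr_eq_sdiff[OF u test_sqint[OF test_partial[OF \<phi>]]] incr_eq_sdiff[OF g test_sqint[OF \<phi>]]
    using wpartialD[OF w test_sdiff[OF \<phi>, of z]] by (simp add: partial_sdiff[OF \<phi>])
  then show ?thesis by (simp add: nonlocal_def)
qed

lemma conv_sdiff:
  fixes \<phi> :: "real^'n::finite \<Rightarrow> real"
  assumes \<phi>: "sqint \<phi>" and \<rho>: "\<rho> \<in> test_functions U"
  shows "conv (sdiff z \<phi>) \<rho> = sdiff z (conv \<phi> \<rho>)"
proof
  fix x
  note [measurable] = sqint_measurable[OF \<phi>] test_measurable[OF \<rho>]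
  have t: "(LINT y|lborel. \<phi> (y + w) * \<rho> (x - y)) = conv \<phi> \<rho> (x + w)" for w
  proof -
    have "(LINT y|lborel. (\<lambda>y. \<phi> y * \<rho> (x + w - y)) (y + w)) = (LINT y|lborel. \<phi> y * \<rho> (x + w - y))"
      by (rule lborel_integral_translate) measurable
    then show ?thesis by (simp add: conv_def)
  qed
  have i: "integrable lborel (\<lambda>y. \<phi> (y + w) * \<rho> (x - y))" for w
    by (rule integrable_mult_sqint[OF sqint_translate[OF \<phi>] test_sqint[OF test_reflect[OF \<rho>]]])
  have "conv (sdiff z \<phi>) \<rho> x = (LINT y|lborel. 2 * (\<phi> (y + 0) * \<rho> (x - y)) - \<phi> (y + z) * \<rho> (x - y) - \<phi> (y + - z) * \<rho> (x - y))"
    unfolding conv_def sdiff_def by (intro Bochner_Integration.integral_cong) (auto simp: algebra_simps)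
  also have "\<dots> = 2 * conv \<phi> \<rho> (x + 0) - conv \<phi> \<rho> (x + z) - conv \<phi> \<rho> (x + - z)"
    unfolding t[symmetric] using i by (simp only: Bochner_Integration.integral_diff Bochner_Integration.integrable_diff
      integrable_mult_right integral_mult_right_zero)
  finally show "conv (sdiff z \<phi>) \<rho> x = sdiff z (conv \<phi> \<rho>) x" by (simp add: sdiff_def)
qed

text \<open>For each \<open>z\<close>, mollification is self-adjoint and commutes with second
  differences.\<close>

lemma nonlocal_conv:
  fixes u \<phi> :: "real^'n::finite \<Rightarrow> real"
  assumes u: "sqint u" and \<phi>: "\<phi> \<in> test_functions U" and \<rho>: "\<rho> \<in> test_functions V" "\<And>x. \<rho> (- x) = \<rho> x"
    and cu: "sqint (conv u \<rho>)" and c\<phi>: "sqint (conv \<phi> \<rho>)"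
  shows "nonlocal s (conv u \<rho>) \<phi> = nonlocal s u (conv \<phi> \<rho>)"
proof -
  have "incr (conv u \<rho>) \<phi> z = incr u (conv \<phi> \<rho>) z" for z
    unfolding incr_eq_sdiff[OF cu test_sqint[OF \<phi>]] incr_eq_sdiff[OF u c\<phi>]
      conv_adjoint[OF u test_sqint[OF test_sdiff[OF \<phi>]] \<rho>] conv_sdiff[OF test_sqint[OF \<phi>] \<rho>(1)] ..
  then show ?thesis by (simp add: nonlocal_def)
qed

text \<open>
  Pointwise, \<open>(a' - a) (e'\<^sup>2 a' - e\<^sup>2 a) = (e' a' - e a)\<^sup>2 - a a' (e' - e)\<^sup>2\<close>; the increments of \<open>\<eta>\<close> in the
  last term absorb the singularity of the kernel.
\<close>

lemma nonlocal_coercive: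
  fixes \<eta> :: "real^'n::finite \<Rightarrow> real"
  assumes s: "0 < s" "s < 1" and \<eta>: "\<eta> \<in> test_functions U"
  obtains C where "C \<ge> 0" "\<And>w. tame w \<Longrightarrow> tame (\<lambda>x. (\<eta> x)\<^sup>2 * w x) \<Longrightarrow>
    nonlocal s w (\<lambda>x. (\<eta> x)\<^sup>2 * w x) \<ge> - C * sqnorm w"
proof -
  obtain L where L: "L > 0" "\<And>x z. \<bar>\<eta> (x + z) - \<eta> x\<bar> \<le> L * norm z" using test_lipschitz[OF \<eta>] by metis
  obtain B where B: "B > 0" "\<And>x. \<bar>\<eta> x\<bar> \<le> B" using test_bounded[OF \<eta>] by metis
  \<comment> \<open>Short shifts are governed by the Lipschitz constant \<open>L\<close>, long ones
    by the bound \<open>2 * B\<close> on increments of \<eta>.\<close>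
  define D where "D = L\<^sup>2 + 4 * B\<^sup>2"
  have D: "0 \<le> D" by (simp add: D_def)
  have sq: "(\<eta> (x + z) - \<eta> x)\<^sup>2 \<le> D * min 1 ((norm z)\<^sup>2)" for x z
  proof -
    have "\<bar>\<eta> (x + z) - \<eta> x\<bar>\<^sup>2 \<le> (L * norm z)\<^sup>2" by (intro power_mono L) auto
    then have 1: "(\<eta> (x + z) - \<eta> x)\<^sup>2 \<le> L\<^sup>2 * (norm z)\<^sup>2" by (simp add: power_mult_distrib)
    have "\<bar>\<eta> (x + z) - \<eta> x\<bar> \<le> 2 * B" using B(2)[of x] B(2)[of "x + z"] by linarith
    then have "\<bar>\<eta> (x + z) - \<eta> x\<bar>\<^sup>2 \<le> (2 * B)\<^sup>2" by (intro power_mono) auto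
    then have 2: "(\<eta> (x + z) - \<eta> x)\<^sup>2 \<le> 4 * B\<^sup>2" by (simp add: power_mult_distrib)
    show ?thesis
    proof (cases "(norm z)\<^sup>2 \<le> 1")
      case True
      have "0 \<le> 4 * B\<^sup>2 * (norm z)\<^sup>2" by (intro mult_nonneg_nonneg) auto
      with 1 have "(\<eta> (x + z) - \<eta> x)\<^sup>2 \<le> L\<^sup>2 * (norm z)\<^sup>2 + 4 * B\<^sup>2 * (norm z)\<^sup>2" by linarith
      then show ?thesis using True by (simp add: D_def min_absorb2 distrib_right)
    next
      case False
      have "0 \<le> L\<^sup>2" by simp
      with 2 have "(\<eta> (x + z) - \<eta> x)\<^sup>2 \<le> L\<^sup>2 + 4 * B\<^sup>2" by linarith
      then show ?thesis using False by (simp add: D_def)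
    qed
  qed
  define C where "C = (LINT z|(lborel :: (real^'n) measure). D * (min 1 ((norm z)\<^sup>2) * riesz s z))"
  have iC: "integrable lborel (\<lambda>z::real^'n. D * (min 1 ((norm z)\<^sup>2) * riesz s z))"
    by (intro integrable_mult_right integrable_min_riesz s)
  have C: "0 \<le> C" unfolding C_def
    by (intro Bochner_Integration.integral_nonneg mult_nonneg_nonneg D riesz_nonneg) auto
  show thesis
  proof (rule that[OF C])
    fix w :: "real^'n \<Rightarrow> real"
    let ?W = "\<lambda>x. (\<eta> x)\<^sup>2 * w x"
    assume w: "tame w" and W: "tame ?W"
    note sw = tame_sqint[OF w]
    have low: "- (D * min 1 ((norm z)\<^sup>2)) * sqnorm w \<le> incr w ?W z" for z
    proof -
      have p: "- (D * min 1 ((norm z)\<^sup>2)) * (((w (x + z))\<^sup>2 + (w x)\<^sup>2) / 2) \<le> (w (x + z) - w x) * (?W (x + z) - ?W x)" for x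
      proof -
        define a a' e e' where "a = w x" and "a' = w (x + z)" and "e = \<eta> x" and "e' = \<eta> (x + z)"
        have id: "(a' - a) * (e'\<^sup>2 * a' - e\<^sup>2 * a) = (e' * a' - e * a)\<^sup>2 - a * a' * (e' - e)\<^sup>2"
          by (simp add: power2_eq_square algebra_simps)
        have "a * a' * (e' - e)\<^sup>2 \<le> ((a'\<^sup>2 + a\<^sup>2) / 2) * (e' - e)\<^sup>2"
          using sum_squares_bound[of a a'] by (intro mult_right_mono) (simp_all add: mult.assoc)
        also have "\<dots> \<le> ((a'\<^sup>2 + a\<^sup>2) / 2) * (D * min 1 ((norm z)\<^sup>2))"
          unfolding e'_def e_def by (intro mult_left_mono sq) auto
        finally have le: "a * a' * (e' - e)\<^sup>2 \<le> ((a'\<^sup>2 + a\<^sup>2) / 2) * (D * min 1 ((norm z)\<^sup>2))" .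
        have "- (D * min 1 ((norm z)\<^sup>2)) * ((a'\<^sup>2 + a\<^sup>2) / 2) = - (((a'\<^sup>2 + a\<^sup>2) / 2) * (D * min 1 ((norm z)\<^sup>2)))"
          by (simp only: mult_minus_left mult.commute)
        with le have "- (D * min 1 ((norm z)\<^sup>2)) * ((a'\<^sup>2 + a\<^sup>2) / 2) \<le> (a' - a) * (e'\<^sup>2 * a' - e\<^sup>2 * a)"
          unfolding id using zero_le_power2[of "e' * a' - e * a"] by linarith
        then show ?thesis by (simp add: a_def a'_def e_def e'_def)
      qed
      have i: "integrable lborel (\<lambda>x. ((w (x + z))\<^sup>2 + (w x)\<^sup>2) / 2)"
        using sqint_integrable[OF sqint_translate[OF sw, of z]] sqint_integrable[OF sw] by simp
      have "(LINT x|lborel. ((w (x + z))\<^sup>2 + (w x)\<^sup>2) / 2) = (sqnorm (\<lambda>x. w (x + z)) + sqnorm w) / 2"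
        using sqint_integrable[OF sqint_translate[OF sw, of z]] sqint_integrable[OF sw]
        by (simp add: sqnorm_def)
      also have "\<dots> = sqnorm w" by (simp add: sqnorm_translate[OF sw])
      finally have "(LINT x|lborel. - (D * min 1 ((norm z)\<^sup>2)) * (((w (x + z))\<^sup>2 + (w x)\<^sup>2) / 2)) = - (D * min 1 ((norm z)\<^sup>2)) * sqnorm w"
        by (simp only: integral_mult_right_zero)
      moreover have "(LINT x|lborel. - (D * min 1 ((norm z)\<^sup>2)) * (((w (x + z))\<^sup>2 + (w x)\<^sup>2) / 2)) \<le> incr w ?W z"
        unfolding incr_def by (intro integral_mono p integrable_mult_right i incr_integrable sw tame_sqint[OF W])
      ultimately show ?thesis by (simp only:)
    qed
    have "- C * sqnorm w = (LINT z|lborel. - (D * min 1 ((norm z)\<^sup>2)) * sqnorm w * riesz s (z::real^'n))"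
    proof -
      have "- (D * min 1 ((norm z)\<^sup>2)) * sqnorm w * riesz s z = - sqnorm w * (D * (min 1 ((norm z)\<^sup>2) * riesz s z))" for z :: "real^'n"
        by simp
      then show ?thesis by (simp only: integral_mult_right_zero C_def) simp
    qed
    also have "\<dots> \<le> nonlocal s w ?W"
      unfolding nonlocal_def
    proof (intro integral_mono mult_right_mono low riesz_nonneg nonlocal_integrable[OF s w W])
      have "- (D * min 1 ((norm z)\<^sup>2)) * sqnorm w * riesz s z = - sqnorm w * (D * (min 1 ((norm z)\<^sup>2) * riesz s z))" for z :: "real^'n"
        by simp
      then show "integrable lborel (\<lambda>z::real^'n. - (D * min 1 ((norm z)\<^sup>2)) * sqnorm w * riesz s z)"
        using integrable_mult_right[OF iC, of "- sqnorm w"] by (simp only:)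
    qed
    finally show "- C * sqnorm w \<le> nonlocal s w ?W" .
  qed
qed

text \<open>On each fibre over \<open>x\<close> the map is a translation, so Tonelli reduces the
  claim to translation invariance.\<close>

lemma distr_shear:
  "distr (lborel \<Otimes>\<^sub>M lborel) (lborel \<Otimes>\<^sub>M lborel) (\<lambda>(x, z). (x, x + z)) = (lborel \<Otimes>\<^sub>M lborel :: ('a::euclidean_space \<times> 'a) measure)"
proof (rule measure_eqI)
  let ?L = "lborel \<Otimes>\<^sub>M lborel :: ('a \<times> 'a) measure"
  let ?T = "\<lambda>(x::'a, z). (x, x + z)"
  fix A assume A: "A \<in> sets (distr ?L ?L ?T)"
  then have AL [measurable]: "A \<in> sets ?L" by simp
  have T [measurable]: "?T \<in> ?L \<rightarrow>\<^sub>M ?L" by measurable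
  have "emeasure (distr ?L ?L ?T) A = (\<integral>\<^sup>+p. indicator A p \<partial>distr ?L ?L ?T)"
    by (rule nn_integral_indicator[OF A, symmetric])
  also have "\<dots> = (\<integral>\<^sup>+p. indicator A (?T p) \<partial>?L)" by (rule nn_integral_distr) measurable
  also have "\<dots> = (\<integral>\<^sup>+x. \<integral>\<^sup>+z. indicator A (?T (x, z)) \<partial>lborel \<partial>lborel)"
    by (rule lborel.nn_integral_fst[symmetric]) measurable
  also have "\<dots> = (\<integral>\<^sup>+x. \<integral>\<^sup>+y. indicator A (x, y) \<partial>lborel \<partial>lborel)"
  proof (rule nn_integral_cong)
    fix x
    have P: "Pair x \<in> (lborel :: 'a measure) \<rightarrow>\<^sub>M ?L" by (rule measurable_Pair1') simp
    have I: "(indicator A :: 'a \<times> 'a \<Rightarrow> ennreal) \<in> ?L \<rightarrow>\<^sub>M borel"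
      by (rule borel_measurable_indicator[OF AL])
    have "(\<lambda>y. indicator A (x, y) :: ennreal) \<in> (lborel :: 'a measure) \<rightarrow>\<^sub>M borel"
      by (rule measurable_compose[OF P I])
    then have "(\<lambda>y. indicator A (x, y) :: ennreal) \<in> borel_measurable borel"
      by (simp only: measurable_lborel2)
    from nn_integral_lborel_translate[OF this, of x]
    show "(\<integral>\<^sup>+z. indicator A (?T (x, z)) \<partial>lborel) = (\<integral>\<^sup>+y. indicator A (x, y) \<partial>lborel)"
      by (simp only: case_prod_conv add.commute)
  qed
  also have "\<dots> = (\<integral>\<^sup>+p. indicator A p \<partial>?L)" by (rule lborel.nn_integral_fst) measurable
  also have "\<dots> = emeasure ?L A" by (rule nn_integral_indicator[OF AL])
  finally show "emeasure (distr ?L ?L ?T) A = emeasure ?L A" .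
qed simp

lemma
  fixes F :: "'a::euclidean_space \<Rightarrow> 'a \<Rightarrow> real"
  assumes [measurable]: "case_prod F \<in> borel_measurable (lborel \<Otimes>\<^sub>M lborel)"
  shows integrable_shear: "integrable (lborel \<Otimes>\<^sub>M lborel) (\<lambda>(x, z). F x (x + z)) = integrable (lborel \<Otimes>\<^sub>M lborel) (case_prod F)"
    and integral_shear: "(LINT (x, z)|(lborel \<Otimes>\<^sub>M lborel). F x (x + z)) = (LINT (x, y)|(lborel \<Otimes>\<^sub>M lborel). F x y)"
proof -
  let ?L = "lborel \<Otimes>\<^sub>M lborel :: ('a \<times> 'a) measure"
  have T: "(\<lambda>(x, z). (x, x + z)) \<in> ?L \<rightarrow>\<^sub>M ?L" by measurable
  have eq: "(\<lambda>p. case_prod F ((\<lambda>(x, z). (x, x + z)) p)) = (\<lambda>(x, z). F x (x + z))" by auto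
  show "integrable ?L (\<lambda>(x, z). F x (x + z)) = integrable ?L (case_prod F)"
    using integrable_distr_eq[OF T assms] unfolding distr_shear eq by simp
  show "(LINT (x, z)|?L. F x (x + z)) = (LINT (x, y)|?L. F x y)"
    using integral_distr[OF T assms] unfolding distr_shear eq by simp
qed

text \<open>Reversing both differences leaves their product unchanged. The shear
  \<open>y = x + z\<close> then turns the distance into \<open>z\<close> alone, and Fubini is
  justified by the bound of \<open>abs_incr_le\<close> against the kernel.\<close>

lemma double_integral_eq_nonlocal:
  fixes u v :: "real^'n::finite \<Rightarrow> real"
  assumes s: "0 < s" "s < 1" and u: "tame u" and v: "tame v"
  shows "(LINT (x, y)|lborel. (u x - u y) * (v x - v y) / norm (x - y) powr (real CARD('n) + 2 * s)) = nonlocal s u v"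
proof -
  let ?L = "lborel \<Otimes>\<^sub>M lborel :: ((real^'n) \<times> (real^'n)) measure"
  note [measurable] = sqint_measurable[OF tame_sqint[OF u]] sqint_measurable[OF tame_sqint[OF v]]
  let ?F = "\<lambda>x y. (u y - u x) * (v y - v x) * riesz s (y - x)"
  let ?H = "\<lambda>z x. (u (x + z) - u x) * (v (x + z) - v x) * riesz s z"
  obtain C where C: "C \<ge> 0" "\<And>z. \<bar>incr u v z\<bar> \<le> C * min 1 ((norm z)\<^sup>2)"
    "\<And>z. (LINT x|lborel. \<bar>(u (x + z) - u x) * (v (x + z) - v x)\<bar>) \<le> C * min 1 ((norm z)\<^sup>2)"
    by (rule abs_incr_le[OF u v]) (rule that)
  have H: "integrable ?L (case_prod ?H)"
  proof (rule lborel_pair.Fubini_integrable)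
    show "case_prod ?H \<in> borel_measurable ?L" by measurable
    show "AE z in lborel. integrable lborel (\<lambda>x. case (z, x) of (z, x) \<Rightarrow> ?H z x)"
      using incr_integrable[OF tame_sqint[OF u] tame_sqint[OF v]] by (intro AE_I2) simp
    have eq: "(LINT x|lborel. norm (case (z, x) of (z, x) \<Rightarrow> ?H z x))
        = (LINT x|lborel. \<bar>(u (x + z) - u x) * (v (x + z) - v x)\<bar>) * riesz s z" for z
      by (simp add: abs_mult abs_of_nonneg[OF riesz_nonneg])
    show "integrable lborel (\<lambda>z. LINT x|lborel. norm (case (z, x) of (z, x) \<Rightarrow> ?H z x))"
      unfolding eq
    proof (rule Bochner_Integration.integrable_bound)
      show "integrable lborel (\<lambda>z::real^'n. C * (min 1 ((norm z)\<^sup>2) * riesz s z))"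
        by (intro integrable_mult_right integrable_min_riesz s)
      show "AE z in lborel. norm ((LINT x|lborel. \<bar>(u (x + z) - u x) * (v (x + z) - v x)\<bar>) * riesz s z)
          \<le> norm (C * (min 1 ((norm z)\<^sup>2) * riesz s z))"
      proof (rule AE_I2)
        fix z :: "real^'n"
        have 0: "0 \<le> (LINT x|lborel. \<bar>(u (x + z) - u x) * (v (x + z) - v x)\<bar>)"
          by (intro Bochner_Integration.integral_nonneg) auto
        have "(LINT x|lborel. \<bar>(u (x + z) - u x) * (v (x + z) - v x)\<bar>) * riesz s z \<le> C * min 1 ((norm z)\<^sup>2) * riesz s z"
          by (intro mult_right_mono C riesz_nonneg)
        also have "\<dots> \<le> \<bar>C * (min 1 ((norm z)\<^sup>2) * riesz s z)\<bar>" by (simp only: mult.assoc abs_ge_self)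
        finally show "norm ((LINT x|lborel. \<bar>(u (x + z) - u x) * (v (x + z) - v x)\<bar>) * riesz s z)
            \<le> norm (C * (min 1 ((norm z)\<^sup>2) * riesz s z))"
          unfolding real_norm_def abs_of_nonneg[OF mult_nonneg_nonneg[OF 0 riesz_nonneg]] .
      qed
    qed measurable
  qed
  have Fm: "case_prod ?F \<in> borel_measurable ?L" by measurable
  have sh: "(\<lambda>(x, z). ?F x (x + z)) = (\<lambda>(x, z). ?H z x)" by auto
  have "(LINT (x, y)|lborel. (u x - u y) * (v x - v y) / norm (x - y) powr (real CARD('n) + 2 * s))
      = (LINT (x, y)|?L. ?F x y)"
    unfolding lborel_prod
  proof (intro Bochner_Integration.integral_cong refl)
    fix p :: "(real^'n) \<times> (real^'n)"
    have "(a - b) * (c - d) / norm (x - y) powr (real CARD('n) + 2 * s) = (b - a) * (d - c) * riesz s (y - x)"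
      for a b c d :: real and x y :: "real^'n"
      by (simp add: riesz_def norm_minus_commute algebra_simps)
    then show "(case p of (x, y) \<Rightarrow> (u x - u y) * (v x - v y) / norm (x - y) powr (real CARD('n) + 2 * s))
        = (case p of (x, y) \<Rightarrow> ?F x y)" by (cases p) simp
  qed
  also have "\<dots> = (LINT (x, z)|?L. ?H z x)"
    using integral_shear[OF Fm] unfolding sh by simp
  also have "\<dots> = (LINT (z, x)|?L. ?H z x)"
    using lborel_pair.integral_product_swap[of "case_prod ?H"] by (simp add: case_prod_beta')
  also have "\<dots> = (LINT z|lborel. LINT x|lborel. ?H z x)"
    by (rule lborel_pair.integral_fst[OF H, symmetric])
  also have "\<dots> = nonlocal s u v" by (simp add: nonlocal_def incr_def)
  finally show ?thesis .
qed

section \<open>Interaction of functions with separated supports\<close>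

definition rieszcut :: "real \<Rightarrow> real \<Rightarrow> real^'n::finite \<Rightarrow> real" where
  "rieszcut s \<delta> z = riesz s z * indicator {z. \<delta> \<le> norm z} z"

lemma rieszcut_integrable:
  assumes s: "0 < s" "s < 1" and \<delta>: "0 < \<delta>"
  shows "integrable lborel (rieszcut s \<delta> :: real^'n::finite \<Rightarrow> real)"
proof (rule Bochner_Integration.integrable_bound)
  let ?c = "1 / min 1 (\<delta>\<^sup>2)"
  have c: "min 1 (\<delta>\<^sup>2) > 0" using \<delta> by simp
  show "integrable lborel (\<lambda>z::real^'n. ?c * (min 1 ((norm z)\<^sup>2) * riesz s z))"
    by (intro integrable_mult_right integrable_min_riesz s)
  show "AE z in lborel. norm (rieszcut s \<delta> (z::real^'n)) \<le> norm (?c * (min 1 ((norm z)\<^sup>2) * riesz s z))"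
  proof (rule AE_I2)
    fix z :: "real^'n"
    show "norm (rieszcut s \<delta> z) \<le> norm (?c * (min 1 ((norm z)\<^sup>2) * riesz s z))"
    proof (cases "\<delta> \<le> norm z")
      case True
      then have "\<delta>\<^sup>2 \<le> (norm z)\<^sup>2" using \<delta> by (intro power_mono) auto
      then have "1 \<le> ?c * min 1 ((norm z)\<^sup>2)" using c by (simp add: pos_le_divide_eq min.coboundedI2)
      then have "1 * riesz s z \<le> ?c * min 1 ((norm z)\<^sup>2) * riesz s z" by (intro mult_right_mono riesz_nonneg)
      also have "\<dots> \<le> norm (?c * (min 1 ((norm z)\<^sup>2) * riesz s z))" by (simp only: mult.assoc real_norm_def abs_ge_self)
      finally show ?thesis using True by (simp add: rieszcut_def abs_of_nonneg[OF riesz_nonneg])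
    qed (simp add: rieszcut_def)
  qed
  show "rieszcut s \<delta> \<in> borel_measurable (lborel :: (real^'n) measure)"
    unfolding rieszcut_def by measurable
qed

text \<open>All products of \<open>h\<close> and \<phi> at points closer than \<delta> vanish, so
  only the cross terms survive and the kernel is never evaluated near the origin. The shifts by
  \<open>z\<close> and by \<open>- z\<close> each contribute the same interaction, whence the factor
  2.\<close>

lemma nonlocal_disjoint_support:
  fixes h \<phi> :: "real^'n::finite \<Rightarrow> real"
  assumes s: "0 < s" "s < 1" and \<delta>: "0 < \<delta>" and h: "sqint h" and \<phi>: "sqint \<phi>"
    and far: "\<And>x y. h x \<noteq> 0 \<Longrightarrow> \<phi> y \<noteq> 0 \<Longrightarrow> \<delta> \<le> dist x y"
  shows "nonlocal s h \<phi> = - 2 * (LINT x|lborel. conv h (rieszcut s \<delta>) x * \<phi> x)"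
proof -
  let ?k = "rieszcut s \<delta> :: real^'n \<Rightarrow> real" and ?L = "lborel \<Otimes>\<^sub>M lborel :: ((real^'n) \<times> (real^'n)) measure"
  note [measurable] = sqint_measurable[OF h] sqint_measurable[OF \<phi>]
  have k: "integrable lborel ?k" by (rule rieszcut_integrable[OF s \<delta>])
  have ke: "?k (- z) = ?k z" for z by (simp add: rieszcut_def riesz_minus indicator_def)
  have ke2: "?k (x - y) = ?k (y - x)" for x y using ke[of "y - x"] by simp
  have [measurable]: "?k \<in> borel_measurable borel" using k by auto
  define J where "J z = (LINT x|lborel. h x * \<phi> (x + z)) * ?k z" for z
  have [measurable]: "J \<in> borel_measurable borel" unfolding J_def by measurable
  let ?F = "\<lambda>x y. h x * \<phi> y * ?k (x - y)"
  have F: "integrable ?L (case_prod ?F)" by (rule integrable_kernel[OF h \<phi> k])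
  have sh: "(\<lambda>(x, z). ?F x (x + z)) = (\<lambda>(x, z). h x * \<phi> (x + z) * ?k z)" using ke by auto
  have G: "integrable ?L (\<lambda>(x, z). h x * \<phi> (x + z) * ?k z)"
    using F integrable_shear[of ?F] unfolding sh by (simp add: borel_measurable_integrable)
  have Jint: "integrable lborel J"
    using lborel_pair.integrable_snd[OF G] by (simp add: J_def[abs_def])
  have Jm: "integrable lborel (\<lambda>z. J (- z))" using lborel_integrable_reflect[OF Jint, of 0] by simp
  have zero: "h x * \<phi> y = 0" if "dist x y < \<delta>" for x y using far[of x y] that by force
  \<comment> \<open>For long \<open>z\<close> only the diagonal term of \<open>sdiff\<close>
    disappears; for short \<open>z\<close> all three terms do, and so does the cut kernel.\<close>
  have point: "incr h \<phi> z * riesz s z = - J z - J (- z)" for z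
  proof (cases "\<delta> \<le> norm z")
    case True
    have i: "integrable lborel (\<lambda>x. h x * \<phi> (x + w))" for w
      by (rule integrable_mult_sqint[OF h sqint_translate[OF \<phi>]])
    have "h x * sdiff z \<phi> x = - (h x * \<phi> (x + z)) - h x * \<phi> (x + - z)" for x
      using zero[of x x] \<delta> by (simp add: sdiff_def algebra_simps)
    then have "incr h \<phi> z = - (LINT x|lborel. h x * \<phi> (x + z)) - (LINT x|lborel. h x * \<phi> (x + - z))"
      unfolding incr_eq_sdiff[OF h \<phi>] using i[of z] i[of "- z"] by simp
    moreover have "riesz s z = ?k z" using True by (simp add: rieszcut_def)
    moreover have "?k (- z) = ?k z" by (rule ke)
    ultimately show ?thesis by (simp only: J_def left_diff_distrib mult_minus_left)
  next
    case False
    have z: "h x * \<phi> (x + z) = 0" "h x * \<phi> (x - z) = 0" "h x * \<phi> x = 0" for x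
      using zero[of x "x + z"] zero[of x "x - z"] zero[of x x] False \<delta> by (simp_all add: dist_norm)
    have "h x * sdiff z \<phi> x = 2 * (h x * \<phi> x) - h x * \<phi> (x + z) - h x * \<phi> (x - z)" for x
      by (simp add: sdiff_def algebra_simps)
    then have "h x * sdiff z \<phi> x = 0" for x unfolding z by simp
    then have "incr h \<phi> z = 0" unfolding incr_eq_sdiff[OF h \<phi>] by (simp only: Bochner_Integration.integral_zero)
    moreover have "?k z = 0" using False by (simp add: rieszcut_def)
    moreover have "?k (- z) = ?k z" by (rule ke)
    ultimately show ?thesis by (simp add: J_def)
  qed
  have "nonlocal s h \<phi> = - (LINT z|lborel. J z) - (LINT z|lborel. J (- z))"
    unfolding nonlocal_def point using Jint Jm by simp
  also have "(LINT z|lborel. J (- z)) = (LINT z|lborel. J z)"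
    using lborel_integral_reflect[of J 0] by simp
  also have "(LINT z|lborel. J z) = (LINT (x, z)|?L. h x * \<phi> (x + z) * ?k z)"
    using lborel_pair.integral_snd[OF G] by (simp add: J_def)
  also have "\<dots> = (LINT (x, y)|?L. ?F x y)"
    using integral_shear[OF borel_measurable_integrable[OF F]] unfolding sh .
  also have "\<dots> = (LINT y|lborel. LINT x|lborel. ?F x y)"
    by (rule lborel_pair.integral_snd[OF F, symmetric])
  also have "\<dots> = (LINT y|lborel. conv h ?k y * \<phi> y)"
  proof (intro Bochner_Integration.integral_cong refl)
    fix y
    have "(LINT x|lborel. ?F x y) = (LINT x|lborel. \<phi> y * (h x * ?k (y - x)))"
      by (intro Bochner_Integration.integral_cong) (auto simp: ke2[of _ y])
    then show "(LINT x|lborel. ?F x y) = conv h ?k y * \<phi> y" by (simp add: conv_def)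
  qed
  finally show ?thesis by simp
qed

subsection \<open>Interior second-order regularity\<close>

text \<open>A form of Young's inequality for kernels without sign or unit mass, as needed for
  derivatives of mollifiers and for general test functions.\<close>

lemma sqint_conv_test:
  fixes u :: "real^'n::finite \<Rightarrow> real"
  assumes u: "sqint u" and \<rho>: "\<rho> \<in> test_functions U"
  shows "sqint (conv u \<rho>)"
proof -
  note [measurable] = sqint_measurable[OF u] test_measurable[OF \<rho>]
  txt \<open>Jensen's inequality is applied with weight \<open>\<bar>\<rho>\<bar> + \<sigma>\<close>: the mollifier \<open>\<sigma>\<close> keeps the total mass positive.\<close>
  define M where "M = (LINT y|lborel. \<bar>\<rho> y\<bar>) + 1"
  have "0 \<le> (LINT y|lborel. \<bar>\<rho> y\<bar>)" by (intro Bochner_Integration.integral_nonneg) auto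
  then have M: "M > 0" unfolding M_def by (rule add_nonneg_pos) simp
  obtain \<sigma> :: "real^'n \<Rightarrow> real" where \<sigma>: "\<sigma> \<in> test_functions UNIV" "\<And>x. 0 \<le> \<sigma> x"
      "\<And>x. 1 \<le> norm x \<Longrightarrow> \<sigma> x = 0" "(LINT x|lborel. \<sigma> x) = 1" "\<And>x. \<sigma> (- x) = \<sigma> x"
    by (rule mollifier_exists[of 1], simp) (rule that)
  note [measurable] = test_measurable[OF \<sigma>(1)]
  let ?p = "\<lambda>y. (\<bar>\<rho> y\<bar> + \<sigma> y) / M"
  \<comment> \<open>The factor undoes the weight \<open>?p\<close> and restores the sign of \<rho>.
    Its quotient has absolute value at most 1, being 0 by convention where \<rho> and \<sigma> both
    vanish.\<close>
  let ?F = "\<lambda>x y. M * (\<rho> y / (\<bar>\<rho> y\<bar> + \<sigma> y)) * u (x - y)"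
  have pF: "?p y * ?F x y = \<rho> y * u (x - y)" for x y
    using M \<sigma>(2)[of y] by (cases "\<rho> y = 0") (auto simp: field_simps add_nonneg_eq_0_iff)
  have q: "\<bar>\<rho> y / (\<bar>\<rho> y\<bar> + \<sigma> y)\<bar> \<le> 1" for y
    using \<sigma>(2)[of y] by (auto simp: abs_div_pos divide_le_eq_1)
  have q2: "(\<rho> y / (\<bar>\<rho> y\<bar> + \<sigma> y))\<^sup>2 \<le> 1" for y
    using q[of y] by (simp add: abs_square_le_1)
  have pt: "integrable lborel ?p" using test_integrable[OF \<rho>] test_integrable[OF \<sigma>(1)] by simp
  have i2: "integrable lborel (\<lambda>y. ?p y * (?F x y)\<^sup>2)" for x
  proof (rule Bochner_Integration.integrable_bound)
    have a: "integrable lborel (\<lambda>y. \<bar>\<rho> y * (u (x - y))\<^sup>2\<bar> + \<sigma> y * (u (x - y))\<^sup>2)"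
      by (intro Bochner_Integration.integrable_add integrable_abs integrable_test_mult[OF \<rho>] integrable_test_mult[OF \<sigma>(1)]
          sqint_integrable sqint_reflect u)
    show "integrable lborel (\<lambda>y. M * (\<bar>\<rho> y * (u (x - y))\<^sup>2\<bar> + \<sigma> y * (u (x - y))\<^sup>2))"
      by (rule integrable_mult_right[OF a])
    show "AE y in lborel. norm (?p y * (?F x y)\<^sup>2) \<le> norm (M * (\<bar>\<rho> y * (u (x - y))\<^sup>2\<bar> + \<sigma> y * (u (x - y))\<^sup>2))"
    proof (rule AE_I2)
      fix y
      define t where "t = \<rho> y / (\<bar>\<rho> y\<bar> + \<sigma> y)"
      have n: "0 \<le> M * (\<bar>\<rho> y\<bar> + \<sigma> y) * (u (x - y))\<^sup>2" using M \<sigma>(2)[of y] by simp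
      have "?p y * (M * t * u (x - y))\<^sup>2 = (M * (\<bar>\<rho> y\<bar> + \<sigma> y) * (u (x - y))\<^sup>2) * t\<^sup>2"
        using M by (simp add: power_mult_distrib power2_eq_square)
      also have "\<dots> \<le> (M * (\<bar>\<rho> y\<bar> + \<sigma> y) * (u (x - y))\<^sup>2) * 1"
        unfolding t_def by (intro mult_left_mono q2 n)
      finally have le: "?p y * (M * t * u (x - y))\<^sup>2 \<le> M * (\<bar>\<rho> y * (u (x - y))\<^sup>2\<bar> + \<sigma> y * (u (x - y))\<^sup>2)"
        by (simp add: abs_mult algebra_simps)
      moreover have "0 \<le> ?p y * (M * t * u (x - y))\<^sup>2" using M \<sigma>(2)[of y] by simp
      ultimately show "norm (?p y * (?F x y)\<^sup>2) \<le> norm (M * (\<bar>\<rho> y * (u (x - y))\<^sup>2\<bar> + \<sigma> y * (u (x - y))\<^sup>2))"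
        unfolding t_def real_norm_def by (subst abs_of_nonneg) (auto intro: order.trans[OF _ abs_ge_self])
    qed
  qed measurable
  have b: "(\<integral>\<^sup>+x. ennreal ((?F x y)\<^sup>2) \<partial>lborel) \<le> ennreal (M\<^sup>2 * sqnorm u)" for y
  proof -
    have le: "(?F x y)\<^sup>2 \<le> M\<^sup>2 * (u (x + - y))\<^sup>2" for x
    proof -
      have "(M * t * v)\<^sup>2 = (M\<^sup>2 * v\<^sup>2) * t\<^sup>2" for t v :: real by (simp add: power_mult_distrib)
      then have "(?F x y)\<^sup>2 = (M\<^sup>2 * (u (x - y))\<^sup>2) * (\<rho> y / (\<bar>\<rho> y\<bar> + \<sigma> y))\<^sup>2" .
      also have "\<dots> \<le> (M\<^sup>2 * (u (x - y))\<^sup>2) * 1" by (intro mult_left_mono q2) auto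
      finally show ?thesis by simp
    qed
    have "(\<integral>\<^sup>+x. ennreal ((?F x y)\<^sup>2) \<partial>lborel) \<le> (\<integral>\<^sup>+x. ennreal (M\<^sup>2 * (u (x + - y))\<^sup>2) \<partial>lborel)"
      by (intro nn_integral_mono ennreal_leI le)
    also have "\<dots> = ennreal (LINT x|lborel. M\<^sup>2 * (u (x + - y))\<^sup>2)"
      using sqint_integrable[OF sqint_translate[OF u, of "- y"]] by (intro nn_integral_eq_integral) auto
    also have "(LINT x|lborel. M\<^sup>2 * (u (x + - y))\<^sup>2) = M\<^sup>2 * sqnorm (\<lambda>x. u (x + - y))" by (simp add: sqnorm_def)
    finally show ?thesis unfolding sqnorm_translate[OF u] .
  qed
  have one: "(LINT y|lborel. ?p y) = 1"
    using M test_integrable[OF \<rho>] test_integrable[OF \<sigma>(1)] by (simp add: M_def \<sigma>(4))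
  have eq: "conv u \<rho> = (\<lambda>x. LINT y|lborel. ?p y * ?F x y)"
    unfolding pF by (rule ext, rule conv_eq_reflect) measurable
  show ?thesis unfolding eq
  proof (rule weighted_average_bound(1)[OF _ pt one _ _ i2 b])
    show "(\<lambda>(x, y). ?F x y) \<in> borel_measurable (borel \<Otimes>\<^sub>M borel)" by measurable
    show "0 \<le> ?p y" for y using M \<sigma>(2)[of y] by simp
    show "integrable lborel (\<lambda>y. ?p y * ?F x y)" for x
      unfolding pF by (rule integrable_mult_sqint[OF test_sqint[OF \<rho>] sqint_reflect[OF u]])
    show "0 \<le> M\<^sup>2 * sqnorm u" by simp
  qed
qed

lemma partial_conv_left:
  fixes \<phi> :: "real^'n::finite \<Rightarrow> real"
  assumes \<phi>: "\<phi> \<in> test_functions U" and \<rho>: "\<rho> \<in> test_functions V"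
  shows "partial i (conv \<phi> \<rho>) = conv (partial i \<phi>) \<rho>"
  unfolding partial_conv[OF test_sqint[OF \<phi>] \<rho>]
  by (rule conv_weak_partial[OF integral_by_parts_test[OF test_smooth[OF \<phi>]] \<rho>])

lemma tame_conv:
  fixes u :: "real^'n::finite \<Rightarrow> real"
  assumes u: "sqint u" and \<rho>: "\<rho> \<in> test_functions U"
  shows "tame (conv u \<rho>)"
  by (rule tame_smooth[OF smooth_conv[OF u \<rho>] sqint_conv_test[OF u \<rho>]])
     (simp add: partial_conv[OF u \<rho>] sqint_conv_test[OF u test_partial[OF \<rho>]])

text \<open>After one integration by parts this is the pointwise identity \<open>partial j w x *
  partial j \<psi> x = (partial j (\<lambda>x. \<eta> x * w x) x)\<^sup>2 - (partial j \<eta> x * w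
  x)\<^sup>2\<close>: with the square of the cutoff no mixed term is left over.\<close>

lemma energy_identity:
  fixes w \<eta> :: "real^'n::finite \<Rightarrow> real"
  assumes w: "smooth w" and \<eta>: "\<eta> \<in> test_functions U"
  defines "\<psi> \<equiv> \<lambda>x. (\<eta> x)\<^sup>2 * w x"
  shows "- (\<Sum>j\<in>UNIV. LINT x|lborel. w x * partial j (partial j \<psi>) x)
    = (\<Sum>j\<in>UNIV. sqnorm (partial j (\<lambda>x. \<eta> x * w x))) - (\<Sum>j\<in>UNIV. sqnorm (\<lambda>x. partial j \<eta> x * w x))"
proof -
  let ?\<eta>w = "\<lambda>x. \<eta> x * w x"
  have \<eta>w: "?\<eta>w \<in> test_functions U" using test_mult[OF w \<eta>] by (simp add: mult.commute)
  have \<psi>: "\<psi> \<in> test_functions U" and \<psi>eq: "\<psi> = (\<lambda>x. \<eta> x * ?\<eta>w x)"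
    using test_mult[OF test_smooth[OF \<eta>] \<eta>w] by (simp_all add: \<psi>_def power2_eq_square mult.assoc)
  have d\<eta>w: "(\<lambda>x. partial j \<eta> x * w x) \<in> test_functions U" for j
    using test_mult[OF w test_partial[OF \<eta>]] by (simp add: mult.commute)
  have "- (LINT x|lborel. w x * partial j (partial j \<psi>) x) = sqnorm (partial j ?\<eta>w) - sqnorm (\<lambda>x. partial j \<eta> x * w x)" for j
  proof -
    have pt: "partial j w x * partial j \<psi> x = (partial j ?\<eta>w x)\<^sup>2 - (partial j \<eta> x * w x)\<^sup>2" for x
    proof -
      have 1: "partial j ?\<eta>w x = \<eta> x * partial j w x + partial j \<eta> x * w x"
        by (rule partial_mult[OF test_differentiable[OF \<eta>] smooth_differentiable[OF w]])
      have 2: "partial j \<psi> x = \<eta> x * partial j ?\<eta>w x + partial j \<eta> x * ?\<eta>w x"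
        unfolding \<psi>eq by (rule partial_mult[OF test_differentiable[OF \<eta>] test_differentiable[OF \<eta>w]])
      show ?thesis unfolding 2 1 by (simp add: power2_eq_square algebra_simps)
    qed
    have "- (LINT x|lborel. w x * partial j (partial j \<psi>) x) = (LINT x|lborel. partial j w x * partial j \<psi> x)"
      using integral_by_parts_test[OF w test_partial[OF \<psi>]] by simp
    also have "\<dots> = sqnorm (partial j ?\<eta>w) - sqnorm (\<lambda>x. partial j \<eta> x * w x)"
      unfolding pt sqnorm_def
      by (rule Bochner_Integration.integral_diff[OF sqint_integrable[OF test_sqint[OF test_partial[OF \<eta>w]]] sqint_integrable[OF test_sqint[OF d\<eta>w]]])
    finally show ?thesis .
  qed
  then show ?thesis by (simp add: sum_negf[symmetric] sum_subtractf[symmetric])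
qed

text \<open>A Caccioppoli inequality. The datum appears in divergence form, so only its L^2 norm
  enters; the constant is fixed before \<open>w\<close>, \<open>g\<close> and \<open>i\<close>,
  which is what makes the estimate usable on differences.\<close>

lemma energy_estimate:
  fixes \<eta> :: "real^'n::finite \<Rightarrow> real"
  assumes s: "0 < s" "s < 1" and c: "0 \<le> c" and \<eta>: "\<eta> \<in> test_functions U"
  obtains C where "C \<ge> 0" "\<And>w g i. smooth w \<Longrightarrow> tame w \<Longrightarrow> sqint g \<Longrightarrow>
    - (\<Sum>j\<in>UNIV. LINT x|lborel. w x * partial j (partial j (\<lambda>x. (\<eta> x)\<^sup>2 * w x)) x)
      + c * nonlocal s w (\<lambda>x. (\<eta> x)\<^sup>2 * w x) = - (LINT x|lborel. g x * partial i (\<lambda>x. (\<eta> x)\<^sup>2 * w x) x) \<Longrightarrow>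
    (\<Sum>j\<in>UNIV. sqnorm (partial j (\<lambda>x. \<eta> x * w x))) \<le> C * (sqnorm w + sqnorm g)"
proof -
  obtain C1 where C1: "C1 \<ge> 0" "\<And>w. tame w \<Longrightarrow> tame (\<lambda>x. (\<eta> x)\<^sup>2 * w x) \<Longrightarrow>
    nonlocal s w (\<lambda>x. (\<eta> x)\<^sup>2 * w x) \<ge> - C1 * sqnorm w"
    by (rule nonlocal_coercive[OF s \<eta>]) (rule that)
  obtain B0 where B0: "B0 > 0" "\<And>x. \<bar>\<eta> x\<bar> \<le> B0" using test_bounded[OF \<eta>] by metis
  have "\<exists>B>0. \<forall>x. \<bar>partial j \<eta> x\<bar> \<le> B" for j using test_bounded[OF test_partial[OF \<eta>]] by metis
  then obtain B where B: "\<And>j. B j > 0" "\<And>j x. \<bar>partial j \<eta> x\<bar> \<le> B j" by metis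
  define S where "S = (\<Sum>j\<in>UNIV. (B j)\<^sup>2)"
  have BS: "(B i)\<^sup>2 \<le> S" for i unfolding S_def by (rule member_le_sum) auto
  have S0: "0 \<le> S" unfolding S_def by (intro sum_nonneg) auto
  define C where "C = 3 * S + 2 * (c * C1) + 2 * B0\<^sup>2"
  have C: "0 \<le> C" using c C1(1) S0 by (simp add: C_def)
  show thesis
  proof (rule that[OF C])
    fix w g :: "real^'n \<Rightarrow> real" and i
    let ?\<psi> = "\<lambda>x. (\<eta> x)\<^sup>2 * w x" and ?\<eta>w = "\<lambda>x. \<eta> x * w x"
    let ?X = "\<Sum>j\<in>UNIV. sqnorm (partial j ?\<eta>w)"
    assume w: "smooth w" "tame w" and g: "sqint g"
      and eq: "- (\<Sum>j\<in>UNIV. LINT x|lborel. w x * partial j (partial j ?\<psi>) x) + c * nonlocal s w ?\<psi>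
        = - (LINT x|lborel. g x * partial i ?\<psi> x)"
    have \<eta>w: "?\<eta>w \<in> test_functions U" using test_mult[OF w(1) \<eta>] by (simp add: mult.commute)
    have \<psi>: "?\<psi> \<in> test_functions U" and \<psi>eq: "?\<psi> = (\<lambda>x. \<eta> x * ?\<eta>w x)"
      using test_mult[OF test_smooth[OF \<eta>] \<eta>w] by (simp_all add: power2_eq_square mult.assoc)
    note sw = tame_sqint[OF w(2)]
    have dw: "sqint (\<lambda>x. partial j \<eta> x * w x)" "sqnorm (\<lambda>x. partial j \<eta> x * w x) \<le> (B j)\<^sup>2 * sqnorm w" for j
      using sqint_mult_bounded[OF test_measurable[OF test_partial[OF \<eta>]] sw B(2)]
        sqnorm_mult_bounded[OF test_measurable[OF test_partial[OF \<eta>]] sw B(2)] by auto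
    have \<eta>g: "sqint (\<lambda>x. \<eta> x * g x)" "sqnorm (\<lambda>x. \<eta> x * g x) \<le> B0\<^sup>2 * sqnorm g"
      using sqint_mult_bounded[OF test_measurable[OF \<eta>] g B0(2)]
        sqnorm_mult_bounded[OF test_measurable[OF \<eta>] g B0(2)] by auto
    have s\<eta>w: "sqint (partial i ?\<eta>w)" by (rule test_sqint[OF test_partial[OF \<eta>w]])
    have nl: "- C1 * sqnorm w \<le> nonlocal s w ?\<psi>" by (rule C1(2)[OF w(2) tame_test[OF \<psi>]])
    have sum: "(\<Sum>j\<in>UNIV. sqnorm (\<lambda>x. partial j \<eta> x * w x)) \<le> S * sqnorm w"
      unfolding S_def sum_distrib_right by (intro sum_mono dw)
    have split: "(LINT x|lborel. g x * partial i ?\<psi> x)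
        = (LINT x|lborel. (\<eta> x * g x) * partial i ?\<eta>w x) + (LINT x|lborel. (\<eta> x * g x) * (partial i \<eta> x * w x))"
    proof -
      have "partial i ?\<psi> x = \<eta> x * partial i ?\<eta>w x + partial i \<eta> x * ?\<eta>w x" for x
        unfolding \<psi>eq by (rule partial_mult[OF test_differentiable[OF \<eta>] test_differentiable[OF \<eta>w]])
      then have "g x * partial i ?\<psi> x = (\<eta> x * g x) * partial i ?\<eta>w x + (\<eta> x * g x) * (partial i \<eta> x * w x)" for x
        by (simp add: algebra_simps)
      then show ?thesis
        using integrable_mult_sqint[OF \<eta>g(1) s\<eta>w] integrable_mult_sqint[OF \<eta>g(1) dw(1)] by simp
    qed
    \<comment> \<open>The gradient sum \<open>?X\<close> enters with the coefficient 1/2 and can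
      therefore be absorbed on the left.\<close>
    have a1: "\<bar>LINT x|lborel. (\<eta> x * g x) * partial i ?\<eta>w x\<bar> \<le> (B0\<^sup>2 * sqnorm g + ?X) / 2"
    proof -
      have "sqnorm (partial i ?\<eta>w) \<le> ?X" by (rule member_le_sum) auto
      then show ?thesis
        by (intro order.trans[OF abs_integral_mult_le[OF \<eta>g(1) s\<eta>w]] divide_right_mono add_mono \<eta>g(2)) auto
    qed
    have a2: "\<bar>LINT x|lborel. (\<eta> x * g x) * (partial i \<eta> x * w x)\<bar> \<le> (B0\<^sup>2 * sqnorm g + S * sqnorm w) / 2"
    proof -
      have "(B i)\<^sup>2 * sqnorm w \<le> S * sqnorm w" by (intro mult_right_mono BS) auto
      then show ?thesis
        by (intro order.trans[OF abs_integral_mult_le[OF \<eta>g(1) dw(1)]] divide_right_mono add_mono \<eta>g(2)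
            order.trans[OF dw(2)]) auto
    qed
    have X: "?X - (\<Sum>j\<in>UNIV. sqnorm (\<lambda>x. partial j \<eta> x * w x)) + c * nonlocal s w ?\<psi> = - (LINT x|lborel. g x * partial i ?\<psi> x)"
      using eq unfolding energy_identity[OF w(1) \<eta>] .
    have "c * (- C1 * sqnorm w) \<le> c * nonlocal s w ?\<psi>" by (rule mult_left_mono[OF nl c])
    then have nl2: "- (c * C1 * sqnorm w) \<le> c * nonlocal s w ?\<psi>" by simp
    \<comment> \<open>Here \<open>x\<close> is the gradient sum, \<open>t\<close> the bound on the
      cutoff terms, \<open>q\<close> the loss in the nonlocal form and \<open>r\<close> the bound on
      the datum. Cancelling x/2 and doubling yields the coefficients 3, 2 and 2 of
      \<open>C\<close>.\<close>
    have absorb: "x \<le> 3 * t + 2 * q + 2 * r"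
      if "x - y + n = - l" "l = a + b" "- a \<le> (r + x) / 2" "- b \<le> (r + t) / 2" "- q \<le> n" "y \<le> t"
      for x y n l a b r t q :: real
    proof -
      have "2 * (- a) \<le> r + x" "2 * (- b) \<le> r + t"
        using that(3,4) by (simp_all only: pos_le_divide_eq zero_less_numeral mult.commute)
      with that show ?thesis by linarith
    qed
    have "?X \<le> 3 * (S * sqnorm w) + 2 * (c * C1 * sqnorm w) + 2 * (B0\<^sup>2 * sqnorm g)"
      by (rule absorb[OF X split abs_le_D2[OF a1] abs_le_D2[OF a2] nl2 sum])
    also have "\<dots> \<le> C * (sqnorm w + sqnorm g)"
    proof -
      have "0 \<le> B0\<^sup>2 * sqnorm w" "0 \<le> S * sqnorm g" "0 \<le> c * C1 * sqnorm g"
        using c C1(1) S0 by (auto intro!: mult_nonneg_nonneg)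
      moreover have "C * (sqnorm w + sqnorm g) = 3 * (S * sqnorm w) + 2 * (c * C1 * sqnorm w) + 2 * (B0\<^sup>2 * sqnorm w)
          + (3 * (S * sqnorm g) + 2 * (c * C1 * sqnorm g) + 2 * (B0\<^sup>2 * sqnorm g))"
        by (simp add: C_def algebra_simps)
      ultimately show ?thesis by linarith
    qed
    finally show "?X \<le> C * (sqnorm w + sqnorm g)" .
  qed
qed

text \<open>
  All local derivatives are moved to the test function, so that the equation makes sense for
  square-integrable \<open>u\<close> and is stable under mollification and differentiation.
\<close>

definition very_weak :: "(real^'n::finite) set \<Rightarrow> real \<Rightarrow> real \<Rightarrow> (real^'n \<Rightarrow> real) \<Rightarrow> (real^'n \<Rightarrow> real) \<Rightarrow> bool" where
  "very_weak U s c u f \<longleftrightarrow> (\<forall>\<phi>\<in>test_functions U.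
    - (\<Sum>j\<in>UNIV. LINT x|lborel. u x * partial j (partial j \<phi>) x) + c * nonlocal s u \<phi> = (LINT x|lborel. f x * \<phi> x))"

text \<open>The equation for \<open>u\<close> is tested with \<open>partial i \<psi>\<close>; one
  derivative returns to \<open>u\<close>, while \<open>f\<close> is left undifferentiated.\<close>

lemma very_weak_derivative:
  fixes u :: "real^'n::finite \<Rightarrow> real"
  assumes u: "sqint u" and g: "sqint g" and w: "wpartial UNIV i u g" and eq: "very_weak U s c u f"
    and \<psi>: "\<psi> \<in> test_functions U"
  shows "- (\<Sum>j\<in>UNIV. LINT x|lborel. g x * partial j (partial j \<psi>) x) + c * nonlocal s g \<psi>
    = - (LINT x|lborel. f x * partial i \<psi> x)"
proof -
  have t: "partial i \<psi> \<in> test_functions U" by (rule test_partial[OF \<psi>])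
  have "- (\<Sum>j\<in>UNIV. LINT x|lborel. u x * partial j (partial j (partial i \<psi>)) x) + c * nonlocal s u (partial i \<psi>)
      = (LINT x|lborel. f x * partial i \<psi> x)"
    using eq t unfolding very_weak_def by blast
  moreover have "(LINT x|lborel. u x * partial j (partial j (partial i \<psi>)) x) = - (LINT x|lborel. g x * partial j (partial j \<psi>) x)" for j
  proof -
    have "partial j (partial j (partial i \<psi>)) = partial i (partial j (partial j \<psi>))"
      by (simp only: partial_commute[OF test_smooth[OF \<psi>], of j i]
          partial_commute[OF test_smooth[OF test_partial[OF \<psi>]], of j i])
    moreover have "partial j (partial j \<psi>) \<in> test_functions UNIV"
      by (rule test_mono[OF test_partial[OF test_partial[OF \<psi>]]]) simp
    ultimately show ?thesis using wpartialD[OF w] by simp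
  qed
  moreover have "nonlocal s u (partial i \<psi>) = - nonlocal s g \<psi>"
    by (rule nonlocal_wpartial[OF u g w \<psi>])
  ultimately show ?thesis by (simp add: sum_negf)
qed

lemma wpartial_limit:
  fixes u :: "real^'n::finite \<Rightarrow> real"
  assumes U: "\<And>n. U n \<in> test_functions V" and u: "sqint u" and p: "sqint p"
    and lu: "(\<lambda>n. sqnorm (\<lambda>x. U n x - u x)) \<longlonglongrightarrow> 0"
    and lp: "(\<lambda>n. sqnorm (\<lambda>x. partial j (U n) x - p x)) \<longlonglongrightarrow> 0"
  shows "wpartial UNIV j u p"
  unfolding wpartial_def
proof
  fix \<phi> :: "real^'n \<Rightarrow> real" assume \<phi>: "\<phi> \<in> test_functions UNIV"
  have "(\<lambda>n. LINT x|lborel. U n x * partial j \<phi> x) \<longlonglongrightarrow> (LINT x|lborel. u x * partial j \<phi> x)"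
    by (rule tendsto_integral_mult_sqint[OF test_sqint[OF U] u test_sqint[OF test_partial[OF \<phi>]] lu])
  moreover have "(\<lambda>n. - (LINT x|lborel. partial j (U n) x * \<phi> x)) \<longlonglongrightarrow> - (LINT x|lborel. p x * \<phi> x)"
    by (intro tendsto_minus tendsto_integral_mult_sqint[OF test_sqint[OF test_partial[OF U]] p test_sqint[OF \<phi>] lp])
  moreover have "(LINT x|lborel. U n x * partial j \<phi> x) = - (LINT x|lborel. partial j (U n) x * \<phi> x)" for n
    by (rule integral_by_parts_test[OF test_smooth[OF U] \<phi>])
  ultimately show "(LINT x|lborel. u x * partial j \<phi> x) = - (LINT x|lborel. p x * \<phi> x)"
    using LIMSEQ_unique by simp
qed

text \<open>The conclusion concerns the cut-off derivative, whose derivative is a weak derivative on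
  the whole space; the induction step needs it in that form.\<close>

theorem interior_H2:
  fixes u f :: "real^'n::finite \<Rightarrow> real"
  assumes s: "0 < s" "s < 1" and c: "0 \<le> c" and U: "open U"
    and u: "sqint u" and g: "sqint g" and w: "wpartial UNIV i u g" and f: "sqint f"
    and eq: "very_weak U s c u f" and \<eta>: "\<eta> \<in> test_functions U"
  shows "\<exists>p. sqint p \<and> wpartial UNIV j (\<lambda>x. \<eta> x * g x) p"
proof -
  obtain K where K: "smooth \<eta>" "compact K" "K \<subseteq> U" "\<And>x. x \<notin> K \<Longrightarrow> \<eta> x = 0"
    using \<eta> by (rule test_functionsE) (rule that)
  obtain d where d: "d > 0" "(\<Union>x\<in>K. ball x d) \<subseteq> U"
    using compact_subset_open_imp_ball_epsilon_subset[OF K(2) U K(3)] by blast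
  have near: "y \<in> U" if "x \<in> K" "dist x y \<le> d / 2" for x y
  proof -
    have "y \<in> ball x d" using that d(1) by simp
    with that(1) d(2) show ?thesis by blast
  qed
  obtain \<rho> :: "nat \<Rightarrow> real^'n \<Rightarrow> real" where \<rho>: "\<And>n. \<rho> n \<in> test_functions UNIV" "\<And>n x. 0 \<le> \<rho> n x"
    "\<And>n. (LINT x|lborel. \<rho> n x) = 1" "\<And>n x. \<rho> n (- x) = \<rho> n x"
    "\<And>n x. d / 2 \<le> norm x \<Longrightarrow> \<rho> n x = 0"
    and lim: "\<And>u. sqint u \<Longrightarrow> (\<lambda>n. sqnorm (\<lambda>x. conv u (\<rho> n) x - u x)) \<longlonglongrightarrow> 0"
    by (rule mollifier_sequence[of "d / 2"], use d(1) in simp) (rule that)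
  obtain B where B: "B > 0" "\<And>x. \<bar>\<eta> x\<bar> \<le> B" using test_bounded[OF \<eta>] by metis
  define W where "W n = conv g (\<rho> n)" for n
  define F where "F n = conv f (\<rho> n)" for n
  have Wsm: "smooth (W n)" and Wt: "tame (W n)" for n
    unfolding W_def by (rule smooth_conv[OF g \<rho>(1)], rule tame_conv[OF g \<rho>(1)])
  have Fs: "sqint (F n)" for n unfolding F_def by (rule sqint_conv_test[OF f \<rho>(1)])
  \<comment> \<open>The mollifier is moved onto \<psi> and spreads it by at most d/2. Hence the
    equation is available only for \<psi> supported in \<open>K\<close>, which suffices because the
    estimate tests with a multiple of \<eta>^2.\<close>
  have eqn: "- (\<Sum>j\<in>UNIV. LINT x|lborel. W n x * partial j (partial j \<psi>) x) + c * nonlocal s (W n) \<psi>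
      = - (LINT x|lborel. F n x * partial i \<psi> x)"
    if \<psi>: "\<psi> \<in> test_functions U" and supp: "\<And>x. x \<notin> K \<Longrightarrow> \<psi> x = 0" for \<psi> n
  proof -
    let ?\<Psi> = "conv \<psi> (\<rho> n)"
    have \<Psi>: "?\<Psi> \<in> test_functions U"
      by (rule test_conv[OF test_sqint[OF \<psi>] \<rho>(1) \<rho>(5) K(2) supp near])
    have p: "partial k ?\<Psi> = conv (partial k \<psi>) (\<rho> n)" for k by (rule partial_conv_left[OF \<psi> \<rho>(1)])
    have pp: "partial k (partial k ?\<Psi>) = conv (partial k (partial k \<psi>)) (\<rho> n)" for k
      unfolding p by (rule partial_conv_left[OF test_partial[OF \<psi>] \<rho>(1)])
    have "(LINT x|lborel. W n x * partial j (partial j \<psi>) x) = (LINT x|lborel. g x * partial j (partial j ?\<Psi>) x)" for j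
      unfolding W_def pp by (rule conv_adjoint[OF g test_sqint[OF test_partial[OF test_partial[OF \<psi>]]] \<rho>(1,4)])
    moreover have "(LINT x|lborel. F n x * partial i \<psi> x) = (LINT x|lborel. f x * partial i ?\<Psi> x)"
      unfolding F_def p by (rule conv_adjoint[OF f test_sqint[OF test_partial[OF \<psi>]] \<rho>(1,4)])
    moreover have "nonlocal s (W n) \<psi> = nonlocal s g ?\<Psi>"
      unfolding W_def by (rule nonlocal_conv[OF g \<psi> \<rho>(1,4) sqint_conv_test[OF g \<rho>(1)] sqint_conv_test[OF test_sqint[OF \<psi>] \<rho>(1)]])
    ultimately show ?thesis using very_weak_derivative[OF u g w eq \<Psi>] by simp
  qed
  obtain C where C: "C \<ge> 0" "\<And>w g i. smooth w \<Longrightarrow> tame w \<Longrightarrow> sqint g \<Longrightarrow>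
    - (\<Sum>j\<in>UNIV. LINT x|lborel. w x * partial j (partial j (\<lambda>x. (\<eta> x)\<^sup>2 * w x)) x)
      + c * nonlocal s w (\<lambda>x. (\<eta> x)\<^sup>2 * w x) = - (LINT x|lborel. g x * partial i (\<lambda>x. (\<eta> x)\<^sup>2 * w x) x) \<Longrightarrow>
    (\<Sum>j\<in>UNIV. sqnorm (partial j (\<lambda>x. \<eta> x * w x))) \<le> C * (sqnorm w + sqnorm g)"
    by (rule energy_estimate[OF s c \<eta>]) (rule that)
  define V where "V n = (\<lambda>x. \<eta> x * W n x)" for n
  have V: "V n \<in> test_functions U" for n
    unfolding V_def using test_mult[OF Wsm \<eta>] by (simp add: mult.commute)
  have est: "sqnorm (\<lambda>x. partial j (V m) x - partial j (V n) x)
      \<le> C * (sqnorm (\<lambda>x. W m x - W n x) + sqnorm (\<lambda>x. F m x - F n x))" for m n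
  proof -
    let ?w = "\<lambda>x. W m x - W n x" and ?f = "\<lambda>x. F m x - F n x"
    let ?\<psi> = "\<lambda>x. (\<eta> x)\<^sup>2 * ?w x"
    have wsm: "smooth ?w" and wt: "tame ?w" by (intro smooth_diff tame_diff Wsm Wt)+
    have \<psi>: "?\<psi> \<in> test_functions U"
      using test_mult[OF smooth_mult[OF K(1) wsm] \<eta>] by (simp add: power2_eq_square mult_ac)
    have "- (\<Sum>j\<in>UNIV. LINT x|lborel. ?w x * partial j (partial j ?\<psi>) x) + c * nonlocal s ?w ?\<psi>
        = - (LINT x|lborel. ?f x * partial i ?\<psi> x)"
    proof -
      have 1: "(LINT x|lborel. ?w x * partial j (partial j ?\<psi>) x)
          = (LINT x|lborel. W m x * partial j (partial j ?\<psi>) x) - (LINT x|lborel. W n x * partial j (partial j ?\<psi>) x)" for j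
        unfolding left_diff_distrib
        by (intro Bochner_Integration.integral_diff integrable_mult_sqint tame_sqint Wt test_sqint[OF test_partial[OF test_partial[OF \<psi>]]])
      have 2: "(LINT x|lborel. ?f x * partial i ?\<psi> x) = (LINT x|lborel. F m x * partial i ?\<psi> x) - (LINT x|lborel. F n x * partial i ?\<psi> x)"
        unfolding left_diff_distrib
        by (intro Bochner_Integration.integral_diff integrable_mult_sqint Fs test_sqint[OF test_partial[OF \<psi>]])
      have 3: "nonlocal s ?w ?\<psi> = nonlocal s (W m) ?\<psi> - nonlocal s (W n) ?\<psi>"
        by (rule nonlocal_diff_left[OF s Wt Wt tame_test[OF \<psi>]])
      have supp: "?\<psi> x = 0" if "x \<notin> K" for x using K(4)[OF that] by simp
      show ?thesis
        unfolding 1 2 3 sum_subtractf using eqn[OF \<psi> supp, of m] eqn[OF \<psi> supp, of n]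
        unfolding right_diff_distrib[of c] by linarith
    qed
    from C(2)[OF wsm wt sqint_diff[OF Fs Fs] this]
    have "(\<Sum>j\<in>UNIV. sqnorm (partial j (\<lambda>x. \<eta> x * ?w x))) \<le> C * (sqnorm ?w + sqnorm ?f)" .
    moreover have "sqnorm (partial j (\<lambda>x. \<eta> x * ?w x)) \<le> (\<Sum>j\<in>UNIV. sqnorm (partial j (\<lambda>x. \<eta> x * ?w x)))"
      by (rule member_le_sum) auto
    moreover have "partial j (\<lambda>x. \<eta> x * ?w x) = (\<lambda>x. partial j (V m) x - partial j (V n) x)"
    proof -
      have "(\<lambda>x. \<eta> x * ?w x) = (\<lambda>x. V m x - V n x)" by (simp add: V_def right_diff_distrib)
      then show ?thesis by (auto simp: partial_diff test_differentiable[OF V])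
    qed
    ultimately show ?thesis by simp
  qed
  have cauchy: "\<exists>M. \<forall>m\<ge>M. \<forall>n\<ge>M. sqnorm (\<lambda>x. partial j (V m) x - partial j (V n) x) < e" if e: "e > 0" for e
  proof -
    \<comment> \<open>Each of the two differences of mollifications costs at most
      \<open>4 * e'\<close>; adding 1 to \<open>C\<close> avoids a vanishing denominator and gives
      strictness.\<close>
    define e' where "e' = e / (8 * (C + 1))"
    have e': "e' > 0" using e C(1) by (simp add: e'_def)
    from LIMSEQ_D[OF lim[OF g] e'] obtain M1 where M1: "\<And>n. n \<ge> M1 \<Longrightarrow> sqnorm (\<lambda>x. W n x - g x) < e'"
      by (auto simp: W_def)
    from LIMSEQ_D[OF lim[OF f] e'] obtain M2 where M2: "\<And>n. n \<ge> M2 \<Longrightarrow> sqnorm (\<lambda>x. F n x - f x) < e'"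
      by (auto simp: F_def)
    have "sqnorm (\<lambda>x. partial j (V m) x - partial j (V n) x) < e" if mn: "m \<ge> max M1 M2" "n \<ge> max M1 M2" for m n
    proof -
      have "sqnorm (\<lambda>x. W m x - W n x) \<le> 2 * sqnorm (\<lambda>x. W m x - g x) + 2 * sqnorm (\<lambda>x. g x - W n x)"
        by (rule sqnorm_triangle_le[OF tame_sqint[OF Wt] g tame_sqint[OF Wt]])
      moreover have "sqnorm (\<lambda>x. g x - W n x) = sqnorm (\<lambda>x. W n x - g x)" by (rule sqnorm_minus_commute)
      ultimately have a: "sqnorm (\<lambda>x. W m x - W n x) \<le> 4 * e'" using M1[of m] M1[of n] mn by simp
      have "sqnorm (\<lambda>x. F m x - F n x) \<le> 2 * sqnorm (\<lambda>x. F m x - f x) + 2 * sqnorm (\<lambda>x. f x - F n x)"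
        by (rule sqnorm_triangle_le[OF Fs f Fs])
      moreover have "sqnorm (\<lambda>x. f x - F n x) = sqnorm (\<lambda>x. F n x - f x)" by (rule sqnorm_minus_commute)
      ultimately have b: "sqnorm (\<lambda>x. F m x - F n x) \<le> 4 * e'" using M2[of m] M2[of n] mn by simp
      have "C * (sqnorm (\<lambda>x. W m x - W n x) + sqnorm (\<lambda>x. F m x - F n x)) \<le> C * (8 * e')"
        using a b C(1) by (intro mult_left_mono) auto
      also have "\<dots> < (C + 1) * (8 * e')" using e' by simp
      also have "\<dots> = e' * (8 * (C + 1))" by simp
      also have "\<dots> = e"
        by (subst nonzero_eq_divide_eq[symmetric]) (use C(1) in \<open>auto simp: e'_def\<close>)
      finally show ?thesis using est[of m n] by linarith
    qed
    then show ?thesis by blast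
  qed
  obtain p where p: "sqint p" "(\<lambda>n. sqnorm (\<lambda>x. partial j (V n) x - p x)) \<longlonglongrightarrow> 0"
    using sqint_complete[of "\<lambda>n. partial j (V n)", OF test_sqint[OF test_partial[OF V]] cauchy] by blast
  have \<eta>g: "sqint (\<lambda>x. \<eta> x * g x)" by (rule sqint_mult_bounded[OF test_measurable[OF \<eta>] g B(2)])
  have "(\<lambda>n. sqnorm (\<lambda>x. V n x - \<eta> x * g x)) \<longlonglongrightarrow> 0"
  proof (rule tendsto_sandwich[OF _ _ tendsto_const])
    show "\<forall>\<^sub>F n in sequentially. 0 \<le> sqnorm (\<lambda>x. V n x - \<eta> x * g x)" by simp
    show "\<forall>\<^sub>F n in sequentially. sqnorm (\<lambda>x. V n x - \<eta> x * g x) \<le> B\<^sup>2 * sqnorm (\<lambda>x. W n x - g x)"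
    proof (rule always_eventually, rule allI)
      fix n
      have "(\<lambda>x. V n x - \<eta> x * g x) = (\<lambda>x. \<eta> x * (W n x - g x))" by (simp add: V_def right_diff_distrib)
      then show "sqnorm (\<lambda>x. V n x - \<eta> x * g x) \<le> B\<^sup>2 * sqnorm (\<lambda>x. W n x - g x)"
        using sqnorm_mult_bounded[OF test_measurable[OF \<eta>] sqint_diff[OF tame_sqint[OF Wt] g] B(2)] by simp
    qed
    show "(\<lambda>n. B\<^sup>2 * sqnorm (\<lambda>x. W n x - g x)) \<longlonglongrightarrow> 0"
      using tendsto_mult_right_zero[OF lim[OF g]] by (simp add: W_def)
  qed
  then have "wpartial UNIV j (\<lambda>x. \<eta> x * g x) p" by (rule wpartial_limit[OF V \<eta>g p(1) _ p(2)])
  with p(1) show ?thesis by blast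
qed

subsection \<open>Smoothness of the far field\<close>

lemma norm_powr_inner: "norm z powr - q = (z \<bullet> z) powr (- q / 2)"
proof -
  have "norm z = (z \<bullet> z) powr (1 / 2)" by (simp add: norm_eq_sqrt_inner powr_half_sqrt)
  then show ?thesis by (simp only: powr_powr) simp
qed

text \<open>
  A class of kernels, smooth away from the origin, that is closed under partial derivatives;
  the index is the rate of decay.
\<close>

inductive kern :: "real \<Rightarrow> (real^'n::finite \<Rightarrow> real) \<Rightarrow> bool" where
  powr: "kern q (\<lambda>z. norm z powr - q)"
| coord: "kern q k \<Longrightarrow> kern (q - 1) (\<lambda>z. z $ i * k z)"
| cmult: "kern q k \<Longrightarrow> kern q (\<lambda>z. c * k z)"
| add: "kern q k \<Longrightarrow> kern q l \<Longrightarrow> kern q (\<lambda>z. k z + l z)"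

lemma kern_measurable: "kern q k \<Longrightarrow> k \<in> borel_measurable borel"
  by (induction rule: kern.induct; measurable)

lemma kern_bound: "kern q k \<Longrightarrow> \<exists>C\<ge>0. \<forall>z. z \<noteq> 0 \<longrightarrow> \<bar>k z\<bar> \<le> C * norm z powr - q"
proof (induction rule: kern.induct)
  case (powr q)
  show ?case by (rule exI[of _ 1]) simp
next
  case (coord q k i)
  then obtain C where C: "C \<ge> 0" "\<And>z. z \<noteq> 0 \<Longrightarrow> \<bar>k z\<bar> \<le> C * norm z powr - q" by blast
  have "\<bar>z $ i * k z\<bar> \<le> C * norm z powr - (q - 1)" if z: "z \<noteq> 0" for z
  proof -
    have "\<bar>z $ i * k z\<bar> \<le> norm z * (C * norm z powr - q)"
      unfolding abs_mult by (intro mult_mono component_le_norm_cart C z) auto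
    also have "norm z * (C * norm z powr - q) = C * (norm z powr 1 * norm z powr - q)" using z by simp
    also have "norm z powr 1 * norm z powr - q = norm z powr (1 + - q)" by (rule powr_add[symmetric])
    finally show ?thesis by simp
  qed
  with C(1) show ?case by blast
next
  case (cmult q k c)
  then obtain C where C: "C \<ge> 0" "\<And>z. z \<noteq> 0 \<Longrightarrow> \<bar>k z\<bar> \<le> C * norm z powr - q" by blast
  have "\<bar>c * k z\<bar> \<le> (\<bar>c\<bar> * C) * norm z powr - q" if "z \<noteq> 0" for z
    unfolding abs_mult mult.assoc by (intro mult_left_mono C that) auto
  with C(1) show ?case by (intro exI[of _ "\<bar>c\<bar> * C"]) simp
next
  case (add q k l)
  then obtain C D where C: "C \<ge> 0" "\<And>z. z \<noteq> 0 \<Longrightarrow> \<bar>k z\<bar> \<le> C * norm z powr - q"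
    and D: "D \<ge> 0" "\<And>z. z \<noteq> 0 \<Longrightarrow> \<bar>l z\<bar> \<le> D * norm z powr - q" by blast
  have "\<bar>k z + l z\<bar> \<le> (C + D) * norm z powr - q" if "z \<noteq> 0" for z
    using C(2)[OF that] D(2)[OF that] by (simp add: distrib_right)
  with C(1) D(1) show ?case by (intro exI[of _ "C + D"]) simp
qed

text \<open>Differentiating the power of the norm gives -q times the coordinate times the power with
  exponent -(q + 2), of decay rate \<open>q + 1\<close>. Derivatives thus decay faster, and
  integrability at infinity is never lost.\<close>

lemma kern_derivative:
  "kern q k \<Longrightarrow> (\<forall>z. z \<noteq> 0 \<longrightarrow> k differentiable (at z)) \<and>
    (\<exists>k'. kern (q + 1) k' \<and> (\<forall>z. z \<noteq> 0 \<longrightarrow> partial i k z = k' z))"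
proof (induction rule: kern.induct)
  case (powr q)
  have D: "((\<lambda>z::real^'a. norm z powr - q) has_derivative
      (\<lambda>h. 2 * (z \<bullet> h) * (- q / 2 * (z \<bullet> z) powr (- q / 2 - 1)))) (at z)" if z: "z \<noteq> 0" for z :: "real^'a"
  proof -
    have "((\<lambda>z::real^'a. z \<bullet> z) has_derivative (\<lambda>h. 2 * (z \<bullet> h))) (at z)"
      by (auto intro!: derivative_eq_intros simp: inner_commute)
    moreover have "0 < z \<bullet> z" using z by simp
    ultimately show ?thesis unfolding norm_powr_inner
      by (intro DERIV_compose_FDERIV has_real_derivative_powr)
  qed
  have "partial i (\<lambda>z::real^'a. norm z powr - q) z = - q * (z $ i * norm z powr - (q + 2))" if z: "z \<noteq> 0" for z
  proof -
    have e: "- (q + 2) / 2 = - q / 2 - 1" by (simp add: field_simps)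
    have "partial i (\<lambda>z::real^'a. norm z powr - q) z = 2 * (z \<bullet> axis i 1) * (- q / 2 * (z \<bullet> z) powr (- q / 2 - 1))"
      by (rule partial_eqI[OF D[OF z]])
    then show ?thesis unfolding norm_powr_inner[of z "q + 2"] e by (simp add: inner_axis)
  qed
  moreover have "kern (q + 1) (\<lambda>z::real^'a. - q * (z $ i * norm z powr - (q + 2)))"
    using kern.cmult[OF kern.coord[OF kern.powr[of "q + 2"], of i], of "- q"] by (simp add: add.commute)
  ultimately show ?case using D by (auto simp: differentiable_def)
next
  case (coord q k l)
  then obtain k' where k': "kern (q + 1) k'" "\<And>z. z \<noteq> 0 \<Longrightarrow> partial i k z = k' z"
    and d: "\<And>z. z \<noteq> 0 \<Longrightarrow> k differentiable (at z)" by blast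
  have c: "(\<lambda>z::real^'a. z $ l) differentiable (at z)" for z by (rule smooth_differentiable[OF smooth_coord])
  have "partial i (\<lambda>z. z $ l * k z) z = z $ l * k' z + (if l = i then 1 else 0) * k z" if "z \<noteq> 0" for z
    using partial_mult[OF c d[OF that], of i] k'(2)[OF that] by (simp add: partial_coord)
  moreover have "kern (q - 1 + 1) (\<lambda>z. z $ l * k' z + (if l = i then 1 else 0) * k z)"
    using kern.add[OF kern.coord[OF k'(1), of l, simplified] kern.cmult[OF coord(1), of "if l = i then 1 else 0"]] by simp
  moreover have "(\<lambda>z. z $ l * k z) differentiable (at z)" if "z \<noteq> 0" for z
    by (rule differentiable_mult[OF c d[OF that]])
  ultimately show ?case by blast
next
  case (cmult q k c)
  then obtain k' where k': "kern (q + 1) k'" "\<And>z. z \<noteq> 0 \<Longrightarrow> partial i k z = k' z"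
    and d: "\<And>z. z \<noteq> 0 \<Longrightarrow> k differentiable (at z)" by blast
  have "partial i (\<lambda>z. c * k z) z = c * k' z" if "z \<noteq> 0" for z
    using partial_cmult[OF d[OF that], of i c] k'(2)[OF that] by simp
  moreover have "(\<lambda>z. c * k z) differentiable (at z)" if "z \<noteq> 0" for z
    by (rule differentiable_mult[OF differentiable_const d[OF that]])
  ultimately show ?case using kern.cmult[OF k'(1), of c] by blast
next
  case (add q k l)
  then obtain k' l' where k': "kern (q + 1) k'" "\<And>z. z \<noteq> 0 \<Longrightarrow> partial i k z = k' z"
    and l': "kern (q + 1) l'" "\<And>z. z \<noteq> 0 \<Longrightarrow> partial i l z = l' z"
    and d: "\<And>z. z \<noteq> 0 \<Longrightarrow> k differentiable (at z)" "\<And>z. z \<noteq> 0 \<Longrightarrow> l differentiable (at z)" by blast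
  have "partial i (\<lambda>z. k z + l z) z = k' z + l' z" if "z \<noteq> 0" for z
    using partial_add[OF d(1)[OF that] d(2)[OF that], of i] k'(2)[OF that] l'(2)[OF that] by simp
  moreover have "(\<lambda>z. k z + l z) differentiable (at z)" if "z \<noteq> 0" for z
    by (rule differentiable_add[OF d(1)[OF that] d(2)[OF that]])
  ultimately show ?case using kern.add[OF k'(1) l'(1)] by blast
qed

definition farcut :: "real \<Rightarrow> (real^'n::finite \<Rightarrow> real) \<Rightarrow> real^'n \<Rightarrow> real" where
  "farcut \<delta> k z = k z * indicator {z. \<delta> \<le> norm z} z"

lemma farcut_powr_eq_rieszcut: "farcut \<delta> (\<lambda>z::real^'n::finite. norm z powr - (real CARD('n) + 2 * s)) = rieszcut s \<delta>"
  by (rule ext) (simp only: farcut_def rieszcut_def riesz_def powr_minus_divide)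

text \<open>Outside the ball of radius \<delta> a kernel decaying at least as fast as the fractional
  one is a bounded multiple of \<open>rieszcut\<close>. That function is integrable and bounded,
  hence also square-integrable.\<close>

lemma
  fixes k :: "real^'n::finite \<Rightarrow> real"
  assumes s: "0 < s" "s < 1" and \<delta>: "0 < \<delta>" and k: "kern q k" and q: "real CARD('n) + 2 * s \<le> q"
  shows integrable_farcut: "integrable lborel (farcut \<delta> k)" and sqint_farcut: "sqint (farcut \<delta> k)"
proof -
  note [measurable] = kern_measurable[OF k]
  have m [measurable]: "farcut \<delta> k \<in> borel_measurable borel" unfolding farcut_def[abs_def] by measurable
  define p where "p = real CARD('n) + 2 * s"
  have p: "0 < p" using s by (simp add: p_def add_nonneg_pos)
  obtain C where C: "C \<ge> 0" "\<And>z. z \<noteq> 0 \<Longrightarrow> \<bar>k z\<bar> \<le> C * norm z powr - q" using kern_bound[OF k] by blast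
  define D where "D = C * \<delta> powr - (q - p)"
  have D: "0 \<le> D" using C(1) by (simp add: D_def)
  have r: "rieszcut s \<delta> z = norm z powr - p" if "\<delta> \<le> norm z" for z :: "real^'n"
    using that unfolding farcut_powr_eq_rieszcut[symmetric] by (simp add: farcut_def p_def)
  have r0: "0 \<le> rieszcut s \<delta> z" for z :: "real^'n" by (simp add: rieszcut_def riesz_nonneg)
  have le: "\<bar>farcut \<delta> k z\<bar> \<le> D * rieszcut s \<delta> z" for z
  proof (cases "\<delta> \<le> norm z")
    case True
    then have z: "z \<noteq> 0" using \<delta> by auto
    have "\<bar>farcut \<delta> k z\<bar> \<le> C * norm z powr - q" using True C(2)[OF z] by (simp add: farcut_def)
    also have "norm z powr - q = norm z powr (- (q - p) + - p)" by simp
    also have "\<dots> = norm z powr - (q - p) * norm z powr - p" by (rule powr_add)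
    also have "C * (norm z powr - (q - p) * norm z powr - p) \<le> C * (\<delta> powr - (q - p) * norm z powr - p)"
      using q \<delta> True by (intro mult_left_mono mult_right_mono powr_mono2' C(1)) (auto simp: p_def)
    finally show ?thesis by (simp add: r[OF True] D_def mult.assoc)
  next
    case False
    then show ?thesis using D r0[of z] by (simp add: farcut_def)
  qed
  have i: "integrable lborel (\<lambda>z::real^'n. rieszcut s \<delta> z)" by (rule rieszcut_integrable[OF s \<delta>])
  show "integrable lborel (farcut \<delta> k)"
  proof (rule Bochner_Integration.integrable_bound)
    show "integrable lborel (\<lambda>z::real^'n. D * rieszcut s \<delta> z)" by (rule integrable_mult_right[OF i])
    show "AE z in lborel. norm (farcut \<delta> k z) \<le> norm (D * rieszcut s \<delta> z)"
      unfolding real_norm_def by (intro AE_I2 order.trans[OF le abs_ge_self])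
  qed measurable
  have rb: "rieszcut s \<delta> z \<le> \<delta> powr - p" for z :: "real^'n"
  proof (cases "\<delta> \<le> norm z")
    case True
    show ?thesis unfolding r[OF True] using True \<delta> p by (intro powr_mono2') auto
  qed (simp add: rieszcut_def)
  have sq: "(farcut \<delta> k z)\<^sup>2 \<le> (D\<^sup>2 * \<delta> powr - p) * rieszcut s \<delta> z" for z
  proof -
    have "(farcut \<delta> k z)\<^sup>2 = \<bar>farcut \<delta> k z\<bar>\<^sup>2" by simp
    also have "\<dots> \<le> (D * rieszcut s \<delta> z)\<^sup>2" by (intro power_mono le) auto
    also have "\<dots> = D\<^sup>2 * (rieszcut s \<delta> z * rieszcut s \<delta> z)" by (simp add: power_mult_distrib power2_eq_square)
    also have "\<dots> \<le> D\<^sup>2 * (\<delta> powr - p * rieszcut s \<delta> z)" by (intro mult_left_mono mult_right_mono rb r0) auto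
    finally show ?thesis by (simp add: mult.assoc)
  qed
  have "integrable lborel (\<lambda>z. (farcut \<delta> k z)\<^sup>2)"
  proof (rule Bochner_Integration.integrable_bound)
    show "integrable lborel (\<lambda>z::real^'n. (D\<^sup>2 * \<delta> powr - p) * rieszcut s \<delta> z)" by (rule integrable_mult_right[OF i])
    show "AE z in lborel. norm ((farcut \<delta> k z)\<^sup>2) \<le> norm ((D\<^sup>2 * \<delta> powr - p) * rieszcut s \<delta> z)"
      unfolding real_norm_def abs_power2 by (intro AE_I2) (simp only: abs_of_nonneg[OF zero_le_power2] order.trans[OF sq abs_ge_self])
  qed measurable
  with m show "sqint (farcut \<delta> k)" by (simp add: sqint_def)
qed

text \<open>Cauchy-Schwarz bounds the convolution uniformly, and a bounded function on a bounded set
  is square-integrable.\<close>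

lemma far_field_sqint:
  fixes k :: "real^'n::finite \<Rightarrow> real"
  assumes h: "sqint h" and k: "sqint k" and V: "V \<in> sets borel" "bounded V"
  shows "sqint (\<lambda>x. conv h k x * indicator V x)"
proof (rule sqint_mult_bounded)
  note [measurable] = sqint_measurable[OF h] sqint_measurable[OF k]
  show "conv h k \<in> borel_measurable borel" unfolding conv_def[abs_def] by measurable
  have "(\<lambda>x. (indicator V x :: real)\<^sup>2) = indicator V" by (auto simp: indicator_def)
  moreover have "integrable lborel (indicator V :: real^'n \<Rightarrow> real)"
    using V by (intro integrable_real_indicator emeasure_bounded_finite) auto
  ultimately show "sqint (indicator V :: real^'n \<Rightarrow> real)" using V(1) by (simp add: sqint_def)
  show "\<bar>conv h k x\<bar> \<le> sqrt (sqnorm h * sqnorm k)" for x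
  proof -
    have "sqnorm (\<lambda>y. k (x - y)) = sqnorm k"
      unfolding sqnorm_def by (rule lborel_integral_reflect[of "\<lambda>y. (k y)\<^sup>2"]) measurable
    then have "(conv h k x)\<^sup>2 \<le> sqnorm h * sqnorm k"
      using Cauchy_Schwarz_sqnorm[OF h sqint_reflect[OF k, of x]] by (simp add: conv_def)
    then show ?thesis by (rule real_le_rsqrt[of "\<bar>conv h k x\<bar>", simplified])
  qed
qed

text \<open>The cut kernel jumps where \<open>x\<close> has distance \<delta> from \<open>y\<close>,
  but the set where \<phi> is nonzero lies in \<open>V\<close>, on which the cut has no effect; no
  boundary term arises.\<close>

lemma integral_by_parts_far:
  fixes k :: "real^'n::finite \<Rightarrow> real"
  assumes k: "\<And>z. z \<noteq> 0 \<Longrightarrow> k differentiable (at z)" and k': "\<And>z. z \<noteq> 0 \<Longrightarrow> partial i k z = k' z"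
    and c': "\<And>z. z \<noteq> 0 \<Longrightarrow> isCont k' z" and \<phi>: "\<phi> \<in> test_functions V"
    and \<delta>: "0 < \<delta>" and far: "\<And>x. x \<in> V \<Longrightarrow> \<delta> \<le> dist x y"
    and int: "integrable lborel (farcut \<delta> k)" "integrable lborel (farcut \<delta> k')"
  shows "(LINT x|lborel. partial i \<phi> x * farcut \<delta> k (x - y)) = - (LINT x|lborel. \<phi> x * farcut \<delta> k' (x - y))"
proof -
  obtain K where K: "smooth \<phi>" "compact K" "K \<subseteq> V" "\<And>x. x \<notin> K \<Longrightarrow> \<phi> x = 0"
    using \<phi> by (rule test_functionsE) (rule that)
  have oK: "open (- K)" using K(2) by (simp add: compact_imp_closed open_Compl)
  have ne: "x - y \<noteq> 0" if "x \<in> K" for x using far[of x] K(3) that \<delta> by auto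
  let ?F = "\<lambda>x. k (x - y) * \<phi> x" and ?F' = "\<lambda>x. k (x - y) * partial i \<phi> x + k' (x - y) * \<phi> x"
  have p0: "partial i \<phi> x = 0" if "x \<notin> K" for x
    by (rule partial_zero_off_closed[OF compact_imp_closed[OF K(2)] K(4) that])
  have sub: "((\<lambda>x. x - y) has_derivative (\<lambda>h. h)) (at x)" for x :: "real^'n"
    by (auto intro!: derivative_eq_intros)
  have kd: "((\<lambda>x. k (x - y)) has_derivative frechet_derivative k (at (x - y))) (at x)" if "x - y \<noteq> 0" for x
  proof -
    have "(k has_derivative frechet_derivative k (at (x - y))) (at (x - y))"
      using k[OF that] frechet_derivative_works by blast
    from has_derivative_compose[OF sub this] show ?thesis .
  qed
  \<comment> \<open>The uncut product is treated instead. On \<open>K\<close> the kernel is away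
    from its singularity; off \<open>K\<close> the product vanishes in a neighbourhood, even where
    \<open>k\<close> is singular.\<close>
  have F: "?F differentiable (at x) \<and> partial i ?F x = ?F' x" for x
  proof (cases "x \<in> K")
    case True
    have d: "(\<lambda>x. k (x - y)) differentiable (at x)" using kd[OF ne[OF True]] by (auto simp: differentiable_def)
    have "partial i (\<lambda>x. k (x - y)) x = k' (x - y)"
      using partial_eqI[OF kd[OF ne[OF True]], of i] k'[OF ne[OF True]] by (simp add: partial_def)
    then show ?thesis
      using partial_mult[OF d test_differentiable[OF \<phi>], of i] differentiable_mult[OF d test_differentiable[OF \<phi>]]
      by simp
  next
    case False
    have "((\<lambda>x. 0) has_derivative (\<lambda>h. 0)) (at x)" by simp
    then have "(?F has_derivative (\<lambda>h. 0)) (at x)"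
      by (rule has_derivative_transform_within_open[OF _ oK]) (use False K(4) in auto)
    then show ?thesis
      using partial_eqI[of ?F "\<lambda>h. 0" x i] p0[OF False] K(4)[OF False] by (auto simp: differentiable_def)
  qed
  have pF: "partial i ?F = ?F'" using F by auto
  have cF': "continuous_on UNIV ?F'"
    unfolding continuous_on_eq_continuous_at[OF open_UNIV]
  proof
    fix x
    show "isCont ?F' x"
    proof (cases "x \<in> K")
      case True
      have ck: "isCont (\<lambda>x. k (x - y)) x"
        by (rule has_derivative_continuous[OF kd[OF ne[OF True]]])
      have ck': "isCont (\<lambda>x. k' (x - y)) x"
        by (rule isCont_o2[of _ "\<lambda>x. x - y"]) (auto intro: c'[OF ne[OF True]] continuous_intros)
      have c\<phi>: "isCont \<phi> x" "isCont (partial i \<phi>) x"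
        using smooth_continuous_on[OF K(1), of UNIV] smooth_continuous_on[OF smooth_partial[OF K(1)], of UNIV]
        by (auto simp: continuous_on_eq_continuous_at)
      show ?thesis by (intro continuous_intros ck ck' c\<phi>)
    next
      case False
      have "\<forall>\<^sub>F x in nhds x. ?F' x = 0"
        using False oK K(4) p0 unfolding eventually_nhds by (intro exI[of _ "- K"]) auto
      then show ?thesis using isCont_cong[of ?F' "\<lambda>x. 0" x] by simp
    qed
  qed
  obtain R where R: "\<And>x. R < norm x \<Longrightarrow> \<phi> x = 0" using test_radius[OF \<phi>] by metis
  have "(LINT x|lborel. partial i ?F x) = 0"
    by (rule integral_partial_eq_0[of ?F i R]) (use F cF' R in \<open>auto simp: pF\<close>)
  moreover have "partial i ?F x = partial i \<phi> x * farcut \<delta> k (x - y) + \<phi> x * farcut \<delta> k' (x - y)" for x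
  proof (cases "x \<in> K")
    case True
    then have "\<delta> \<le> norm (x - y)" using far K(3) by (auto simp: dist_norm)
    then show ?thesis unfolding pF by (simp add: farcut_def mult.commute)
  qed (simp add: pF K(4) p0)
  moreover have "integrable lborel (\<lambda>x. \<psi> x * farcut \<delta> l (x - y))"
    if "\<psi> \<in> test_functions V" "integrable lborel (farcut \<delta> l)" for \<psi> l
    using integrable_test_mult[OF that(1) lborel_integrable_translate[OF that(2), of "- y"]] by simp
  ultimately show ?thesis using int \<phi> test_partial[OF \<phi>] by simp
qed

text \<open>Fubini isolates the integral in \<open>x\<close> for each \<open>y\<close>, and only
  those \<open>y\<close> with \<open>h y\<close> nonzero count, for which \<open>V\<close> is at
  distance at least \<delta>.\<close>

lemma far_field_wpartial:
  fixes k :: "real^'n::finite \<Rightarrow> real"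
  assumes s: "0 < s" "s < 1" and \<delta>: "0 < \<delta>" and k: "kern q k" and q: "real CARD('n) + 2 * s \<le> q"
    and k': "kern (q + 1) k'" "\<And>z. z \<noteq> 0 \<Longrightarrow> partial i k z = k' z"
    and h: "sqint h" and far: "\<And>x y. x \<in> V \<Longrightarrow> h y \<noteq> 0 \<Longrightarrow> \<delta> \<le> dist x y"
  shows "wpartial V i (\<lambda>x. conv h (farcut \<delta> k) x * indicator V x) (\<lambda>x. conv h (farcut \<delta> k') x * indicator V x)"
  unfolding wpartial_def
proof
  fix \<phi> assume \<phi>: "\<phi> \<in> test_functions V"
  have q': "real CARD('n) + 2 * s \<le> q + 1" using q by simp
  have ik: "integrable lborel (farcut \<delta> k)" "integrable lborel (farcut \<delta> k')"
    by (rule integrable_farcut[OF s \<delta> k q], rule integrable_farcut[OF s \<delta> k'(1) q'])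
  have conv: "(LINT x|lborel. conv h (farcut \<delta> l) x * indicator V x * \<psi> x) = (LINT y|lborel. h y * (LINT x|lborel. \<psi> x * farcut \<delta> l (x - y)))"
    if \<psi>: "\<psi> \<in> test_functions V" and l: "integrable lborel (farcut \<delta> l)" for \<psi> l
  proof -
    have I: "integrable (lborel \<Otimes>\<^sub>M lborel) (\<lambda>(x, y). \<psi> x * h y * farcut \<delta> l (x - y))"
      by (rule integrable_kernel[OF test_sqint[OF \<psi>] h l])
    have "conv h (farcut \<delta> l) x * indicator V x * \<psi> x = (LINT y|lborel. \<psi> x * h y * farcut \<delta> l (x - y))" for x
      unfolding mult.assoc[of "\<psi> x"] integral_mult_right_zero conv_def
      using test_zero_outside[OF \<psi>, of x] by (cases "x \<in> V") auto
    then have "(LINT x|lborel. conv h (farcut \<delta> l) x * indicator V x * \<psi> x) = (LINT x|lborel. LINT y|lborel. \<psi> x * h y * farcut \<delta> l (x - y))"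
      by simp
    also have "\<dots> = (LINT y|lborel. LINT x|lborel. \<psi> x * h y * farcut \<delta> l (x - y))"
      using lborel_pair.Fubini_integral[OF I] by simp
    also have "\<dots> = (LINT y|lborel. h y * (LINT x|lborel. \<psi> x * farcut \<delta> l (x - y)))"
    proof (intro Bochner_Integration.integral_cong refl)
      fix y
      have "\<psi> x * h y * farcut \<delta> l (x - y) = h y * (\<psi> x * farcut \<delta> l (x - y))" for x by simp
      then show "(LINT x|lborel. \<psi> x * h y * farcut \<delta> l (x - y)) = h y * (LINT x|lborel. \<psi> x * farcut \<delta> l (x - y))"
        by (simp only: integral_mult_right_zero)
    qed
    finally show ?thesis .
  qed
  have "h y * (LINT x|lborel. partial i \<phi> x * farcut \<delta> k (x - y)) = - (h y * (LINT x|lborel. \<phi> x * farcut \<delta> k' (x - y)))" for y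
  proof (cases "h y = 0")
    case False
    have "isCont k' z" if "z \<noteq> 0" for z
      using kern_derivative[OF k'(1)] that differentiable_imp_continuous_within by blast
    moreover have "k differentiable (at z)" if "z \<noteq> 0" for z using kern_derivative[OF k] that by blast
    ultimately have "(LINT x|lborel. partial i \<phi> x * farcut \<delta> k (x - y)) = - (LINT x|lborel. \<phi> x * farcut \<delta> k' (x - y))"
      using far False by (intro integral_by_parts_far[OF _ k'(2) _ \<phi> \<delta> _ ik]) auto
    then show ?thesis by simp
  qed simp
  then show "(LINT x|lborel. conv h (farcut \<delta> k) x * indicator V x * partial i \<phi> x)
      = - (LINT x|lborel. conv h (farcut \<delta> k') x * indicator V x * \<phi> x)"
    unfolding conv[OF test_partial[OF \<phi>] ik(1)] conv[OF \<phi> ik(2)] by simp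
qed

subsection \<open>Higher regularity\<close>

text \<open>
  Unlike in \<open>sobolev\<close>, the functions are square-integrable on the whole space; only the derivative
  relations are local to \<open>U\<close>.
\<close>

primrec sob :: "nat \<Rightarrow> (real^'n::finite) set \<Rightarrow> (real^'n \<Rightarrow> real) \<Rightarrow> bool" where
  "sob 0 U u = sqint u"
| "sob (Suc m) U u = (sqint u \<and> (\<forall>i. \<exists>g. sob m U g \<and> wpartial U i u g))"

lemma sob_sqint: "sob m U u \<Longrightarrow> sqint u"
  by (cases m) auto

lemma wpartial_mono: "wpartial U i u g \<Longrightarrow> V \<subseteq> U \<Longrightarrow> wpartial V i u g"
  unfolding wpartial_def using test_mono by blast

lemma sob_mono: "sob m U u \<Longrightarrow> V \<subseteq> U \<Longrightarrow> sob m V u"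
proof (induction m arbitrary: u)
  case (Suc m)
  have "\<exists>g. sob m V g \<and> wpartial V i u g" for i
  proof -
    obtain g where "sob m U g" "wpartial U i u g" using Suc.prems(1) by auto
    then show ?thesis using Suc.IH[of g] Suc.prems(2) wpartial_mono by blast
  qed
  then show ?case using Suc.prems(1) by simp
qed simp

lemma wpartial_add_cmult:
  assumes "sqint u" "sqint v" "sqint g" "sqint h" "wpartial U i u g" "wpartial U i v h"
  shows "wpartial U i (\<lambda>x. u x + c * v x) (\<lambda>x. g x + c * h x)"
  unfolding wpartial_def
proof
  fix \<phi> assume \<phi>: "\<phi> \<in> test_functions U"
  have lin: "(LINT x|lborel. (a x + c * b x) * \<psi> x) = (LINT x|lborel. a x * \<psi> x) + c * (LINT x|lborel. b x * \<psi> x)"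
    if "sqint a" "sqint b" "sqint \<psi>" for a b \<psi> :: "real^'a \<Rightarrow> real"
    using integrable_mult_sqint[OF that(1,3)] integrable_mult_sqint[OF that(2,3)]
    by (simp add: distrib_right mult.assoc)
  show "(LINT x|lborel. (u x + c * v x) * partial i \<phi> x) = - (LINT x|lborel. (g x + c * h x) * \<phi> x)"
    unfolding lin[OF assms(1,2) test_sqint[OF test_partial[OF \<phi>]]] lin[OF assms(3,4) test_sqint[OF \<phi>]]
    using wpartialD[OF assms(5) \<phi>] wpartialD[OF assms(6) \<phi>] by simp
qed

lemma sob_add_cmult:
  "sob m U u \<Longrightarrow> sob m U v \<Longrightarrow> sob m U (\<lambda>x. u x + c * v x)"
proof (induction m arbitrary: u v)
  case 0
  then show ?case by (simp add: sqint_add sqint_cmult)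
next
  case (Suc m)
  have "\<exists>g. sob m U g \<and> wpartial U i (\<lambda>x. u x + c * v x) g" for i
  proof -
    obtain g where g: "sob m U g" "wpartial U i u g" using Suc.prems(1) by auto
    obtain h where h: "sob m U h" "wpartial U i v h" using Suc.prems(2) by auto
    have "wpartial U i (\<lambda>x. u x + c * v x) (\<lambda>x. g x + c * h x)"
      by (rule wpartial_add_cmult[OF sob_sqint[OF Suc.prems(1)] sob_sqint[OF Suc.prems(2)]
            sob_sqint[OF g(1)] sob_sqint[OF h(1)] g(2) h(2)])
    with Suc.IH[OF g(1) h(1)] show ?thesis by blast
  qed
  then show ?case using Suc.prems by (simp add: sqint_add sqint_cmult)
qed

lemma wpartial_cong:
  assumes w: "wpartial U i u g" and eq: "\<And>x. x \<in> U \<Longrightarrow> u x = u' x"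
  shows "wpartial U i u' g"
  unfolding wpartial_def
proof
  fix \<phi> assume \<phi>: "\<phi> \<in> test_functions U"
  have e: "u x * partial i \<phi> x = u' x * partial i \<phi> x" for x
    using eq[of x] test_zero_outside[OF test_partial[OF \<phi>], of x] by (cases "x \<in> U") auto
  show "(LINT x|lborel. u' x * partial i \<phi> x) = - (LINT x|lborel. g x * \<phi> x)"
    using wpartialD[OF w \<phi>] unfolding e .
qed

text \<open>A relation local to \<open>U\<close> becomes one on the whole space, since \<zeta> times
  any test function is supported in \<open>U\<close>.\<close>

lemma wpartial_mult_test:
  fixes u :: "real^'n::finite \<Rightarrow> real"
  assumes u: "sqint u" and g: "sqint g" and w: "wpartial U i u g" and \<zeta>: "\<zeta> \<in> test_functions U"
  shows "wpartial UNIV i (\<lambda>x. \<zeta> x * u x) (\<lambda>x. partial i \<zeta> x * u x + \<zeta> x * g x)"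
  unfolding wpartial_def
proof
  fix \<phi> :: "real^'n \<Rightarrow> real" assume \<phi>: "\<phi> \<in> test_functions UNIV"
  have \<zeta>\<phi>: "(\<lambda>x. \<zeta> x * \<phi> x) \<in> test_functions U" using test_mult[OF test_smooth[OF \<phi>] \<zeta>] by (simp add: mult.commute)
  have d\<zeta>\<phi>: "(\<lambda>x. partial i \<zeta> x * \<phi> x) \<in> test_functions U"
    using test_mult[OF test_smooth[OF \<phi>] test_partial[OF \<zeta>]] by (simp add: mult.commute)
  have p: "partial i (\<lambda>x. \<zeta> x * \<phi> x) x = \<zeta> x * partial i \<phi> x + partial i \<zeta> x * \<phi> x" for x
    by (rule partial_mult[OF test_differentiable[OF \<zeta>] test_differentiable[OF \<phi>]])
  have "(LINT x|lborel. \<zeta> x * u x * partial i \<phi> x)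
      = (LINT x|lborel. u x * partial i (\<lambda>x. \<zeta> x * \<phi> x) x - u x * (partial i \<zeta> x * \<phi> x))"
    unfolding p by (intro Bochner_Integration.integral_cong) (auto simp: algebra_simps)
  also have "\<dots> = (LINT x|lborel. u x * partial i (\<lambda>x. \<zeta> x * \<phi> x) x) - (LINT x|lborel. u x * (partial i \<zeta> x * \<phi> x))"
    by (intro Bochner_Integration.integral_diff integrable_mult_sqint u test_sqint[OF test_partial[OF \<zeta>\<phi>]] test_sqint[OF d\<zeta>\<phi>])
  also have "(LINT x|lborel. u x * partial i (\<lambda>x. \<zeta> x * \<phi> x) x) = - (LINT x|lborel. g x * (\<zeta> x * \<phi> x))"
    by (rule wpartialD[OF w \<zeta>\<phi>])
  also have "- (LINT x|lborel. g x * (\<zeta> x * \<phi> x)) - (LINT x|lborel. u x * (partial i \<zeta> x * \<phi> x))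
      = - (LINT x|lborel. g x * (\<zeta> x * \<phi> x) + u x * (partial i \<zeta> x * \<phi> x))"
    using integrable_mult_sqint[OF g test_sqint[OF \<zeta>\<phi>]] integrable_mult_sqint[OF u test_sqint[OF d\<zeta>\<phi>]] by simp
  also have "(LINT x|lborel. g x * (\<zeta> x * \<phi> x) + u x * (partial i \<zeta> x * \<phi> x))
      = (LINT x|lborel. (partial i \<zeta> x * u x + \<zeta> x * g x) * \<phi> x)"
    by (intro Bochner_Integration.integral_cong) (auto simp: algebra_simps)
  finally show "(LINT x|lborel. \<zeta> x * u x * partial i \<phi> x) = - (LINT x|lborel. (partial i \<zeta> x * u x + \<zeta> x * g x) * \<phi> x)" .
qed

text \<open>The induction runs over all kernels of the class at once: each derivative replaces
  \<open>k\<close> by another kernel and \<open>q\<close> by \<open>q + 1\<close>, so the decay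
  condition persists.\<close>

lemma far_field_sob:
  fixes k :: "real^'n::finite \<Rightarrow> real"
  assumes s: "0 < s" "s < 1" and \<delta>: "0 < \<delta>" and h: "sqint h" and V: "V \<in> sets borel" "bounded V"
    and far: "\<And>x y. x \<in> V \<Longrightarrow> h y \<noteq> 0 \<Longrightarrow> \<delta> \<le> dist x y"
  shows "kern q k \<Longrightarrow> real CARD('n) + 2 * s \<le> q \<Longrightarrow> sob m V (\<lambda>x. conv h (farcut \<delta> k) x * indicator V x)"
proof (induction m arbitrary: q k)
  case 0
  then show ?case by (simp add: far_field_sqint[OF h sqint_farcut[OF s \<delta>] V])
next
  case (Suc m)
  have "\<exists>g. sob m V g \<and> wpartial V i (\<lambda>x. conv h (farcut \<delta> k) x * indicator V x) g" for i
  proof -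
    obtain k' where k': "kern (q + 1) k'" "\<And>z. z \<noteq> 0 \<Longrightarrow> partial i k z = k' z"
      using kern_derivative[OF Suc.prems(1), of i] by blast
    have "sob m V (\<lambda>x. conv h (farcut \<delta> k') x * indicator V x)"
      by (rule Suc.IH[OF k'(1)]) (use Suc.prems(2) in simp)
    moreover have "wpartial V i (\<lambda>x. conv h (farcut \<delta> k) x * indicator V x) (\<lambda>x. conv h (farcut \<delta> k') x * indicator V x)"
      by (rule far_field_wpartial[OF s \<delta> Suc.prems k' h far])
    ultimately show ?thesis by blast
  qed
  then show ?case using Suc.prems by (simp add: far_field_sqint[OF h sqint_farcut[OF s \<delta>] V])
qed

lemma sqint_test_mult: "\<zeta> \<in> test_functions U \<Longrightarrow> sqint u \<Longrightarrow> sqint (\<lambda>x. \<zeta> x * u x)"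
  using test_bounded[of \<zeta> U] sqint_mult_bounded[OF test_measurable] by metis

text \<open>Domain, solution, derivatives and datum are all generalised in the induction, for the
  hypothesis is applied to a derivative of the cut-off solution, on a smaller open set and with a
  new datum. The weak derivatives \<open>g\<close> are required on the whole space, as the nonlocal
  form demands.\<close>

theorem interior_regularity:
  fixes u f :: "real^'n::finite \<Rightarrow> real"
  assumes s: "0 < s" "s < 1" and c: "0 \<le> c"
  shows "open \<Omega> \<Longrightarrow> sqint u \<Longrightarrow> (\<And>i. sqint (g i)) \<Longrightarrow> (\<And>i. wpartial UNIV i u (g i)) \<Longrightarrow> sob m \<Omega> f \<Longrightarrow>
    very_weak \<Omega> s c u f \<Longrightarrow> compact (closure V) \<Longrightarrow> closure V \<subseteq> \<Omega> \<Longrightarrow> sob (m + 2) V u"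
proof (induction m arbitrary: \<Omega> u g f)
  case 0
  note u = 0(2) and g = 0(3) and w = 0(4)
  have f: "sqint f" using 0(5) by simp
  obtain \<eta> W where \<eta>: "\<eta> \<in> test_functions \<Omega>" "open W" "closure V \<subseteq> W" "W \<subseteq> \<Omega>" "\<And>x. x \<in> W \<Longrightarrow> \<eta> x = 1"
    by (rule cutoff_exists[OF 0(7,1,8)]) (rule that)
  have V: "\<eta> x * g i x = g i x" if "x \<in> V" for x i
    using \<eta>(3,5) closure_subset[of V] that by (simp add: subset_iff)
  have "sob 1 V (g i)" for i
  proof -
    have "\<exists>p. sqint p \<and> wpartial V j (g i) p" for j
    proof -
      obtain p where p: "sqint p" "wpartial UNIV j (\<lambda>x. \<eta> x * g i x) p"
        using interior_H2[OF s c 0(1) u g w f 0(6) \<eta>(1)] by blast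
      have "wpartial V j (g i) p"
        by (rule wpartial_cong[OF wpartial_mono[OF p(2)]]) (auto simp: V)
      with p(1) show ?thesis by blast
    qed
    then show ?thesis using g by simp
  qed
  moreover have "wpartial V i u (g i)" for i by (rule wpartial_mono[OF w]) simp
  ultimately have "sob (Suc 1) V u" using u by auto
  then show ?case by (simp add: numeral_2_eq_2)
next
  case (Suc m)
  note \<Omega> = Suc(2) and u = Suc(3) and g = Suc(4) and w = Suc(5) and sf = Suc(6) and eq = Suc(7) and cV = Suc(8) and V\<Omega> = Suc(9)
  have f: "sqint f" by (rule sob_sqint[OF sf])
  obtain \<zeta> W where \<zeta>: "\<zeta> \<in> test_functions \<Omega>" "open W" "closure V \<subseteq> W" "W \<subseteq> \<Omega>" "\<And>x. x \<in> W \<Longrightarrow> \<zeta> x = 1"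
    by (rule cutoff_exists[OF cV \<Omega> V\<Omega>]) (rule that)
  obtain d where d: "d > 0" "(\<Union>x\<in>closure V. ball x d) \<subseteq> W"
    using compact_subset_open_imp_ball_epsilon_subset[OF cV \<zeta>(2,3)] by blast
  \<comment> \<open>\<open>V1\<close> is the half-way neighbourhood: it contains the closure of
    \<open>V\<close> and stays at distance at least \<open>\<delta> = d / 2\<close> from the
    complement of \<open>W\<close>, hence from the points where the far part \<open>h\<close> is
    nonzero.\<close>
  define V1 where "V1 = (\<Union>x\<in>closure V. ball x (d / 2))"
  define \<delta> where "\<delta> = d / 2"
  have \<delta>: "0 < \<delta>" using d(1) by (simp add: \<delta>_def)
  have oV1: "open V1" unfolding V1_def by blast
  have VV1: "closure V \<subseteq> V1" unfolding V1_def using d(1) by force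
  have nearW: "y \<in> W" if xV1: "x \<in> V1" and near: "dist x y < \<delta>" for x y
  proof -
    obtain k where k: "k \<in> closure V" "dist k x < d / 2" using xV1
      unfolding V1_def by (auto simp: mem_ball)
    have "dist k y < d" using k(2) near dist_triangle[of k y x] by (simp add: \<delta>_def)
    with k(1) d(2) show ?thesis by (auto simp: subset_iff)
  qed
  have V1W: "V1 \<subseteq> W" using nearW \<delta> by force
  have V1\<Omega>: "V1 \<subseteq> \<Omega>" using V1W \<zeta>(4) by blast
  have bV1: "bounded V1"
  proof -
    obtain R where R: "\<And>x. x \<in> closure V \<Longrightarrow> norm x \<le> R"
      using compact_imp_bounded[OF cV] by (auto simp: bounded_iff)
    have "norm y \<le> R + d" if y: "y \<in> V1" for y
    proof -
      obtain k where k: "k \<in> closure V" "dist k y < d / 2" using y unfolding V1_def by auto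
      have "norm y \<le> norm k + dist k y" using norm_triangle_sub[of y k] by (simp add: dist_norm norm_minus_commute)
      also have "\<dots> \<le> R + d" using R[OF k(1)] k(2) d(1) by (intro add_mono) auto
      finally show ?thesis .
    qed
    then show ?thesis by (auto simp: bounded_iff)
  qed
  define v where "v = (\<lambda>x. \<zeta> x * u x)"
  define h where "h = (\<lambda>x. u x - v x)"
  define w' where "w' i = (\<lambda>x. partial i \<zeta> x * u x + \<zeta> x * g i x)" for i
  have v: "sqint v" unfolding v_def by (rule sqint_test_mult[OF \<zeta>(1) u])
  have sw': "sqint (w' i)" for i
    unfolding w'_def by (intro sqint_add sqint_test_mult[OF test_partial[OF \<zeta>(1)] u] sqint_test_mult[OF \<zeta>(1) g])
  have wv: "wpartial UNIV i v (w' i)" for i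
    unfolding v_def w'_def by (rule wpartial_mult_test[OF u g wpartial_mono[OF w] \<zeta>(1)]) simp
  have tu: "tame u" by (rule tame_weak[OF u g w])
  have tv: "tame v" by (rule tame_weak[OF v sw' wv])
  have th: "tame h" unfolding h_def by (rule tame_diff[OF tu tv])
  have vV1: "v x = u x" if "x \<in> V1" for x using V1W \<zeta>(5) that by (auto simp: v_def)
  have h0: "h x = 0" if "x \<in> W" for x using \<zeta>(5)[OF that] by (simp add: h_def v_def)
  have far: "\<delta> \<le> dist x y" if "x \<in> V1" "h y \<noteq> 0" for x y
    using nearW[OF that(1), of y] h0[of y] that(2) by force
  define G where "G = (\<lambda>x. conv h (rieszcut s \<delta>) x * indicator V1 x)"
  have sG: "sob k V1 G" for k
    unfolding G_def farcut_powr_eq_rieszcut[symmetric]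
    by (rule far_field_sob[OF s \<delta> tame_sqint[OF th] _ bV1 far kern.powr order.refl]) (use oV1 in auto)
  \<comment> \<open>Removing \<open>h\<close> from \<open>u\<close> subtracts
    \<open>c * nonlocal s h \<phi>\<close>, which equals -2c times the integral of \<open>G\<close>
    against \<phi>; hence the added term \<open>2 * c\<close>. As \<open>G\<close> is regular of
    every order on \<open>V1\<close>, the new datum is as regular as \<open>f\<close>.\<close>
  define F where "F = (\<lambda>x. f x + (2 * c) * G x)"
  have sF: "sob (Suc m) V1 F"
    unfolding F_def by (rule sob_add_cmult[OF sob_mono[OF sf V1\<Omega>] sG])
  have veq: "very_weak V1 s c v F"
    unfolding very_weak_def
  proof
    fix \<phi> assume \<phi>: "\<phi> \<in> test_functions V1"
    have e1: "v x * partial j (partial j \<phi>) x = u x * partial j (partial j \<phi>) x" for x j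
      using vV1[of x] test_zero_outside[OF test_partial[OF test_partial[OF \<phi>]], of x] by (cases "x \<in> V1") auto
    have 1: "(LINT x|lborel. v x * partial j (partial j \<phi>) x) = (LINT x|lborel. u x * partial j (partial j \<phi>) x)" for j
      unfolding e1 ..
    have "v = (\<lambda>x. u x - h x)" by (simp add: h_def)
    then have 2: "nonlocal s v \<phi> = nonlocal s u \<phi> - nonlocal s h \<phi>"
      using nonlocal_diff_left[OF s tu th tame_test[OF \<phi>]] by simp
    have "\<delta> \<le> dist x y" if "h x \<noteq> 0" "\<phi> y \<noteq> 0" for x y
      using far[of y x] that test_zero_outside[OF \<phi>, of y] by (auto simp: dist_commute)
    then have nl: "nonlocal s h \<phi> = - 2 * (LINT x|lborel. conv h (rieszcut s \<delta>) x * \<phi> x)"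
      by (rule nonlocal_disjoint_support[OF s \<delta> tame_sqint[OF th] test_sqint[OF \<phi>]])
    have e2: "conv h (rieszcut s \<delta>) x * \<phi> x = G x * \<phi> x" for x
      using test_zero_outside[OF \<phi>, of x] by (cases "x \<in> V1") (auto simp: G_def)
    from nl have 3: "nonlocal s h \<phi> = - 2 * (LINT x|lborel. G x * \<phi> x)" unfolding e2 .
    have "(LINT x|lborel. F x * \<phi> x) = (LINT x|lborel. f x * \<phi> x) + 2 * c * (LINT x|lborel. G x * \<phi> x)"
      using integrable_mult_sqint[OF f test_sqint[OF \<phi>]] integrable_mult_sqint[OF sob_sqint[OF sG] test_sqint[OF \<phi>]]
      by (simp add: F_def distrib_right mult.assoc)
    moreover have "- (\<Sum>j\<in>UNIV. LINT x|lborel. u x * partial j (partial j \<phi>) x) + c * nonlocal s u \<phi> = (LINT x|lborel. f x * \<phi> x)"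
      using eq test_mono[OF \<phi> V1\<Omega>] unfolding very_weak_def by blast
    ultimately show "- (\<Sum>j\<in>UNIV. LINT x|lborel. v x * partial j (partial j \<phi>) x) + c * nonlocal s v \<phi> = (LINT x|lborel. F x * \<phi> x)"
      unfolding 1 2 3 by (simp add: algebra_simps)
  qed
  \<comment> \<open>The induction hypothesis asks for weak derivatives of \<open>w' i\<close> on the
    whole space. The part with \<open>\<zeta> x * g i x\<close> is covered by
    \<open>interior_H2\<close>; the part with \<open>partial i \<zeta> x * u x\<close> needs only
    the first derivatives of \<open>u\<close>.\<close>
  have "sob (m + 2) V (w' i)" for i
  proof -
    have "\<exists>p. sqint p \<and> wpartial UNIV j (w' i) p" for j
    proof -
      obtain p where p: "sqint p" "wpartial UNIV j (\<lambda>x. \<zeta> x * g i x) p"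
        using interior_H2[OF s c \<Omega> u g w f eq \<zeta>(1)] by blast
      let ?q = "\<lambda>x. partial j (partial i \<zeta>) x * u x + partial i \<zeta> x * g j x"
      have q: "wpartial UNIV j (\<lambda>x. partial i \<zeta> x * u x) ?q"
        by (rule wpartial_mult_test[OF u g wpartial_mono[OF w] test_partial[OF \<zeta>(1)]]) simp
      have sq: "sqint ?q"
        by (intro sqint_add sqint_test_mult[OF test_partial[OF test_partial[OF \<zeta>(1)]] u] sqint_test_mult[OF test_partial[OF \<zeta>(1)] g])
      have "wpartial UNIV j (\<lambda>x. partial i \<zeta> x * u x + 1 * (\<zeta> x * g i x)) (\<lambda>x. ?q x + 1 * p x)"
        by (rule wpartial_add_cmult[OF sqint_test_mult[OF test_partial[OF \<zeta>(1)] u] sqint_test_mult[OF \<zeta>(1) g] sq p(1) q p(2)])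
      moreover have "sqint (\<lambda>x. ?q x + 1 * p x)" using sqint_add[OF sq p(1)] by simp
      ultimately show ?thesis unfolding w'_def by (intro exI[of _ "\<lambda>x. ?q x + 1 * p x"]) simp
    qed
    then obtain p where p: "\<And>j. sqint (p j)" "\<And>j. wpartial UNIV j (w' i) (p j)" by metis
    obtain Fi where Fi: "sob m V1 Fi" "wpartial V1 i F Fi" using sF by auto
    have "very_weak V1 s c (w' i) Fi"
      unfolding very_weak_def
    proof
      fix \<phi> assume \<phi>: "\<phi> \<in> test_functions V1"
      show "- (\<Sum>j\<in>UNIV. LINT x|lborel. w' i x * partial j (partial j \<phi>) x) + c * nonlocal s (w' i) \<phi> = (LINT x|lborel. Fi x * \<phi> x)"
        using very_weak_derivative[OF v sw' wv veq \<phi>] wpartialD[OF Fi(2) \<phi>] by simp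
    qed
    then show ?thesis by (rule Suc.IH[OF oV1 sw' p Fi(1) _ cV VV1])
  qed
  moreover have "wpartial V i u (w' i)" for i
  proof (rule wpartial_cong[OF wpartial_mono[OF wv]])
    show "v x = u x" if "x \<in> V" for x using vV1 VV1 closure_subset[of V] that by blast
  qed simp
  ultimately have "sob (Suc (m + 2)) V u" using u by (simp only: sob.simps) blast
  then show ?case by (simp only: add_Suc)
qed

subsection \<open>Borel representatives\<close>

text \<open>The function is extended by zero outside \<open>U\<close> before a Borel version is
  chosen, which makes the representative square-integrable on the whole space.\<close>

lemma borel_representative:
  fixes u :: "real^'n::finite \<Rightarrow> real"
  assumes U: "open U" and u: "u \<in> L2 U"
  obtains u' where "sqint u'" "AE x in lborel. x \<in> U \<longrightarrow> u x = u' x"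
proof -
  have UL: "U \<inter> space lebesgue \<in> sets lebesgue" using U by simp
  let ?g = "\<lambda>x. indicator U x *\<^sub>R u x"
  have "?g \<in> borel_measurable lebesgue"
    using u borel_measurable_restrict_space_iff[OF UL, of u] by (simp add: L2_def)
  from completion_ex_borel_measurable_real[OF this]
  obtain u' where u': "u' \<in> borel_measurable lborel" "AE x in lborel. ?g x = u' x" by auto
  have [measurable]: "u' \<in> borel_measurable borel" using u'(1) by simp
  have "integrable lebesgue (\<lambda>x. indicator U x *\<^sub>R (u x)\<^sup>2)"
    using u integrable_restrict_space[OF UL, of "\<lambda>x. (u x)\<^sup>2"] by (simp add: L2_def)
  moreover have "(\<lambda>x. (u' x)\<^sup>2) \<in> borel_measurable lebesgue" by (intro measurable_completion) measurable
  moreover have "AE x in lebesgue. indicator U x *\<^sub>R (u x)\<^sup>2 = (u' x)\<^sup>2"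
    using AE_completion[OF u'(2)] by eventually_elim (auto simp: indicator_def split: if_splits)
  ultimately have "integrable lebesgue (\<lambda>x. (u' x)\<^sup>2)" by (rule integrable_cong_AE_imp)
  then have "integrable lborel (\<lambda>x. (u' x)\<^sup>2)" using u'(1) by (subst (asm) integrable_completion) auto
  then have "sqint u'" using u'(1) by (simp add: sqint_def)
  moreover have "AE x in lborel. x \<in> U \<longrightarrow> u x = u' x"
    using u'(2) by eventually_elim auto
  ultimately show thesis by (rule that)
qed

lemma
  fixes F F' :: "real^'n::finite \<Rightarrow> real"
  assumes U: "open U" and F' [measurable]: "F' \<in> borel_measurable borel"
    and AE: "AE x in lborel. x \<in> U \<longrightarrow> F x = F' x"
  shows lebesgue_on_measurable_rep: "F \<in> borel_measurable (lebesgue_on U)"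
    and lebesgue_on_integrable_rep: "integrable lborel F' \<Longrightarrow> integrable (lebesgue_on U) F"
    and lebesgue_on_integral_rep: "(\<And>x. x \<notin> U \<Longrightarrow> F' x = 0) \<Longrightarrow> (LINT x|lebesgue_on U. F x) = (LINT x|lborel. F' x)"
proof -
  have UL: "U \<inter> space lebesgue \<in> sets lebesgue" using U by simp
  have [measurable]: "U \<in> sets borel" using U by simp
  have m': "(\<lambda>x. indicator U x *\<^sub>R F' x) \<in> borel_measurable borel" by measurable
  then have m'': "(\<lambda>x. indicator U x *\<^sub>R F' x) \<in> borel_measurable lebesgue"
    by (intro measurable_completion) simp
  have ae: "AE x in lebesgue. indicator U x *\<^sub>R F' x = indicator U x *\<^sub>R F x"
    using AE_completion[OF AE] by eventually_elim (auto simp: indicator_def)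
  have m: "(\<lambda>x. indicator U x *\<^sub>R F x) \<in> borel_measurable lebesgue"
    by (rule borel_measurable_AE[OF m'' ae])
  show "F \<in> borel_measurable (lebesgue_on U)"
    using m borel_measurable_restrict_space_iff[OF UL, of F] by simp
  show "integrable (lebesgue_on U) F" if i: "integrable lborel F'"
  proof -
    have "integrable lborel (\<lambda>x. indicator U x *\<^sub>R F' x)"
      using i by (intro integrable_mult_indicator) auto
    then have "integrable lebesgue (\<lambda>x. indicator U x *\<^sub>R F' x)"
      using m' by (subst integrable_completion) auto
    from integrable_cong_AE_imp[OF this m ae] show ?thesis
      using integrable_restrict_space[OF UL, of F] by simp
  qed
  show "(LINT x|lebesgue_on U. F x) = (LINT x|lborel. F' x)" if z: "\<And>x. x \<notin> U \<Longrightarrow> F' x = 0"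
  proof -
    have e: "(\<lambda>x. indicator U x *\<^sub>R F' x) = F'"
      by (rule ext) (use z in \<open>auto simp: indicator_def\<close>)
    have "(LINT x|lebesgue_on U. F x) = (LINT x|lebesgue. indicator U x *\<^sub>R F x)"
      by (rule integral_restrict_space[OF UL])
    also have "\<dots> = (LINT x|lebesgue. indicator U x *\<^sub>R F' x)"
    proof (rule integral_cong_AE[OF m m''])
      show "AE x in lebesgue. indicator U x *\<^sub>R F x = indicator U x *\<^sub>R F' x"
        using ae by eventually_elim (rule sym)
    qed
    also have "\<dots> = (LINT x|lborel. F' x)"
      unfolding e by (rule integral_completion) simp
    finally show ?thesis .
  qed
qed

lemma L2_rep:
  fixes u :: "real^'n::finite \<Rightarrow> real"
  assumes U: "open U" and u': "sqint u'" and AE: "AE x in lborel. x \<in> U \<longrightarrow> u x = u' x"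
  shows "u \<in> L2 U"
proof -
  note [measurable] = sqint_measurable[OF u']
  have "AE x in lborel. x \<in> U \<longrightarrow> (u x)\<^sup>2 = (u' x)\<^sup>2" using AE by eventually_elim auto
  then have "integrable (lebesgue_on U) (\<lambda>x. (u x)\<^sup>2)"
    by (intro lebesgue_on_integrable_rep[OF U _ _ sqint_integrable[OF u']]) auto
  moreover have "u \<in> borel_measurable (lebesgue_on U)"
    by (rule lebesgue_on_measurable_rep[OF U _ AE]) simp
  ultimately show ?thesis by (simp add: L2_def)
qed

lemma test_partials: "\<phi> \<in> test_functions U \<Longrightarrow> partials is \<phi> \<in> test_functions U"
  by (induction "is") (auto intro: test_partial)

lemma lebesgue_on_integral_test:
  fixes u :: "real^'n::finite \<Rightarrow> real"
  assumes U: "open U" and u': "sqint u'" and AE: "AE x in lborel. x \<in> U \<longrightarrow> u x = u' x"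
    and \<phi>: "\<phi> \<in> test_functions U"
  shows "(LINT x|lebesgue_on U. u x * \<phi> x) = (LINT x|lborel. u' x * \<phi> x)"
proof (rule lebesgue_on_integral_rep[OF U])
  note [measurable] = sqint_measurable[OF u'] test_measurable[OF \<phi>]
  show "(\<lambda>x. u' x * \<phi> x) \<in> borel_measurable borel" by measurable
  show "AE x in lborel. x \<in> U \<longrightarrow> u x * \<phi> x = u' x * \<phi> x" using AE by eventually_elim auto
  show "u' x * \<phi> x = 0" if "x \<notin> U" for x using test_zero_outside[OF \<phi> that] by simp
qed

lemma weak_derivative_rep:
  fixes u g :: "real^'n::finite \<Rightarrow> real"
  assumes U: "open U" and u': "sqint u'" "AE x in lborel. x \<in> U \<longrightarrow> u x = u' x"
    and g': "sqint g'" "AE x in lborel. x \<in> U \<longrightarrow> g x = g' x"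
  shows "weak_derivative U is u g \<longleftrightarrow> (\<forall>\<phi>\<in>test_functions U.
    (LINT x|lborel. u' x * partials is \<phi> x) = (-1) ^ length is * (LINT x|lborel. g' x * \<phi> x))"
  unfolding weak_derivative_def
  by (intro ball_cong refl) (simp only: lebesgue_on_integral_test[OF U u' test_partials] lebesgue_on_integral_test[OF U g'])

lemma weak_derivative_single_rep:
  fixes u g :: "real^'n::finite \<Rightarrow> real"
  assumes U: "open U" and u': "sqint u'" "AE x in lborel. x \<in> U \<longrightarrow> u x = u' x"
    and g': "sqint g'" "AE x in lborel. x \<in> U \<longrightarrow> g x = g' x"
  shows "weak_derivative U [i] u g \<longleftrightarrow> wpartial U i u' g'"
  unfolding weak_derivative_rep[OF assms] wpartial_def by simp

text \<open>A derivative of \<open>u\<close> along \<open>i # is\<close> is a derivative along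
  \<open>is\<close> of the first weak derivative \<open>g\<close>: since \<open>partials\<close>
  applies the head of the list last, it suffices to test the relation for \<open>g\<close> with
  \<open>partials is \<phi>\<close>.\<close>

lemma sobolev_imp_sob:
  fixes u :: "real^'n::finite \<Rightarrow> real"
  assumes U: "open U"
  shows "u \<in> sobolev m U \<Longrightarrow> sqint u' \<Longrightarrow> AE x in lborel. x \<in> U \<longrightarrow> u x = u' x \<Longrightarrow> sob m U u'"
proof (induction m arbitrary: u u')
  case (Suc m)
  have "\<exists>g'. sob m U g' \<and> wpartial U i u' g'" for i
  proof -
    obtain g where g: "g \<in> L2 U" "weak_derivative U [i] u g"
      using Suc.prems(1) unfolding sobolev_def by (auto dest: spec[of _ "[i]"])
    obtain g' where g': "sqint g'" "AE x in lborel. x \<in> U \<longrightarrow> g x = g' x"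
      by (rule borel_representative[OF U g(1)])
    have "\<exists>G\<in>L2 U. weak_derivative U is g G" if len: "length is \<le> m" for "is"
    proof -
      obtain G where G: "G \<in> L2 U" "weak_derivative U (i # is) u G"
        using Suc.prems(1) len unfolding sobolev_def by (auto dest: spec[of _ "i # is"])
      have "weak_derivative U is g (\<lambda>x. G x)"
        unfolding weak_derivative_def
      proof
        fix \<phi> assume \<phi>: "\<phi> \<in> test_functions U"
        have "(LINT x|lebesgue_on U. u x * partials (i # is) \<phi> x) = (-1) ^ length (i # is) * (LINT x|lebesgue_on U. G x * \<phi> x)"
          using G(2) \<phi> unfolding weak_derivative_def by blast
        moreover have "(LINT x|lebesgue_on U. u x * partials [i] (partials is \<phi>) x) = (-1) ^ length [i] * (LINT x|lebesgue_on U. g x * partials is \<phi> x)"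
          using g(2) test_partials[OF \<phi>] unfolding weak_derivative_def by blast
        ultimately show "(LINT x|lebesgue_on U. g x * partials is \<phi> x) = (-1) ^ length is * (LINT x|lebesgue_on U. G x * \<phi> x)"
          by simp
      qed
      with G(1) show ?thesis by blast
    qed
    then have "g \<in> sobolev m U" using g(1) by (simp add: sobolev_def)
    then have "sob m U g'" using g' by (rule Suc.IH)
    moreover have "wpartial U i u' g'"
      using g(2) weak_derivative_single_rep[OF U Suc.prems(2,3) g'] by simp
    ultimately show ?thesis by blast
  qed
  then show ?case using Suc.prems by simp
qed simp

lemma sob_weak_derivative:
  fixes u :: "real^'n::finite \<Rightarrow> real"
  shows "sob m U u \<Longrightarrow> length is \<le> m \<Longrightarrow> \<exists>g. sqint g \<and> (\<forall>\<phi>\<in>test_functions U.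
    (LINT x|lborel. u x * partials is \<phi> x) = (-1) ^ length is * (LINT x|lborel. g x * \<phi> x))"
proof (induction "is" arbitrary: m u)
  case Nil
  then show ?case using sob_sqint by (intro exI[of _ u]) auto
next
  case (Cons i "is")
  then obtain m' where m': "m = Suc m'" by (cases m) auto
  obtain v where v: "sob m' U v" "wpartial U i u v" using Cons.prems(1) m' by auto
  obtain g where g: "sqint g" "\<And>\<phi>. \<phi> \<in> test_functions U \<Longrightarrow>
    (LINT x|lborel. v x * partials is \<phi> x) = (-1) ^ length is * (LINT x|lborel. g x * \<phi> x)"
    using Cons.IH[OF v(1)] Cons.prems(2) m' by auto
  have "(LINT x|lborel. u x * partials (i # is) \<phi> x) = (-1) ^ length (i # is) * (LINT x|lborel. g x * \<phi> x)"
    if "\<phi> \<in> test_functions U" for \<phi>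
    using wpartialD[OF v(2) test_partials[OF that]] g(2)[OF that] by simp
  with g(1) show ?case by blast
qed

lemma sob_imp_sobolev:
  fixes u :: "real^'n::finite \<Rightarrow> real"
  assumes U: "open U" and u': "sob m U u'" and AE: "AE x in lborel. x \<in> U \<longrightarrow> u x = u' x"
  shows "u \<in> sobolev m U"
  unfolding sobolev_def
proof (intro CollectI conjI allI impI)
  show "u \<in> L2 U" by (rule L2_rep[OF U sob_sqint[OF u'] AE])
  fix "is" :: "'n list" assume "length is \<le> m"
  from sob_weak_derivative[OF u' this] obtain g where g: "sqint g" "\<forall>\<phi>\<in>test_functions U.
    (LINT x|lborel. u' x * partials is \<phi> x) = (-1) ^ length is * (LINT x|lborel. g x * \<phi> x)" by blast
  have "g \<in> L2 U" by (rule L2_rep[OF U g(1)]) simp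
  moreover have "weak_derivative U is u g"
    using weak_derivative_rep[OF U sob_sqint[OF u'] AE g(1), of g "is"] g(2) by simp
  ultimately show "\<exists>g\<in>L2 U. weak_derivative U is u g" by blast
qed

text \<open>Changing \<open>u\<close> on a null set affects only pairs with a coordinate in that
  set, and these form a null set of the product.\<close>

lemma double_integral_rep:
  fixes u u' \<phi> :: "real^'n::finite \<Rightarrow> real"
  assumes s: "0 < s" "s < 1" and u': "tame u'" and \<phi>: "tame \<phi>" and AE: "AE x in lborel. u x = u' x"
  shows "(LINT (x, y)|lebesgue. (u x - u y) * (\<phi> x - \<phi> y) / norm (x - y) powr (real CARD('n) + 2 * s)) = nonlocal s u' \<phi>"
proof -
  note [measurable] = sqint_measurable[OF tame_sqint[OF u']] sqint_measurable[OF tame_sqint[OF \<phi>]]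
  let ?k = "\<lambda>u. \<lambda>(x, y). (u x - u y) * (\<phi> x - \<phi> y) / norm (x - y) powr (real CARD('n) + 2 * s)"
  obtain N where N: "N \<in> null_sets lborel" "{x. u x \<noteq> u' x} \<subseteq> N" using AE by (auto elim!: AE_E3 simp: eventually_ae_filter)
  have [measurable]: "N \<in> sets borel" using N(1) by auto
  have Nae: "AE x in lborel. x \<notin> N" using N(1) by (rule AE_not_in)
  have ae: "AE p in (lborel \<Otimes>\<^sub>M lborel :: ((real^'n) \<times> (real^'n)) measure). fst p \<notin> N \<and> snd p \<notin> N"
  proof (rule lborel_pair.AE_pair_measure)
    show "{p \<in> space (lborel \<Otimes>\<^sub>M lborel :: ((real^'n) \<times> (real^'n)) measure). fst p \<notin> N \<and> snd p \<notin> N} \<in> sets (lborel \<Otimes>\<^sub>M lborel)"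
      by measurable
    show "AE x in lborel. AE y in lborel. fst (x, y) \<notin> N \<and> snd (x, y) \<notin> N"
      using Nae by eventually_elim (use Nae in auto)
  qed
  then have "AE p in lborel. ?k u' p = ?k u p"
    unfolding lborel_prod
  proof eventually_elim
    case (elim p)
    then have "u (fst p) = u' (fst p)" "u (snd p) = u' (snd p)" using N(2) by auto
    then show ?case by (simp add: case_prod_beta')
  qed
  then have ae: "AE p in lebesgue. ?k u' p = ?k u p" by (rule AE_completion)
  have m': "?k u' \<in> borel_measurable lborel" unfolding lborel_prod[symmetric] by measurable
  then have m: "?k u' \<in> borel_measurable lebesgue" by (rule measurable_completion)
  have "(LINT p|lebesgue. ?k u p) = (LINT p|lebesgue. ?k u' p)"
    by (rule integral_cong_AE[OF borel_measurable_AE[OF m ae] m]) (use ae in \<open>eventually_elim, simp\<close>)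
  also have "\<dots> = (LINT p|lborel. ?k u' p)" by (rule integral_completion[OF m'])
  also have "\<dots> = nonlocal s u' \<phi>" by (rule double_integral_eq_nonlocal[OF s u' \<phi>])
  finally show ?thesis .
qed

text \<open>The sign allows the lower bound of \<open>nonlocal_coercive\<close> to be multiplied by
  the constant; it is read off from the integrand.\<close>

lemma frac_const_nonneg: "0 \<le> frac_const TYPE('n::finite) s"
  unfolding frac_const_def frac_integral_def
  by (intro iffD2[OF inverse_nonnegative_iff_nonnegative] Bochner_Integration.integral_nonneg divide_nonneg_nonneg) auto

theorem theorem1p4:
  fixes \<Omega> :: "(real^'n::finite) set" and s :: real and m :: nat
    and f u :: "real^'n \<Rightarrow> real"
  assumes "open \<Omega>" and "bounded \<Omega>" and "C1_boundary \<Omega>"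
    and "0 < s" and "s < 1"
    and "f \<in> sobolev m \<Omega>"
    and "u \<in> sobolev 1 UNIV"
    and "weak_solution \<Omega> s f u"
  shows "u \<in> sobolev_loc (m + 2) \<Omega>"
proof -
  define c where "c = frac_const TYPE('n) s / 2"
  have c: "0 \<le> c" using frac_const_nonneg[where 'n='n, of s] by (simp add: c_def)
  note s = \<open>0 < s\<close> \<open>s < 1\<close>
  obtain G where G: "weak_gradient UNIV u G" and eq: "\<And>\<phi>. \<phi> \<in> test_functions \<Omega> \<Longrightarrow>
        (LINT x|lebesgue_on \<Omega>. G x \<bullet> grad \<phi> x) +
        c * (LINT (x, y)|lebesgue. (u x - u y) * (\<phi> x - \<phi> y) / norm (x - y) powr (real CARD('n) + 2 * s)) =
        (LINT x|lebesgue_on \<Omega>. f x * \<phi> x)"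
    using \<open>weak_solution \<Omega> s f u\<close> unfolding weak_solution_def c_def by blast
  have "u \<in> L2 UNIV" using \<open>u \<in> sobolev 1 UNIV\<close> by (simp add: sobolev_def)
  then obtain u' where u': "sqint u'" "AE x in lborel. x \<in> UNIV \<longrightarrow> u x = u' x"
    by (rule borel_representative[OF open_UNIV])
  have "\<exists>g. sqint g \<and> (AE x in lborel. x \<in> UNIV \<longrightarrow> G x $ i = g x)" for i
  proof -
    have "(\<lambda>x. G x $ i) \<in> L2 UNIV" using G by (simp add: weak_gradient_def)
    then show ?thesis by (rule borel_representative[OF open_UNIV]) blast
  qed
  then obtain g where g: "\<And>i. sqint (g i)" "\<And>i. AE x in lborel. x \<in> UNIV \<longrightarrow> G x $ i = g i x" by metis
  have w: "wpartial UNIV i u' (g i)" for i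
    using G weak_derivative_single_rep[OF open_UNIV u' g] by (simp add: weak_gradient_def)
  have tu: "tame u'" by (rule tame_weak[OF u'(1) g(1) w])
  have "f \<in> L2 \<Omega>" using \<open>f \<in> sobolev m \<Omega>\<close> by (simp add: sobolev_def)
  then obtain f' where f': "sqint f'" "AE x in lborel. x \<in> \<Omega> \<longrightarrow> f x = f' x"
    by (rule borel_representative[OF \<open>open \<Omega>\<close>])
  have sf: "sob m \<Omega> f'" by (rule sobolev_imp_sob[OF \<open>open \<Omega>\<close> \<open>f \<in> sobolev m \<Omega>\<close> f'])
  have vw: "very_weak \<Omega> s c u' f'"
    unfolding very_weak_def
  proof
    fix \<phi> assume \<phi>: "\<phi> \<in> test_functions \<Omega>"
    note [measurable] = sqint_measurable[OF g(1)] test_measurable[OF test_partial[OF \<phi>]]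
    have "(LINT x|lebesgue_on \<Omega>. G x \<bullet> grad \<phi> x) = (LINT x|lborel. (\<Sum>j\<in>UNIV. g j x * partial j \<phi> x))"
    proof (rule lebesgue_on_integral_rep[OF \<open>open \<Omega>\<close>])
      have "AE x in lborel. \<forall>j\<in>UNIV. G x $ j = g j x"
        using g(2) by (intro AE_finite_allI) auto
      then show "AE x in lborel. x \<in> \<Omega> \<longrightarrow> G x \<bullet> grad \<phi> x = (\<Sum>j\<in>UNIV. g j x * partial j \<phi> x)"
        by eventually_elim (simp add: inner_vec_def grad_def)
      show "(\<Sum>j\<in>UNIV. g j x * partial j \<phi> x) = 0" if "x \<notin> \<Omega>" for x
        using test_zero_outside[OF test_partial[OF \<phi>] that] by simp
    qed measurable
    also have "\<dots> = (\<Sum>j\<in>UNIV. LINT x|lborel. g j x * partial j \<phi> x)"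
      by (intro Bochner_Integration.integral_sum integrable_mult_sqint g(1) test_sqint[OF test_partial[OF \<phi>]])
    \<comment> \<open>One more integration by parts against the weak derivative of
      \<open>u'\<close>, because \<open>partial j \<phi>\<close> is again a test function: this
      passes from the weak to the very weak form.\<close>
    also have "\<dots> = - (\<Sum>j\<in>UNIV. LINT x|lborel. u' x * partial j (partial j \<phi>) x)"
    proof -
      have "(LINT x|lborel. u' x * partial j (partial j \<phi>) x) = - (LINT x|lborel. g j x * partial j \<phi> x)" for j
        by (rule wpartialD[OF w test_mono[OF test_partial[OF \<phi>] subset_UNIV]])
      then show ?thesis by (simp add: sum_negf)
    qed
    finally have 1: "(LINT x|lebesgue_on \<Omega>. G x \<bullet> grad \<phi> x) = - (\<Sum>j\<in>UNIV. LINT x|lborel. u' x * partial j (partial j \<phi>) x)" .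
    have "AE x in lborel. u x = u' x" using u'(2) by simp
    note 2 = double_integral_rep[OF s tu tame_test[OF \<phi>] this]
    note 3 = lebesgue_on_integral_test[OF \<open>open \<Omega>\<close> f' \<phi>]
    show "- (\<Sum>j\<in>UNIV. LINT x|lborel. u' x * partial j (partial j \<phi>) x) + c * nonlocal s u' \<phi> = (LINT x|lborel. f' x * \<phi> x)"
      using eq[OF \<phi>] unfolding 1 2 3 .
  qed
  show ?thesis
    unfolding sobolev_loc_def
  proof (intro CollectI allI impI)
    fix V :: "(real^'n) set" assume V: "open V \<and> compact (closure V) \<and> closure V \<subseteq> \<Omega>"
    have "sob (m + 2) V u'"
      by (rule interior_regularity[OF s c \<open>open \<Omega>\<close> u'(1) g(1) w sf vw]) (use V in auto)
    then show "u \<in> sobolev (m + 2) V"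
      by (rule sob_imp_sobolev[rotated]) (use V u'(2) in auto)
  qed
qed

end
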